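(* Let $\mathbb F$ be a skew field (possibly a field) of characteristic not $2$ that is finite dimensional over its center. Let $a\mapsto a^{\complement}$ be an involutory automorphism of $\mathbb F$ (possibly the identity) and let $a\mapsto a^{\circ}$ be an involutory anti-automorphism of $\mathbb F$ (possibly the identity if $\mathbb F$ is a field). For each matrix $A$ over $\mathbb F$ put $A^{\dagger}:=(A^{\circ})^{\top}$ and $A^{*}:=((A^{\complement})^{\circ})^{\top}$, where $\complement$ and $\circ$ are applied entrywise. Consider a system of matrix equations over $\mathbb F$ $$A_iX_{i'}^{\varepsilon_i}M_i-N_iX_{i''}^{\delta_i}B_i=C_i,\qquad i=1,\dots,s,$$ with unknown matrices $X_1,\dots,X_t$ (of prescribed sizes compatible with the given matrices $A_i,B_i,C_i,M_i,N_i$), in which $i',i''\in\{1,\dots,t\}$ (indices depending on $i$) and $\varepsilon_i,\delta_i\in\{1,\complement,\dagger,*\}$ for every $i$. This system has a solution if and only if there exist nonsingular matrices $P_1,\dots,P_t,\ Q_1,\dots,Q_s,\ R_1,\dots,R_s$ over $\mathbb F$ satisfying the following $3s$ equalities, for $i=1,\dots,s$: $$\begin{bmatrix}A_i&0\\0&B_i\end{bmatrix}Q_i=R_i\begin{bmatrix}A_i&C_i\\0&B_i\end{bmatrix},\qquad \begin{bmatrix}I&0\\0&M_i\end{bmatrix}Q_i=P_{i'}^{\langle\varepsilon_i\rangle}\begin{bmatrix}I&0\\0&M_i\end{bmatrix},\qquad \begin{bmatrix}N_i&0\\0&I\end{bmatrix}P_{i''}^{\langle\delta_i\rangle}=R_i\begin{bmatrix}N_i&0\\0&I\end{bmatrix},$$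 where $$P^{\langle\sigma\rangle}:=\begin{cases}P^{\sigma}&\text{if }\sigma\in\{1,\complement\},\\ J(P^{\sigma})^{-1}J^{-1}&\text{if }\sigma\in\{\dagger,*\},\end{cases}\qquad J:=\begin{bmatrix}0&I\\-I&0\end{bmatrix}.$$
   Context: An involutory automorphism of $\mathbb F$ is a bijection $a\mapsto a^{\complement}$ of $\mathbb F$ onto itself with $(a+b)^{\complement}=a^{\complement}+b^{\complement}$, $(ab)^{\complement}=a^{\complement}b^{\complement}$, $(a^{\complement})^{\complement}=a$ for all $a,b\in\mathbb F$. An involutory anti-automorphism of $\mathbb F$ is a bijection $a\mapsto a^{\circ}$ with $(a+b)^{\circ}=a^{\circ}+b^{\circ}$, $(ab)^{\circ}=b^{\circ}a^{\circ}$, $(a^{\circ})^{\circ}=a$ for all $a,b\in\mathbb F$. For a matrix $A$, $A^{1}:=A$, and $A^{\complement}$, $A^{\circ}$ are obtained by applying the map to each entry. Sizes: each unknown $X_j$ has a prescribed size $m_j\times n_j$ (so $X_j^{\sigma}$ is $m_j\times n_j$ for $\sigma\in\{1,\complement\}$ and $n_j\times m_j$ for $\sigma\in\{\dagger,*\}$). If $X_{i'}^{\varepsilon_i}$ is $p_i\times q_i$ and $X_{i''}^{\delta_i}$ is $p_i'\times q_i'$, then $A_i$ is $k_i\times p_i$, $M_i$ is $q_i\times r_i$, $N_i$ is $k_i\times p_i'$, $B_i$ is $q_i'\times r_i$, and $C_i$ is $k_i\times r_i$ for some $k_i,r_i$. The matrix $P_j$ is square of size $m_j+n_j$, partitioned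 conformally with $\begin{bmatrix}I_{m_j}&X_j\\0&I_{n_j}\end{bmatrix}$; $Q_i$ is square of size $p_i+r_i$; $R_i$ is square of size $k_i+q_i'$. The identity block in $\begin{bmatrix}I&0\\0&M_i\end{bmatrix}$ is $I_{p_i}$ and the one in $\begin{bmatrix}N_i&0\\0&I\end{bmatrix}$ is $I_{q_i'}$. In the definition of $P_j^{\langle\sigma\rangle}$ with $\sigma\in\{\dagger,*\}$, $J=\begin{bmatrix}0&I_{n_j}\\-I_{m_j}&0\end{bmatrix}$. *)

theory Defs
  imports
    "Jordan_Normal_Form.VS_Connect"
    "HOL-Algebra.Embedded_Algebras"
begin

text \<open>
  A skew field is a type of class \<^class>\<open>division_ring\<close>. The record
  \<^term>\<open>class_ring\<close> is its view as a ring with carrier \<^term>\<open>UNIV\<close>.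
\<close>

definition ring_center :: "'a::division_ring set" where
  "ring_center = {z. \<forall>a. z * a = a * z}"

definition finite_dimensional_over_center :: "'a::division_ring itself \<Rightarrow> bool" where
  "finite_dimensional_over_center _ \<longleftrightarrow>
     ring.finite_dimension (class_ring :: 'a ring) ring_center UNIV"

definition involutory_automorphism :: "('a::division_ring \<Rightarrow> 'a) \<Rightarrow> bool" where
  "involutory_automorphism c \<longleftrightarrow> bij c \<and> (\<forall>a b. c (a + b) = c a + c b) \<and>
     (\<forall>a b. c (a * b) = c a * c b) \<and> (\<forall>a. c (c a) = a)"

definition involutory_anti_automorphism :: "('a::division_ring \<Rightarrow> 'a) \<Rightarrow> bool" where
  "involutory_anti_automorphism d \<longleftrightarrow> bij d \<and> (\<forall>a b. d (a + b) = d a + d b) \<and>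
     (\<forall>a b. d (a * b) = d b * d a) \<and> (\<forall>a. d (d a) = a)"

text \<open>
  The constant \<open>ring.finite_dimension\<close> has its intended meaning only for a subfield of a ring,
  which the following two lemmas provide.
\<close>

lemma ring_of_division_ring: "ring (class_ring :: 'a::division_ring ring)"
proof -
  have "\<exists>y. y + x = 0 \<and> x + y = 0" for x :: 'a
    by (rule exI[of _ "- x"]) simp
  then show ?thesis
    by unfold_locales (auto simp: algebra_simps Units_def)
qed

lemma subfield_ring_center:
  "subfield ring_center (class_ring :: 'a::division_ring ring)"
proof -
  let ?R = "class_ring :: 'a ring"
  note R = ring_of_division_ring[where ?'a = 'a]
  have sel: "carrier ?R = UNIV" "x \<otimes>\<^bsub>?R\<^esub> y = x * y" "x \<oplus>\<^bsub>?R\<^esub> y = x + y"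
    "\<one>\<^bsub>?R\<^esub> = 1" "\<zero>\<^bsub>?R\<^esub> = 0" for x y :: 'a
    by simp_all
  have neg: "\<ominus>\<^bsub>?R\<^esub> x = - x" for x :: 'a
    by (rule abelian_group.minus_equality[OF ring.is_abelian_group[OF R]]) (simp_all add: sel)
  have inv: "inverse x \<in> ring_center" if "x \<in> ring_center" "x \<noteq> 0" for x :: 'a
    unfolding ring_center_def
  proof (intro CollectI allI)
    fix a
    have "inverse x * a = inverse x * (a * x) * inverse x"
      using that(2) by (simp add: mult.assoc)
    also have "a * x = x * a"
      using that(1) by (simp add: ring_center_def)
    also have "inverse x * (x * a) * inverse x = a * inverse x"
      using that(2) by (simp flip: mult.assoc)
    finally show "inverse x * a = a * inverse x" .
  qed
  have "subring ring_center ?R"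
  proof (rule ring.subringI[OF R])
    fix x y :: 'a
    assume xy: "x \<in> ring_center" "y \<in> ring_center"
    then have "x * y * a = a * (x * y)" for a
      by (metis (mono_tags, lifting) mem_Collect_eq mult.assoc ring_center_def)
    then show "x \<otimes>\<^bsub>?R\<^esub> y \<in> ring_center"
      by (simp add: sel ring_center_def)
    show "x \<oplus>\<^bsub>?R\<^esub> y \<in> ring_center"
      using xy by (simp add: sel ring_center_def distrib_left distrib_right)
  qed (simp_all add: sel neg ring_center_def)
  then have "subcring ring_center ?R"
    by (rule ring.subcringI[OF R]) (unfold sel ring_center_def, blast)
  moreover have "Units (?R\<lparr>carrier := ring_center\<rparr>) = ring_center - {\<zero>\<^bsub>?R\<^esub>}"
  proof (intro equalityI subsetI)
    fix x assume "x \<in> Units (?R\<lparr>carrier := ring_center\<rparr>)"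
    then show "x \<in> ring_center - {\<zero>\<^bsub>?R\<^esub>}"
      by (auto simp: Units_def sel)
  next
    fix x assume x: "x \<in> ring_center - {\<zero>\<^bsub>?R\<^esub>}"
    then have "inverse x \<in> ring_center" "inverse x * x = 1" "x * inverse x = 1"
      using inv by (auto simp: sel)
    with x show "x \<in> Units (?R\<lparr>carrier := ring_center\<rparr>)"
      by (auto simp: Units_def sel intro!: bexI[of _ "inverse x"])
  qed
  ultimately show ?thesis
    by (rule ring.subfieldI[OF R])
qed

datatype superscript = One | Compl | Dagger | Star

fun superscript_mat ::
  "('a \<Rightarrow> 'a) \<Rightarrow> ('a \<Rightarrow> 'a) \<Rightarrow> superscript \<Rightarrow> 'a mat \<Rightarrow> 'a mat" where
  "superscript_mat c d One A = A"
| "superscript_mat c d Compl A = map_mat c A"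
| "superscript_mat c d Dagger A = transpose_mat (map_mat d A)"
| "superscript_mat c d Star A = transpose_mat (map_mat d (map_mat c A))"

text \<open>Row and column numbers of \<open>X\<^sup>\<sigma>\<close> for a matrix \<open>X\<close> of size \<open>m \<times> n\<close>.\<close>

fun superscript_rows :: "superscript \<Rightarrow> nat \<Rightarrow> nat \<Rightarrow> nat" where
  "superscript_rows One m n = m"
| "superscript_rows Compl m n = m"
| "superscript_rows Dagger m n = n"
| "superscript_rows Star m n = n"

fun superscript_cols :: "superscript \<Rightarrow> nat \<Rightarrow> nat \<Rightarrow> nat" where
  "superscript_cols One m n = n"
| "superscript_cols Compl m n = n"
| "superscript_cols Dagger m n = m"
| "superscript_cols Star m n = m"

text \<open>
  The library function \<open>mat_inverse\<close> is restricted to commutative fields. The following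
  two-sided inverse is specified for \<^const>\<open>invertible_mat\<close> arguments only.
\<close>

definition inverse_mat :: "'a::semiring_1 mat \<Rightarrow> 'a mat" where
  "inverse_mat A = (THE B. inverts_mat A B \<and> inverts_mat B A)"

lemma inverse_mat_eqI:
  assumes A: "A \<in> carrier_mat n n" and AB: "inverts_mat A B" and BA: "inverts_mat B A"
  shows "inverse_mat A = B"
  unfolding inverse_mat_def
proof (rule the_equality)
  have carrier: "C \<in> carrier_mat n n" if "inverts_mat A C" "inverts_mat C A" for C
    using that A unfolding inverts_mat_def
    by (metis carrier_matD carrier_matI index_mult_mat(2,3) index_one_mat(2,3))
  fix C
  assume C: "inverts_mat A C \<and> inverts_mat C A"
  have "C = C * (A * B)"
    using carrier[OF AB BA] carrier[of C] C A AB by (simp add: inverts_mat_def)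
  also have "\<dots> = C * A * B"
    using carrier[OF AB BA] carrier[of C] C A by (simp add: assoc_mult_mat[of C n n A n B n])
  also have "\<dots> = B"
    using carrier[OF AB BA] carrier[of C] C A by (simp add: inverts_mat_def)
  finally show "C = B" .
qed (use AB BA in simp)

definition J_mat :: "nat \<Rightarrow> nat \<Rightarrow> 'a::division_ring mat" where
  "J_mat m n = four_block_mat (0\<^sub>m n m) (1\<^sub>m n) (- 1\<^sub>m m) (0\<^sub>m m n)"

text \<open>The numbers \<open>m\<close> and \<open>n\<close> are the sizes of the two diagonal blocks of \<open>P\<close>.\<close>

fun angle_mat ::
  "('a::division_ring \<Rightarrow> 'a) \<Rightarrow> ('a \<Rightarrow> 'a) \<Rightarrow> nat \<Rightarrow> nat \<Rightarrow> superscript \<Rightarrow> 'a mat \<Rightarrow> 'a mat"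
where
  "angle_mat c d m n One P = superscript_mat c d One P"
| "angle_mat c d m n Compl P = superscript_mat c d Compl P"
| "angle_mat c d m n Dagger P =
     J_mat m n * inverse_mat (superscript_mat c d Dagger P) * inverse_mat (J_mat m n)"
| "angle_mat c d m n Star P =
     J_mat m n * inverse_mat (superscript_mat c d Star P) * inverse_mat (J_mat m n)"

abbreviation diag_block_mat2 :: "'a::zero mat \<Rightarrow> 'a mat \<Rightarrow> 'a mat" where
  "diag_block_mat2 A B \<equiv>
     four_block_mat A (0\<^sub>m (dim_row A) (dim_col B)) (0\<^sub>m (dim_row B) (dim_col A)) B"

end

theory Submission
  imports Defs "HOL-Library.Product_Plus" "HOL-Library.Function_Algebras"
begin

text \<open>
  A solution \<open>X\<close> gives the unipotent matrices \<open>P\<^sub>j = [I, X\<^sub>j; 0, I]\<close>. For the converse, the system is first made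
  linear in independent unknowns \<open>X, X\<^sup>c, X\<^sup>\<dagger>, X\<^sup>*\<close> by adding its conjugates; since \<open>c\<close> and \<open>d\<close> need not commute,
  this leaves equations \<open>A \<tau>\<^sup>a(Y) M - N \<tau>\<^sup>b(Z) B = C\<close> with \<open>a, b \<in> {0, 1}\<close> and \<open>\<tau> = dcdc\<close>, an automorphism which may have
  infinite order on the center. Averaging (characteristic not 2) undoes the first step.

  The matrices \<open>(P, Q, R)\<close> form an isomorphism \<open>V \<rightarrow> U \<oplus> W\<close> from an extension of semilinear representations
  to the split one, and a solution is a splitting, that is, a lift of the identity of \<open>W\<close> along
  \<open>Hom(W, V) \<rightarrow> Hom(W, W)\<close>. As in Roth's theorem one compares dimensions over the center, but
  homomorphisms are only the \<open>\<tau>\<close>-fixed points of a relation \<open>\<Gamma>\<close> between finite-dimensional spaces. Left exact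
  subfunctors whose dimension is that of the split case are exact. This is applied to
  the iterated domains of \<open>\<Gamma>\<close>, to the subspace \<open>K\<close> reachable from \<open>0\<close>, and to the span of the fixed vectors modulo \<open>K\<close>;
  modulo \<open>K\<close> the relation is a semilinear map, for which fixed vectors are handled by Galois descent,
  and for \<open>k \<in> K\<close> the condition \<open>(s, s + k) \<in> \<Gamma>\<close> can always be solved for \<open>s\<close>.
\<close>

subsection \<open>Finite-dimensional subspaces\<close>

text \<open>It is made over the full center after treating the values of a morphism at two
  consecutive times as different unknowns: an untwisted occurrence reads the first value, a twisted
  one reads \<tau> of the second. Since both kinds of occurrence appear in one system, the outcome
  is a relation and not a map: a value may have no successor, or several. The iterated domains deal
  with the first defect, the subspace reached from 0 with the second. What remains is a semilinear
  map whose fixed vectors need not form a subspace over the center, so their span is counted, and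
  descent returns from the span to the fixed vectors. The matrix J enters because \<dagger> reverses
  all arrows: on block matrices, \<dagger> combined with J is a duality that preserves upper
  triangular form and turns the data of an equation into the data of its conjugate.\<close>

locale vector_space_fin = vector_space scale for scale :: "'k::field \<Rightarrow> 'b::ab_group_add \<Rightarrow> 'b" (infixr \<open>*s\<close> 75)
begin

definition fin_dim :: "'b set \<Rightarrow> bool" where
  "fin_dim N \<longleftrightarrow> (\<exists>S. finite S \<and> N \<subseteq> span S)"

lemma fin_dim_subset: "fin_dim N \<Longrightarrow> M \<subseteq> N \<Longrightarrow> fin_dim M"
  unfolding fin_dim_def by blast

lemma fin_dim_independent_finite:
  assumes "fin_dim N" "independent B" "B \<subseteq> N"
  shows "finite B"
  using assms independent_span_bound unfolding fin_dim_def by blast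

lemma dim_mono_fin_dim:
  assumes "fin_dim T" "S \<subseteq> T"
  shows "dim S \<le> dim T"
proof -
  obtain B where B: "B \<subseteq> T" "independent B" "T \<subseteq> span B" "card B = dim T"
    using basis_exists by blast
  then have "finite B"
    using fin_dim_independent_finite assms by blast
  then show ?thesis
    using dim_le_card[of S B] B assms(2) by auto
qed

lemma subspace_dim_equal_fin_dim:
  assumes "subspace S" "fin_dim T" "S \<subseteq> T" "dim T \<le> dim S"
  shows "S = T"
proof -
  obtain B where B: "B \<subseteq> S" "independent B" "S \<subseteq> span B" "card B = dim S"
    using basis_exists by blast
  have fB: "finite B"
    using fin_dim_independent_finite[OF assms(2) B(2)] B(1) assms(3) by blast
  have "T \<subseteq> span B"
  proof
    fix x assume x: "x \<in> T"
    show "x \<in> span B"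
    proof (rule ccontr)
      assume n: "x \<notin> span B"
      then have i: "independent (insert x B)"
        using B(2) independent_insertI by blast
      have "x \<notin> B"
        using n span_base by blast
      then have "dim (insert x B) = Suc (dim S)"
        using dim_eq_card_independent[OF i] fB B(4) by simp
      moreover have "dim (insert x B) \<le> dim T"
        using dim_mono_fin_dim[OF assms(2)] x B(1) assms(3) by blast
      ultimately show False
        using assms(4) by simp
    qed
  qed
  moreover have "span B \<subseteq> S"
    using B(1) assms(1) span_minimal by blast
  ultimately show ?thesis
    using assms(3) by blast
qed

lemma span_Int_span_independent:
  assumes B: "independent B" "finite B" "B0 \<subseteq> B"
    and x: "x \<in> span B0" "x \<in> span (B - B0)"
  shows "x = 0"
proof -
  have fin: "finite B0" "finite (B - B0)"
    using B finite_subset by auto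
  obtain u where u: "x = (\<Sum>v\<in>B0. u v *s v)"
    using x(1) span_finite[OF fin(1)] by auto
  obtain w where w: "x = (\<Sum>v\<in>B - B0. w v *s v)"
    using x(2) span_finite[OF fin(2)] by auto
  let ?g = "\<lambda>v. if v \<in> B0 then u v else - w v"
  have "(\<Sum>v\<in>B. ?g v *s v) = (\<Sum>v\<in>B - B0. ?g v *s v) + (\<Sum>v\<in>B0. ?g v *s v)"
    using B by (intro sum.subset_diff) auto
  also have "(\<Sum>v\<in>B0. ?g v *s v) = x"
    unfolding u by (rule sum.cong) auto
  also have "(\<Sum>v\<in>B - B0. ?g v *s v) = - x"
    unfolding w sum_negf[symmetric] by (rule sum.cong) auto
  finally have "(\<Sum>v\<in>B. ?g v *s v) = 0"
    by simp
  then have "u v = 0" if "v \<in> B0" for v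
    using independentD[OF B(1,2) order.refl, of ?g v] that B(3) by auto
  then show ?thesis
    using u by simp
qed

lemma dim_kernel_image:
  assumes f: "Vector_Spaces.linear scale scale f" and N: "subspace N" "fin_dim N"
  shows "dim N = dim {x \<in> N. f x = 0} + dim (f ` N)"
proof -
  interpret f: module_hom scale scale f
    using f by (simp add: module_hom_iff_linear)
  let ?K = "{x \<in> N. f x = 0}"
  obtain B0 where B0: "B0 \<subseteq> ?K" "independent B0" "?K \<subseteq> span B0" "card B0 = dim ?K"
    using basis_exists by blast
  obtain B where B: "B0 \<subseteq> B" "B \<subseteq> N" "independent B" "N \<subseteq> span B"
    using maximal_independent_subset_extend[of B0 N] B0 by blast
  have fB: "finite B"
    using fin_dim_independent_finite N B by blast
  then have fB0: "finite B0"
    using B(1) finite_subset by blast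
  let ?C = "B - B0"
  have sep: "x = 0" if x: "x \<in> span ?C" "f x = 0" for x
  proof -
    have "x \<in> N"
      using x(1) span_minimal[of ?C N] B(2) N(1) by blast
    then have "x \<in> span B0"
      using x(2) B0(3) by blast
    then show ?thesis
      using span_Int_span_independent[OF B(3) fB B(1)] x(1) by blast
  qed
  have inj: "inj_on f (span ?C)"
  proof (rule inj_onI)
    fix x y assume "x \<in> span ?C" "y \<in> span ?C" "f x = f y"
    then show "x = y"
      using sep[of "x - y"] by (simp add: span_diff f.diff)
  qed
  have ind: "independent (f ` ?C)"
    using f.independent_injective_image[OF independent_mono[OF B(3)] inj] by blast
  have card: "card (f ` ?C) = card ?C"
    using inj_on_subset[OF inj span_superset] by (rule card_image)
  have "f ` N \<subseteq> span (f ` ?C)"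
  proof
    fix y assume "y \<in> f ` N"
    then obtain x where x: "x \<in> N" "y = f x"
      by blast
    have "B = B0 \<union> ?C"
      using B(1) by blast
    then have "x \<in> span (B0 \<union> ?C)"
      using x(1) B(4) by auto
    then obtain a b where ab: "x = a + b" "a \<in> span B0" "b \<in> span ?C"
      unfolding span_Un by blast
    have "subspace {x. f x = 0}"
      by (rule f.subspace_kernel)
    then have "f a = 0"
      using span_minimal[of B0 "{x. f x = 0}"] ab(2) B0(1) by blast
    then show "y \<in> span (f ` ?C)"
      using x(2) ab(1,3) by (simp add: f.add f.span_image)
  qed
  moreover have "f ` ?C \<subseteq> f ` N"
    using B(2) by blast
  ultimately have "dim (f ` N) = card ?C"
    using basis_card_eq_dim[OF _ _ ind] card by simp
  moreover have "dim N = card B"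
    using basis_card_eq_dim[OF B(2,4,3)] by simp
  moreover have "card B = card B0 + card ?C"
    using card_Diff_subset[OF fB0 B(1)] card_mono[OF fB B(1)] by simp
  ultimately show ?thesis
    using B0(4) by simp
qed

lemma dim_inj_image:
  assumes f: "Vector_Spaces.linear scale scale f" and N: "subspace N" "fin_dim N" and inj: "inj_on f N"
  shows "dim (f ` N) = dim N"
proof -
  interpret f: module_hom scale scale f
    using f by (simp add: module_hom_iff_linear)
  have "{x \<in> N. f x = 0} = {0}"
    using inj subspace_0[OF N(1)] f.zero by (auto simp: inj_on_def)
  moreover have "dim {0} = 0"
    using dim_le_card[of "{0}" "{}"] by simp
  ultimately show ?thesis
    using dim_kernel_image[OF f N] by simp
qed

lemma fin_dim_image:
  assumes f: "Vector_Spaces.linear scale scale f" and N: "fin_dim N"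
  shows "fin_dim (f ` N)"
proof -
  interpret f: module_hom scale scale f
    using f by (simp add: module_hom_iff_linear)
  obtain S where "finite S" "N \<subseteq> span S"
    using N by (auto simp: fin_dim_def)
  then have "finite (f ` S)" "f ` N \<subseteq> span (f ` S)"
    by (auto simp: f.span_image)
  then show ?thesis
    unfolding fin_dim_def by blast
qed

text \<open>Rank-nullity splits the common dimension into a kernel part and an image part; each part
  of \<open>N\<close> is bounded by that of \<open>M\<close>, so neither bound can be strict. This
  is how left exactness together with equal dimensions becomes exactness.\<close>

lemma kernel_image_eqI:
  assumes f: "Vector_Spaces.linear scale scale f" and N: "subspace N" "fin_dim N"
    and M: "subspace M" "fin_dim M" and dim: "dim N = dim M"
    and ker: "{x \<in> N. f x = 0} \<subseteq> {x \<in> M. f x = 0}" and im: "f ` N \<subseteq> f ` M"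
  shows "{x \<in> N. f x = 0} = {x \<in> M. f x = 0}" "f ` N = f ` M"
proof -
  interpret f: module_hom scale scale f
    using f by (simp add: module_hom_iff_linear)
  have sub: "subspace {x \<in> N'. f x = 0}" if "subspace N'" for N'
    using subspace_inter[OF that f.subspace_kernel] by (simp add: Int_def)
  have fd: "fin_dim {x \<in> M. f x = 0}" "fin_dim (f ` M)"
    using fin_dim_subset[OF M(2)] fin_dim_image[OF f M(2)] by auto
  have "dim {x \<in> N. f x = 0} \<le> dim {x \<in> M. f x = 0}" "dim (f ` N) \<le> dim (f ` M)"
    using dim_mono_fin_dim fd ker im by blast+
  then have "dim {x \<in> N. f x = 0} = dim {x \<in> M. f x = 0}" "dim (f ` N) = dim (f ` M)"
    using dim dim_kernel_image[OF f N] dim_kernel_image[OF f M] by linarith+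
  then show "{x \<in> N. f x = 0} = {x \<in> M. f x = 0}" "f ` N = f ` M"
    using subspace_dim_equal_fin_dim[OF sub[OF N(1)] fd(1) ker]
      subspace_dim_equal_fin_dim[OF f.subspace_image[OF N(1)] fd(2) im] by simp_all
qed

end


subsection \<open>Semilinear relations\<close>

text \<open>
  A pair in \<open>\<Gamma>\<close> consists of the values of a \<open>\<sigma>\<close>-twisted sequence at two consecutive times, so that pairs
  \<open>(v, v)\<close> stand for solutions. The space is an extension with kernel and image of \<open>\<pi>\<close> as its two ends;
  \<open>\<Gamma>\<^sub>0\<close> is the relation of the split extension and \<open>\<theta>\<close> an isomorphism between the two.
\<close>

locale roth_relation = vector_space_fin scale
  for scale :: "'k::field \<Rightarrow> 'v::ab_group_add \<Rightarrow> 'v" (infixr \<open>*s\<close> 75) +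
  fixes \<sigma> :: "'k \<Rightarrow> 'k" and X :: "'v set" and \<pi> \<theta> :: "'v \<Rightarrow> 'v" and \<Gamma> \<Gamma>\<^sub>0 :: "('v \<times> 'v) set"
  assumes \<sigma>_add: "\<sigma> (a + b) = \<sigma> a + \<sigma> b" and \<sigma>_mult: "\<sigma> (a * b) = \<sigma> a * \<sigma> b"
    and \<sigma>_one: "\<sigma> 1 = 1" and surj_\<sigma>: "surj \<sigma>"
    and subspace_X: "subspace X" and fin_dim_X: "fin_dim X"
    and linear_\<pi>: "Vector_Spaces.linear scale scale \<pi>" and \<pi>_idem: "\<pi> (\<pi> x) = \<pi> x"
    and \<pi>_X: "x \<in> X \<Longrightarrow> \<pi> x \<in> X"
    and linear_\<theta>: "Vector_Spaces.linear scale scale \<theta>" and inj_\<theta>: "inj_on \<theta> X"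
    and \<theta>_X: "x \<in> X \<Longrightarrow> \<theta> x \<in> X"
    and \<Gamma>_X: "\<Gamma> \<subseteq> X \<times> X"
    and \<Gamma>_zero: "(0, 0) \<in> \<Gamma>"
    and \<Gamma>_add: "(x, y) \<in> \<Gamma> \<Longrightarrow> (x', y') \<in> \<Gamma> \<Longrightarrow> (x + x', y + y') \<in> \<Gamma>"
    and \<Gamma>_scale: "(x, y) \<in> \<Gamma> \<Longrightarrow> (z *s x, \<sigma> z *s y) \<in> \<Gamma>"
    and \<Gamma>\<^sub>0_eq: "\<Gamma>\<^sub>0 = map_prod \<theta> \<theta> ` \<Gamma>"
    and \<Gamma>\<^sub>0_\<pi>: "(x, y) \<in> \<Gamma>\<^sub>0 \<Longrightarrow> (\<pi> x, \<pi> y) \<in> \<Gamma>\<^sub>0"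
    and \<Gamma>_\<pi>: "(x, y) \<in> \<Gamma> \<Longrightarrow> (\<pi> x, \<pi> y) \<in> \<Gamma>\<^sub>0"
    and \<Gamma>_kernel: "\<pi> x = 0 \<Longrightarrow> \<pi> y = 0 \<Longrightarrow> (x, y) \<in> \<Gamma> \<longleftrightarrow> (x, y) \<in> \<Gamma>\<^sub>0"
begin

sublocale \<pi>: module_hom scale scale \<pi>
  using linear_\<pi> by (simp add: module_hom_iff_linear)

sublocale \<theta>: module_hom scale scale \<theta>
  using linear_\<theta> by (simp add: module_hom_iff_linear)

text \<open>With the second coordinate scaled through \<sigma>, the relation \<open>\<Gamma>\<close>
  is an ordinary linear subspace of the product, so dimension arguments apply to the relation
  itself.\<close>

definition pscale :: "'k \<Rightarrow> 'v \<times> 'v \<Rightarrow> 'v \<times> 'v" where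
  "pscale z p = (z *s fst p, \<sigma> z *s snd p)"

lemma pscale_Pair [simp]: "pscale z (x, y) = (z *s x, \<sigma> z *s y)"
  by (simp add: pscale_def)

sublocale P: vector_space_fin pscale
  by unfold_locales
    (auto simp: pscale_def \<sigma>_add \<sigma>_mult \<sigma>_one scale_left_distrib scale_right_distrib)

lemma linear_map_prod:
  assumes f: "Vector_Spaces.linear scale scale f"
  shows "Vector_Spaces.linear pscale pscale (map_prod f f)"
proof -
  interpret f: module_hom scale scale f
    using f by (simp add: module_hom_iff_linear)
  show ?thesis
    by (subst module_hom_iff_linear[symmetric], unfold_locales) (auto simp: f.add f.scale)
qed

sublocale P\<theta>: module_hom pscale pscale "map_prod \<theta> \<theta>"
  using linear_map_prod[OF linear_\<theta>] by (simp add: module_hom_iff_linear)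

lemma subspace_\<Gamma>: "P.subspace \<Gamma>"
  by (rule P.subspaceI) (auto intro: \<Gamma>_add \<Gamma>_scale simp: zero_prod_def \<Gamma>_zero)

lemma subspace_\<Gamma>\<^sub>0: "P.subspace \<Gamma>\<^sub>0"
  unfolding \<Gamma>\<^sub>0_eq by (rule P\<theta>.subspace_image[OF subspace_\<Gamma>])

lemma \<Gamma>_diff: "(x, y) \<in> \<Gamma> \<Longrightarrow> (x', y') \<in> \<Gamma> \<Longrightarrow> (x - x', y - y') \<in> \<Gamma>"
  using P.subspace_diff[OF subspace_\<Gamma>, of "(x, y)" "(x', y')"] by simp

lemma \<Gamma>\<^sub>0_zero: "(0, 0) \<in> \<Gamma>\<^sub>0"
  using P.subspace_0[OF subspace_\<Gamma>\<^sub>0] by (simp add: zero_prod_def)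

lemma \<Gamma>\<^sub>0_add: "(x, y) \<in> \<Gamma>\<^sub>0 \<Longrightarrow> (x', y') \<in> \<Gamma>\<^sub>0 \<Longrightarrow> (x + x', y + y') \<in> \<Gamma>\<^sub>0"
  using P.subspace_add[OF subspace_\<Gamma>\<^sub>0, of "(x, y)" "(x', y')"] by simp

lemma \<Gamma>\<^sub>0_diff: "(x, y) \<in> \<Gamma>\<^sub>0 \<Longrightarrow> (x', y') \<in> \<Gamma>\<^sub>0 \<Longrightarrow> (x - x', y - y') \<in> \<Gamma>\<^sub>0"
  using P.subspace_diff[OF subspace_\<Gamma>\<^sub>0, of "(x, y)" "(x', y')"] by simp

lemma \<Gamma>\<^sub>0_scale: "(x, y) \<in> \<Gamma>\<^sub>0 \<Longrightarrow> (z *s x, \<sigma> z *s y) \<in> \<Gamma>\<^sub>0"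
  using P.subspace_scale[OF subspace_\<Gamma>\<^sub>0, of "(x, y)" z] by simp

lemma \<Gamma>_\<theta>: "(x, y) \<in> \<Gamma> \<Longrightarrow> (\<theta> x, \<theta> y) \<in> \<Gamma>\<^sub>0"
  unfolding \<Gamma>\<^sub>0_eq by force

lemma \<Gamma>\<^sub>0_E:
  assumes "(x, y) \<in> \<Gamma>\<^sub>0"
  obtains a b where "(a, b) \<in> \<Gamma>" "x = \<theta> a" "y = \<theta> b"
  using assms unfolding \<Gamma>\<^sub>0_eq by auto

lemma \<Gamma>\<^sub>0_X: "\<Gamma>\<^sub>0 \<subseteq> X \<times> X"
  unfolding \<Gamma>\<^sub>0_eq using \<Gamma>_X \<theta>_X by auto

lemma fin_dim_X_times_X: "P.fin_dim (X \<times> X)"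
proof -
  obtain S where S: "finite S" "X \<subseteq> span S"
    using fin_dim_X by (auto simp: fin_dim_def)
  let ?T = "S \<times> {0} \<union> {0} \<times> S"
  have "subspace {x. (x, 0) \<in> P.span ?T}"
  proof (rule subspaceI)
    fix z x assume "x \<in> {x. (x, 0) \<in> P.span ?T}"
    then show "z *s x \<in> {x. (x, 0) \<in> P.span ?T}"
      using P.span_scale[of "(x, 0)" ?T z] by simp
  next
    fix x y assume "x \<in> {x. (x, 0) \<in> P.span ?T}" "y \<in> {x. (x, 0) \<in> P.span ?T}"
    then show "x + y \<in> {x. (x, 0) \<in> P.span ?T}"
      using P.span_add[of "(x, 0)" ?T "(y, 0)"] by simp
  qed (use P.span_zero[of ?T] in \<open>simp add: zero_prod_def\<close>)
  then have 1: "(x, 0) \<in> P.span ?T" if "x \<in> span S" for x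
    using span_minimal[of S "{x. (x, 0) \<in> P.span ?T}"] that P.span_base[of _ ?T] by blast
  have "subspace {y. (0, y) \<in> P.span ?T}"
  proof (rule subspaceI)
    fix z x assume "x \<in> {y. (0, y) \<in> P.span ?T}"
    \<comment> \<open>Scalars reach the second coordinate only through \<sigma>, so closure under
      all of them rests on the surjectivity of \<sigma>.\<close>
    moreover obtain z' where "z = \<sigma> z'"
      using surj_\<sigma> by blast
    ultimately show "z *s x \<in> {y. (0, y) \<in> P.span ?T}"
      using P.span_scale[of "(0, x)" ?T z'] by simp
  next
    fix x y assume "x \<in> {y. (0, y) \<in> P.span ?T}" "y \<in> {y. (0, y) \<in> P.span ?T}"
    then show "x + y \<in> {y. (0, y) \<in> P.span ?T}"
      using P.span_add[of "(0, x)" ?T "(0, y)"] by simp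
  qed (use P.span_zero[of ?T] in \<open>simp add: zero_prod_def\<close>)
  then have 2: "(0, y) \<in> P.span ?T" if "y \<in> span S" for y
    using span_minimal[of S "{y. (0, y) \<in> P.span ?T}"] that P.span_base[of _ ?T] by blast
  have "(x, y) \<in> P.span ?T" if "x \<in> X" "y \<in> X" for x y
    using P.span_add[OF 1[of x] 2[of y]] that S(2) by auto
  then have "X \<times> X \<subseteq> P.span ?T"
    by blast
  moreover have "finite ?T"
    using S(1) by simp
  ultimately show ?thesis
    unfolding P.fin_dim_def by blast
qed

text \<open>
  Read \<^term>\<open>N\<close> as a subspace functor evaluated at an extension of \<open>W\<close> by \<open>U\<close> (where \<^term>\<open>\<pi>\<close> is the
  projection onto \<open>W\<close> with kernel \<open>U\<close>), and \<open>N\<^sub>0\<close> as its value at \<open>U \<oplus> W\<close>. Compatibility says that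
  \<open>0 \<rightarrow> N(U) \<rightarrow> N \<rightarrow> N(W) \<rightarrow> 0\<close> is exact.
\<close>

definition compat :: "'v set \<Rightarrow> 'v set \<Rightarrow> bool" where
  "compat N N\<^sub>0 \<longleftrightarrow> subspace N \<and> N \<subseteq> X \<and> N\<^sub>0 = \<theta> ` N \<and> \<pi> ` N\<^sub>0 \<subseteq> N\<^sub>0 \<and>
     {x \<in> N. \<pi> x = 0} = {x \<in> N\<^sub>0. \<pi> x = 0} \<and> \<pi> ` N = \<pi> ` N\<^sub>0"

lemma compatD:
  assumes "compat N N\<^sub>0"
  shows "subspace N" "N \<subseteq> X" "N\<^sub>0 = \<theta> ` N" "x \<in> N\<^sub>0 \<Longrightarrow> \<pi> x \<in> N\<^sub>0"
    "\<pi> x = 0 \<Longrightarrow> x \<in> N \<longleftrightarrow> x \<in> N\<^sub>0" "\<pi> ` N = \<pi> ` N\<^sub>0" "x \<in> N \<Longrightarrow> \<pi> x \<in> N\<^sub>0"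
    "subspace N\<^sub>0" "N\<^sub>0 \<subseteq> X" "x \<in> N \<Longrightarrow> \<theta> x \<in> N\<^sub>0" "x \<in> N\<^sub>0 \<Longrightarrow> x - \<pi> x \<in> N\<^sub>0"
    "x \<in> N\<^sub>0 \<Longrightarrow> \<exists>y\<in>N. \<pi> y = \<pi> x"
proof -
  note d = assms[unfolded compat_def]
  show *: "subspace N" "N \<subseteq> X" "N\<^sub>0 = \<theta> ` N" "x \<in> N\<^sub>0 \<Longrightarrow> \<pi> x \<in> N\<^sub>0"
    "\<pi> x = 0 \<Longrightarrow> x \<in> N \<longleftrightarrow> x \<in> N\<^sub>0" "\<pi> ` N = \<pi> ` N\<^sub>0"
    using d by blast+
  show "x \<in> N \<Longrightarrow> \<pi> x \<in> N\<^sub>0" "x \<in> N \<Longrightarrow> \<theta> x \<in> N\<^sub>0"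
    using d by blast+
  show N0: "subspace N\<^sub>0"
    using \<theta>.subspace_image[OF *(1)] *(3) by simp
  show "N\<^sub>0 \<subseteq> X"
    using \<theta>_X *(2,3) by auto
  show "x \<in> N\<^sub>0 \<Longrightarrow> x - \<pi> x \<in> N\<^sub>0"
    using subspace_diff[OF N0] *(4) by blast
  show "x \<in> N\<^sub>0 \<Longrightarrow> \<exists>y\<in>N. \<pi> y = \<pi> x"
    using *(6) by (metis imageE imageI)
qed

lemma dim_\<theta>_image: "subspace N \<Longrightarrow> N \<subseteq> X \<Longrightarrow> dim (\<theta> ` N) = dim N"
  using dim_inj_image[OF linear_\<theta>] fin_dim_subset[OF fin_dim_X] inj_on_subset[OF inj_\<theta>] by blast

text \<open>Both sets have the same dimension because \<theta> is injective on \<open>X\<close>, so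
  inclusions in one direction force the equalities demanded by \<open>compat\<close>. The first
  alternative suits left exact subfunctors, the second the situation where elements of the split
  side can be lifted.\<close>

lemma compatI:
  assumes N: "subspace N" "N \<subseteq> X" "N\<^sub>0 = \<theta> ` N" and \<pi>N0: "\<And>x. x \<in> N\<^sub>0 \<Longrightarrow> \<pi> x \<in> N\<^sub>0"
    and exact: "(\<forall>x\<in>N. \<pi> x = 0 \<longrightarrow> x \<in> N\<^sub>0) \<and> (\<forall>x\<in>N. \<pi> x \<in> N\<^sub>0) \<or>
      (\<forall>x\<in>N\<^sub>0. \<pi> x = 0 \<longrightarrow> x \<in> N) \<and> (\<forall>x\<in>N\<^sub>0. \<exists>y\<in>N. \<pi> y = \<pi> x)"
  shows "compat N N\<^sub>0"
proof -
  have fd: "fin_dim N" "fin_dim N\<^sub>0"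
    using fin_dim_subset[OF fin_dim_X N(2)] fin_dim_image[OF linear_\<theta>] N(3) by auto
  have N0: "subspace N\<^sub>0"
    using \<theta>.subspace_image[OF N(1)] N(3) by simp
  have dim: "dim N = dim N\<^sub>0"
    using dim_\<theta>_image[OF N(1,2)] N(3) by simp
  from exact have "{x \<in> N. \<pi> x = 0} = {x \<in> N\<^sub>0. \<pi> x = 0} \<and> \<pi> ` N = \<pi> ` N\<^sub>0"
  proof
    assume A: "(\<forall>x\<in>N. \<pi> x = 0 \<longrightarrow> x \<in> N\<^sub>0) \<and> (\<forall>x\<in>N. \<pi> x \<in> N\<^sub>0)"
    have "\<pi> ` N \<subseteq> \<pi> ` N\<^sub>0"
    proof
      fix y assume "y \<in> \<pi> ` N"
      then have "y \<in> N\<^sub>0" "y = \<pi> y"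
        using A \<pi>_idem by auto
      then show "y \<in> \<pi> ` N\<^sub>0"
        by blast
    qed
    then show ?thesis
      using kernel_image_eqI[OF linear_\<pi> N(1) fd(1) N0 fd(2) dim] A by blast
  next
    assume A: "(\<forall>x\<in>N\<^sub>0. \<pi> x = 0 \<longrightarrow> x \<in> N) \<and> (\<forall>x\<in>N\<^sub>0. \<exists>y\<in>N. \<pi> y = \<pi> x)"
    have "\<pi> ` N\<^sub>0 \<subseteq> \<pi> ` N"
    proof
      fix y assume "y \<in> \<pi> ` N\<^sub>0"
      then obtain x where "x \<in> N\<^sub>0" "y = \<pi> x"
        by blast
      then show "y \<in> \<pi> ` N"
        using A by (metis imageI)
    qed
    then show ?thesis
      using kernel_image_eqI[OF linear_\<pi> N0 fd(2) N(1) fd(1) dim[symmetric]] A by blast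
  qed
  then show ?thesis
    unfolding compat_def using N \<pi>N0 by auto
qed

lemma compat_X: "compat X X"
proof (rule compatI)
  show "X = \<theta> ` X"
    using subspace_dim_equal_fin_dim[OF \<theta>.subspace_image[OF subspace_X] fin_dim_X]
      dim_\<theta>_image[OF subspace_X] \<theta>_X by auto
qed (use subspace_X \<pi>_X in auto)

lemma compat_zero: "compat {0} {0}"
  by (rule compatI) (use subspace_single_0 subspace_0[OF subspace_X] \<theta>.zero \<pi>.zero in auto)

text \<open>The pairs of \<open>\<Gamma>\<close> inside \<open>K \<times> A\<close> behave like a
  subfunctor one level up: \<theta> carries them onto the corresponding split pairs, and kernels and
  images compare componentwise. Counting dimensions for \<open>pscale\<close> lifts both entries of
  a split pair simultaneously.\<close>

lemma restrict_lift:
  assumes K: "compat K K\<^sub>0" and A: "compat A A\<^sub>0"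
    and xy: "(x, y) \<in> \<Gamma>\<^sub>0" "x \<in> K\<^sub>0" "y \<in> A\<^sub>0"
  obtains x' y' where "(x', y') \<in> \<Gamma>" "x' \<in> K" "y' \<in> A" "\<pi> x' = \<pi> x" "\<pi> y' = \<pi> y"
proof -
  let ?G = "\<Gamma> \<inter> K \<times> A" and ?H = "\<Gamma>\<^sub>0 \<inter> K\<^sub>0 \<times> A\<^sub>0"
  note Kd = compatD[OF K] and Ad = compatD[OF A]
  have G0: "?H = map_prod \<theta> \<theta> ` ?G"
  proof
    show "map_prod \<theta> \<theta> ` ?G \<subseteq> ?H"
      using \<Gamma>_\<theta> Kd(10) Ad(10) by auto
    show "?H \<subseteq> map_prod \<theta> \<theta> ` ?G"
    proof
      fix p assume p: "p \<in> ?H"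
      then obtain a b where ab: "(a, b) \<in> \<Gamma>" "p = (\<theta> a, \<theta> b)"
        unfolding \<Gamma>\<^sub>0_eq by auto
      have "\<theta> a \<in> \<theta> ` K" "\<theta> b \<in> \<theta> ` A"
        using p ab(2) Kd(3) Ad(3) by auto
      moreover have "a \<in> X" "b \<in> X"
        using ab(1) \<Gamma>_X by auto
      ultimately have "a \<in> K" "b \<in> A"
        using inj_on_image_mem_iff[OF inj_\<theta>] Kd(2) Ad(2) by blast+
      then show "p \<in> map_prod \<theta> \<theta> ` ?G"
        using ab by force
    qed
  qed
  have sub: "P.subspace ?G"
  proof (rule P.subspace_inter[OF subspace_\<Gamma>], rule P.subspaceI)
    show "0 \<in> K \<times> A"
      using subspace_0 Kd(1) Ad(1) by (simp add: zero_prod_def)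
  qed (use subspace_add subspace_scale Kd(1) Ad(1) in auto)
  have GX: "?G \<subseteq> X \<times> X"
    using \<Gamma>_X by blast
  have fd: "P.fin_dim ?G"
    by (rule P.fin_dim_subset[OF fin_dim_X_times_X GX])
  have inj: "inj_on (map_prod \<theta> \<theta>) ?G"
    using inj_on_subset[OF map_prod_inj_on[OF inj_\<theta> inj_\<theta>] GX] .
  have "map_prod \<pi> \<pi> ` ?G = map_prod \<pi> \<pi> ` ?H"
  proof (rule P.kernel_image_eqI(2)[OF linear_map_prod[OF linear_\<pi>] sub fd])
    show "P.subspace ?H" "P.fin_dim ?H" "P.dim ?G = P.dim ?H"
      unfolding G0 using P\<theta>.subspace_image[OF sub] P.fin_dim_image[OF linear_map_prod[OF linear_\<theta>] fd]
        P.dim_inj_image[OF linear_map_prod[OF linear_\<theta>] sub fd inj] by auto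
    show "{p \<in> ?G. map_prod \<pi> \<pi> p = 0} \<subseteq> {p \<in> ?H. map_prod \<pi> \<pi> p = 0}"
      using \<Gamma>_kernel Kd(5) Ad(5) by (auto simp: zero_prod_def)
    show "map_prod \<pi> \<pi> ` ?G \<subseteq> map_prod \<pi> \<pi> ` ?H"
    proof
      fix p assume "p \<in> map_prod \<pi> \<pi> ` ?G"
      then have "p \<in> ?H" "p = map_prod \<pi> \<pi> p"
        using \<Gamma>_\<pi> Kd(7) Ad(7) by (auto simp: \<pi>_idem)
      then show "p \<in> map_prod \<pi> \<pi> ` ?H"
        by blast
    qed
  qed
  moreover have "(\<pi> x, \<pi> y) \<in> map_prod \<pi> \<pi> ` ?H"
    using xy by force
  ultimately have "(\<pi> x, \<pi> y) \<in> map_prod \<pi> \<pi> ` ?G"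
    by simp
  then show thesis
    using that by auto
qed

text \<open>On the split side the kernel component \<open>x - \<pi> x\<close> of a pair can be
  separated off, and on the kernel of \<pi> the two relations agree.\<close>

lemma \<Gamma>\<^sub>0_complement:
  assumes "(x, y) \<in> \<Gamma>\<^sub>0"
  shows "(x - \<pi> x, y - \<pi> y) \<in> \<Gamma>"
proof -
  have "(x - \<pi> x, y - \<pi> y) \<in> \<Gamma>\<^sub>0"
    using \<Gamma>\<^sub>0_diff[OF assms \<Gamma>\<^sub>0_\<pi>[OF assms]] .
  then show ?thesis
    using \<Gamma>_kernel by (simp add: \<pi>.diff \<pi>_idem)
qed

lemma compat_Image:
  assumes K: "compat K K\<^sub>0"
  shows "compat (\<Gamma> `` K) (\<Gamma>\<^sub>0 `` K\<^sub>0)"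
proof -
  note Kd = compatD[OF K]
  show ?thesis
  proof (rule compatI, goal_cases)
    case 1
    show ?case
    proof (rule subspaceI)
      show "0 \<in> \<Gamma> `` K"
        using \<Gamma>_zero subspace_0[OF Kd(1)] by blast
      show "x + y \<in> \<Gamma> `` K" if "x \<in> \<Gamma> `` K" "y \<in> \<Gamma> `` K" for x y
        using that \<Gamma>_add subspace_add[OF Kd(1)] by blast
      show "z *s x \<in> \<Gamma> `` K" if "x \<in> \<Gamma> `` K" for x z
        using that \<Gamma>_scale subspace_scale[OF Kd(1)] surj_\<sigma> by (metis ImageE ImageI surjE)
    qed
  next
    case 2
    show ?case
      using \<Gamma>_X by blast
  next
    case 3
    show ?case
    proof
      show "\<theta> ` (\<Gamma> `` K) \<subseteq> \<Gamma>\<^sub>0 `` K\<^sub>0"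
        using \<Gamma>_\<theta> Kd(10) by blast
      show "\<Gamma>\<^sub>0 `` K\<^sub>0 \<subseteq> \<theta> ` (\<Gamma> `` K)"
      proof
        fix y assume "y \<in> \<Gamma>\<^sub>0 `` K\<^sub>0"
        then obtain x where "x \<in> K\<^sub>0" "(x, y) \<in> \<Gamma>\<^sub>0"
          by blast
        then obtain a b where ab: "\<theta> a \<in> \<theta> ` K" "(a, b) \<in> \<Gamma>" "y = \<theta> b"
          using \<Gamma>\<^sub>0_E Kd(3) by metis
        then have "a \<in> K"
          using inj_on_image_mem_iff[OF inj_\<theta>] Kd(2) \<Gamma>_X by blast
        then show "y \<in> \<theta> ` (\<Gamma> `` K)"
          using ab by blast
      qed
    qed
  next
    case (4 x)
    then show ?case
      using \<Gamma>\<^sub>0_\<pi> Kd(4) by blast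
  next
    case 5
    \<comment> \<open>A value in the kernel keeps a predecessor in the kernel: removing the
      \<pi>-component of the predecessor changes the value only by its own \<pi>-component, which is
      0. The surjectivity below is \<open>restrict_lift\<close> with no constraint on the second
      entry.\<close>
    have "x \<in> \<Gamma> `` K" if x: "x \<in> \<Gamma>\<^sub>0 `` K\<^sub>0" "\<pi> x = 0" for x
    proof -
      obtain a where a: "a \<in> K\<^sub>0" "(a, x) \<in> \<Gamma>\<^sub>0"
        using x(1) by blast
      have "(a - \<pi> a, x) \<in> \<Gamma>"
        using \<Gamma>\<^sub>0_complement[OF a(2)] x(2) by simp
      moreover have "a - \<pi> a \<in> K"
        using Kd(11)[OF a(1)] Kd(5)[of "a - \<pi> a"] by (simp add: \<pi>.diff \<pi>_idem)
      ultimately show ?thesis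
        by blast
    qed
    moreover have "\<exists>y\<in>\<Gamma> `` K. \<pi> y = \<pi> x" if x: "x \<in> \<Gamma>\<^sub>0 `` K\<^sub>0" for x
    proof -
      obtain a where a: "a \<in> K\<^sub>0" "(a, x) \<in> \<Gamma>\<^sub>0"
        using x(1) by blast
      then obtain x' y' where "(x', y') \<in> \<Gamma>" "x' \<in> K" "\<pi> y' = \<pi> x"
        using restrict_lift[OF K compat_X a(2,1)] \<Gamma>\<^sub>0_X by blast
      then show ?thesis
        by blast
    qed
    ultimately show ?case
      by blast
  qed
qed

text \<open>The converse relation satisfies the same axioms with the inverse of \<sigma>, so a
  preimage is an image for the converse.\<close>

lemma compat_preimage:
  assumes A: "compat A A\<^sub>0"
  shows "compat (\<Gamma>\<inverse> `` A) (\<Gamma>\<^sub>0\<inverse> `` A\<^sub>0)"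
proof -
  have "inj \<sigma>"
  proof (rule injI)
    fix a b assume eq: "\<sigma> a = \<sigma> b"
    have 0: "\<sigma> (a - b) = 0"
      using \<sigma>_add[of "a - b" b] eq by simp
    show "a = b"
    proof (rule ccontr)
      assume "a \<noteq> b"
      then have "(a - b) * inverse (a - b) = 1"
        by simp
      then show False
        using \<sigma>_mult[of "a - b" "inverse (a - b)"] \<sigma>_one 0 by simp
    qed
  qed
  then have inv: "inv_into UNIV \<sigma> (\<sigma> a) = a" "\<sigma> (inv_into UNIV \<sigma> a) = a" for a
    using surj_\<sigma> by (simp_all add: surj_f_inv_f)
  interpret C: roth_relation scale "inv_into UNIV \<sigma>" X \<pi> \<theta> "\<Gamma>\<inverse>" "\<Gamma>\<^sub>0\<inverse>"
  proof unfold_locales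
    show "inv_into UNIV \<sigma> (a + b) = inv_into UNIV \<sigma> a + inv_into UNIV \<sigma> b"
      "inv_into UNIV \<sigma> (a * b) = inv_into UNIV \<sigma> a * inv_into UNIV \<sigma> b" for a b
      using inv \<sigma>_add \<sigma>_mult by metis+
    show "inv_into UNIV \<sigma> 1 = 1"
      using inv(1)[of 1] \<sigma>_one by simp
    show "surj (inv_into UNIV \<sigma>)"
      using inv(1) by (metis surjI)
    show "(z *s x, inv_into UNIV \<sigma> z *s y) \<in> \<Gamma>\<inverse>" if "(x, y) \<in> \<Gamma>\<inverse>" for x y z
      using \<Gamma>_scale[of y x "inv_into UNIV \<sigma> z"] that inv by simp
    show "\<Gamma>\<^sub>0\<inverse> = map_prod \<theta> \<theta> ` \<Gamma>\<inverse>"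
    proof (intro equalityI subrelI)
      fix x y assume "(x, y) \<in> \<Gamma>\<^sub>0\<inverse>"
      then obtain a b where "(a, b) \<in> \<Gamma>" "y = \<theta> a" "x = \<theta> b"
        by (metis \<Gamma>\<^sub>0_E converse_iff)
      then show "(x, y) \<in> map_prod \<theta> \<theta> ` \<Gamma>\<inverse>"
        by force
    qed (auto intro: \<Gamma>_\<theta>)
    show "\<Gamma>\<inverse> \<subseteq> X \<times> X"
      using \<Gamma>_X by blast
  qed (simp_all add: subspace_X fin_dim_X \<pi>_idem \<pi>_X inj_\<theta> \<theta>_X \<Gamma>_zero \<Gamma>_add \<Gamma>\<^sub>0_\<pi> \<Gamma>_\<pi> \<Gamma>_kernel)
  show ?thesis
    by (rule C.compat_Image[OF A])
qed

end

lemma sum_Pair: "(\<Sum>e\<in>E. (g e, h e)) = (sum g E, sum h E)"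
  by (induction E rule: infinite_finite_induct) (simp_all add: zero_prod_def)

section \<open>Relations with successors: the subspace reached from 0 and the vectors fixed modulo
  it\<close>

locale total_roth_relation = roth_relation +
  assumes total: "(x, y) \<in> \<Gamma> \<Longrightarrow> \<exists>z. (y, z) \<in> \<Gamma>"
begin

text \<open>Values at time \<open>n\<close> of twisted sequences that start at 0. They measure how
  far \<open>\<Gamma>\<close> is from being single-valued: two successors of one vector differ by an
  element of \<open>reach 1\<close>.\<close>

primrec reach :: "nat \<Rightarrow> 'b set" where
  "reach 0 = {0}"
| "reach (Suc n) = \<Gamma> `` reach n"

primrec reach\<^sub>0 :: "nat \<Rightarrow> 'b set" where
  "reach\<^sub>0 0 = {0}"
| "reach\<^sub>0 (Suc n) = \<Gamma>\<^sub>0 `` reach\<^sub>0 n"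

definition K :: "'b set" where "K = (\<Union>n. reach n)"

definition K\<^sub>0 :: "'b set" where "K\<^sub>0 = (\<Union>n. reach\<^sub>0 n)"

lemma compat_reach: "compat (reach n) (reach\<^sub>0 n)"
  by (induction n) (auto intro: compat_zero compat_Image)

lemma reach_mono: "m \<le> n \<Longrightarrow> reach m \<subseteq> reach n"
proof (rule lift_Suc_mono_le)
  show "reach n \<subseteq> reach (Suc n)" for n
  proof (induction n)
    case 0
    then show ?case
      using \<Gamma>_zero by auto
  next
    case (Suc n)
    then show ?case
      by (auto simp del: reach.simps(1))
  qed
qed

lemma subspace_K: "subspace K"
proof (rule subspaceI)
  show "0 \<in> K"
    unfolding K_def using reach.simps(1) by blast
  fix x y assume "x \<in> K" "y \<in> K"
  then obtain m n where "x \<in> reach m" "y \<in> reach n"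
    unfolding K_def by blast
  then have "x \<in> reach (max m n)" "y \<in> reach (max m n)"
    using reach_mono[of m "max m n"] reach_mono[of n "max m n"] by auto
  then show "x + y \<in> K"
    unfolding K_def using subspace_add[OF compatD(1)[OF compat_reach]] by blast
next
  show "z *s x \<in> K" if "x \<in> K" for z x
    using that unfolding K_def using subspace_scale[OF compatD(1)[OF compat_reach]] by blast
qed

text \<open>Beyond the levels \<open>reach n\<close> no further dimension count is made: the clauses
  about \<theta>, kernels and images pass to unions, and being a subspace survives because the chain
  is increasing.\<close>

lemma compat_K: "compat K K\<^sub>0"
  unfolding compat_def
proof (intro conjI)
  note R = compatD[OF compat_reach]
  show "K \<subseteq> X"
    unfolding K_def using R(2) by blast
  show "K\<^sub>0 = \<theta> ` K" "\<pi> ` K = \<pi> ` K\<^sub>0"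
    unfolding K_def K\<^sub>0_def image_UN using R(3,6) by (auto intro!: SUP_cong)
  show "\<pi> ` K\<^sub>0 \<subseteq> K\<^sub>0"
    unfolding K\<^sub>0_def using R(4) by blast
  show "{x \<in> K. \<pi> x = 0} = {x \<in> K\<^sub>0. \<pi> x = 0}"
    unfolding K_def K\<^sub>0_def using R(5) by blast
qed (rule subspace_K)

lemmas Kd = compatD[OF compat_K]

lemma K_closed: "x \<in> K \<Longrightarrow> (x, y) \<in> \<Gamma> \<Longrightarrow> y \<in> K"
  unfolding K_def using reach.simps(2) by blast

lemma K\<^sub>0_closed: "x \<in> K\<^sub>0 \<Longrightarrow> (x, y) \<in> \<Gamma>\<^sub>0 \<Longrightarrow> y \<in> K\<^sub>0"
  unfolding K\<^sub>0_def using reach\<^sub>0.simps(2) by blast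

lemma K_total: "x \<in> K \<Longrightarrow> \<exists>y\<in>K. (x, y) \<in> \<Gamma>"
proof -
  assume x: "x \<in> K"
  then obtain n where "x \<in> reach n"
    unfolding K_def by blast
  then have "\<exists>y. (x, y) \<in> \<Gamma>"
    using total \<Gamma>_zero by (cases n) auto
  then show ?thesis
    using K_closed x by blast
qed

lemma \<Gamma>_unique: "(x, y) \<in> \<Gamma> \<Longrightarrow> (x, z) \<in> \<Gamma> \<Longrightarrow> y - z \<in> K"
  using \<Gamma>_diff[of x y x z] K_closed[OF subspace_0[OF subspace_K]] by simp

text \<open>Telescoping: along a chain 0 = x_0, x_1, ..., x_n = k of consecutive pairs take s = x_0
  + ... + x_{n-1}. The pairs add up to (s, x_1 + ... + x_n), which is (s, s + k).\<close>

lemma K\<^sub>0_coboundary: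
  assumes "k \<in> K\<^sub>0"
  shows "\<exists>s. (s, s + k) \<in> \<Gamma>\<^sub>0"
proof -
  obtain n where "k \<in> reach\<^sub>0 n"
    using assms unfolding K\<^sub>0_def by blast
  then show ?thesis
  proof (induction n arbitrary: k)
    case 0
    then show ?case
      using \<Gamma>\<^sub>0_zero by auto
  next
    case (Suc n)
    then obtain x where x: "x \<in> reach\<^sub>0 n" "(x, k) \<in> \<Gamma>\<^sub>0"
      by auto
    then obtain s where "(s, s + x) \<in> \<Gamma>\<^sub>0"
      using Suc.IH by blast
    then have "(s + x, s + x + k) \<in> \<Gamma>\<^sub>0"
      using \<Gamma>\<^sub>0_add x(2) by blast
    then show ?case
      by blast
  qed
qed

text \<open>The fixed vectors of the semilinear map induced modulo \<open>K\<close>. Closure under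
  scaling is available only for scalars fixed by \<sigma>, which is why the dimension arguments use
  the span of this set.\<close>

definition \<Phi> :: "'b set" where "\<Phi> = {x. \<exists>y. (x, y) \<in> \<Gamma> \<and> y - x \<in> K}"

definition \<Phi>\<^sub>0 :: "'b set" where "\<Phi>\<^sub>0 = {x. \<exists>y. (x, y) \<in> \<Gamma>\<^sub>0 \<and> y - x \<in> K\<^sub>0}"

lemma K_subset_\<Phi>: "K \<subseteq> \<Phi>"
  unfolding \<Phi>_def using K_total subspace_diff[OF subspace_K] by blast

lemma \<Phi>I: "(x, y) \<in> \<Gamma> \<Longrightarrow> y - x \<in> K \<Longrightarrow> x \<in> \<Phi>"
  unfolding \<Phi>_def by blast

lemma \<Phi>E:
  assumes "x \<in> \<Phi>"
  obtains y where "(x, y) \<in> \<Gamma>" "y - x \<in> K"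
  using assms unfolding \<Phi>_def by blast

lemma \<Phi>_diff:
  assumes "x \<in> \<Phi>" "y \<in> \<Phi>"
  shows "x - y \<in> \<Phi>"
proof -
  obtain x' y' where xy: "(x, x') \<in> \<Gamma>" "x' - x \<in> K" "(y, y') \<in> \<Gamma>" "y' - y \<in> K"
    using assms by (metis \<Phi>E)
  have "(x' - y') - (x - y) = (x' - x) - (y' - y)"
    by simp
  also have "\<dots> \<in> K"
    using xy(2,4) by (rule subspace_diff[OF subspace_K])
  finally show ?thesis
    by (rule \<Phi>I[OF \<Gamma>_diff[OF xy(1,3)]])
qed

lemma \<Phi>_scale:
  assumes "x \<in> \<Phi>" "\<sigma> z = z"
  shows "z *s x \<in> \<Phi>"
proof -
  obtain y where y: "(x, y) \<in> \<Gamma>" "y - x \<in> K"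
    using assms by (metis \<Phi>E)
  show ?thesis
    using \<Phi>I[of "z *s x" "z *s y"] \<Gamma>_scale[OF y(1), of z] assms(2)
      subspace_scale[OF subspace_K y(2), of z] by (simp add: scale_right_diff_distrib)
qed

lemma \<Phi>_X: "\<Phi> \<subseteq> X"
  unfolding \<Phi>_def using \<Gamma>_X by blast

lemma \<Phi>\<^sub>0_eq: "\<Phi>\<^sub>0 = \<theta> ` \<Phi>"
proof
  show "\<theta> ` \<Phi> \<subseteq> \<Phi>\<^sub>0"
  proof
    fix x assume "x \<in> \<theta> ` \<Phi>"
    then obtain a b where ab: "x = \<theta> a" "(a, b) \<in> \<Gamma>" "b - a \<in> K"
      by (metis imageE \<Phi>E)
    then show "x \<in> \<Phi>\<^sub>0"
      unfolding \<Phi>\<^sub>0_def using \<Gamma>_\<theta>[OF ab(2)] Kd(10)[OF ab(3)] by (auto simp: \<theta>.diff)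
  qed
  show "\<Phi>\<^sub>0 \<subseteq> \<theta> ` \<Phi>"
  proof
    fix x assume "x \<in> \<Phi>\<^sub>0"
    then obtain y where y: "(x, y) \<in> \<Gamma>\<^sub>0" "y - x \<in> K\<^sub>0"
      unfolding \<Phi>\<^sub>0_def by blast
    obtain a b where ab: "(a, b) \<in> \<Gamma>" "x = \<theta> a" "y = \<theta> b"
      using \<Gamma>\<^sub>0_E[OF y(1)] .
    then have "\<theta> (b - a) \<in> \<theta> ` K"
      using y(2) Kd(3) by (simp add: \<theta>.diff)
    have "b - a \<in> X"
      using ab(1) \<Gamma>_X subspace_diff[OF subspace_X] by blast
    then have "b - a \<in> K"
      using inj_on_image_mem_iff[OF inj_\<theta>] Kd(2) \<open>\<theta> (b - a) \<in> \<theta> ` K\<close> by blast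
    then show "x \<in> \<theta> ` \<Phi>"
      unfolding \<Phi>_def using ab by blast
  qed
qed

lemma \<Phi>\<^sub>0_\<pi>:
  assumes "x \<in> \<Phi>\<^sub>0"
  shows "\<pi> x \<in> \<Phi>\<^sub>0"
proof -
  obtain y where "(x, y) \<in> \<Gamma>\<^sub>0" "y - x \<in> K\<^sub>0"
    using assms unfolding \<Phi>\<^sub>0_def by blast
  then have "(\<pi> x, \<pi> y) \<in> \<Gamma>\<^sub>0" "\<pi> y - \<pi> x \<in> K\<^sub>0"
    using \<Gamma>\<^sub>0_\<pi> Kd(4)[of "y - x"] by (auto simp: \<pi>.diff)
  then show ?thesis
    unfolding \<Phi>\<^sub>0_def by blast
qed

lemma \<Phi>_\<pi>:
  assumes "x \<in> \<Phi>"
  shows "\<pi> x \<in> \<Phi>\<^sub>0"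
proof -
  obtain y where "(x, y) \<in> \<Gamma>" "y - x \<in> K"
    using assms by (metis \<Phi>E)
  then have "(\<pi> x, \<pi> y) \<in> \<Gamma>\<^sub>0" "\<pi> y - \<pi> x \<in> K\<^sub>0"
    using \<Gamma>_\<pi> Kd(7)[of "y - x"] by (auto simp: \<pi>.diff)
  then show ?thesis
    unfolding \<Phi>\<^sub>0_def by blast
qed

text \<open>A vector \<open>e\<close> of \<open>\<Phi>\<close> has a successor of the form
  \<open>e\<close> plus an element of \<open>K\<close>, so it stays in any span that contains
  \<open>K\<close>; semilinearity extends this from \<open>E\<close> to its span.\<close>

lemma span_\<Phi>_image:
  assumes E: "E \<subseteq> \<Phi>" and K: "K \<subseteq> span E" and x: "x \<in> span E"
  shows "\<exists>y\<in>span E. (x, y) \<in> \<Gamma>"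
proof -
  have "subspace {x. \<exists>y\<in>span E. (x, y) \<in> \<Gamma>}"
    using \<Gamma>_zero \<Gamma>_add \<Gamma>_scale span_zero span_add span_scale
    by (intro subspaceI) blast+
  moreover have "E \<subseteq> {x. \<exists>y\<in>span E. (x, y) \<in> \<Gamma>}"
  proof
    fix e assume e: "e \<in> E"
    then obtain y where y: "(e, y) \<in> \<Gamma>" "y - e \<in> K"
      using E unfolding \<Phi>_def by blast
    then have "y - e + e \<in> span E"
      using K e span_base span_add by blast
    then show "e \<in> {x. \<exists>y\<in>span E. (x, y) \<in> \<Gamma>}"
      using y(1) by auto
  qed
  ultimately show ?thesis
    using x span_minimal by blast
qed

lemma span_\<Phi>_closed:
  assumes E: "E \<subseteq> \<Phi>" and K: "K \<subseteq> span E" and x: "x \<in> span E" and xy: "(x, y) \<in> \<Gamma>"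
  shows "y \<in> span E"
proof -
  obtain z where z: "z \<in> span E" "(x, z) \<in> \<Gamma>"
    using span_\<Phi>_image[OF E K x] by blast
  then have "y - z + z \<in> span E"
    using \<Gamma>_unique[OF xy] K span_add by blast
  then show ?thesis
    by simp
qed

text \<open>
  Modulo \<^term>\<open>K\<close> the relation is a \<^term>\<open>\<sigma>\<close>-semilinear map and \<^term>\<open>\<Phi>\<close> is its set of fixed points, so
  this is Galois descent.
\<close>

lemma stable_subspace_spanned_by_fixed:
  assumes B: "subspace B" "K \<subseteq> B" "B \<subseteq> span \<Phi>"
    and stable: "\<And>x y. x \<in> B \<Longrightarrow> (x, y) \<in> \<Gamma> \<Longrightarrow> y \<in> B"
  shows "B = span (\<Phi> \<inter> B)"
proof
  let ?B' = "span (\<Phi> \<inter> B)"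
  have B'B: "?B' \<subseteq> B"
    using span_minimal B(1) by blast
  have KB': "K \<subseteq> ?B'"
    using K_subset_\<Phi> B(2) span_base by blast
  show "?B' \<subseteq> B"
    by (fact B'B)
  \<comment> \<open>A shortest-relation argument: \<open>b\<close> is written modulo
    \<open>?B'\<close> as a combination of vectors of \<open>E\<close>, and the induction removes
    vectors from \<open>E\<close>.\<close>
  have main: "b \<in> ?B'" if "finite E" "E \<subseteq> \<Phi>" "b \<in> B" "b \<in> span (E \<union> (\<Phi> \<inter> B))" for E b
    using that
  proof (induction "card E" arbitrary: E b rule: less_induct)
    case less
    obtain x \<beta> where x: "x \<in> span E" "b = x + \<beta>" "\<beta> \<in> ?B'"
      using less.prems(4) unfolding span_Un by blast
    obtain z where "x = (\<Sum>e\<in>E. z e *s e)"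
      using x(1) unfolding span_finite[OF less.prems(1)] by (rule rangeE)
    then have b: "b = (\<Sum>e\<in>E. z e *s e) + \<beta>" "\<beta> \<in> ?B'"
      using x by auto
    show ?case
    proof (cases "\<forall>e\<in>E. z e = 0")
      case True
      then show ?thesis
        using b by simp
    next
      case False
      then obtain e0 where e0: "e0 \<in> E" "z e0 \<noteq> 0"
        by blast
      \<comment> \<open>The coefficient of \<open>e0\<close> is normalized to 1, which \<sigma>
        fixes, so that this term cancels when the vector is subtracted from its successor.\<close>
      define y where "y e = z e / z e0" for e
      define b1 where "b1 = inverse (z e0) *s b"
      define \<phi> where "\<phi> = (\<Sum>e\<in>E. y e *s e)"
      have b1B: "b1 \<in> B"
        unfolding b1_def using less.prems(3) subspace_scale[OF B(1)] by blast
      have b_b1: "b = z e0 *s b1"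
        unfolding b1_def using e0(2) by simp
      have "b1 - \<phi> = inverse (z e0) *s \<beta>"
        unfolding b1_def \<phi>_def b(1) y_def
        by (simp add: scale_right_distrib scale_sum_right divide_inverse mult.commute)
      then have b1\<phi>: "b1 - \<phi> \<in> ?B'"
        using b(2) span_scale by simp
      have "\<forall>e\<in>E. \<exists>f. (e, f) \<in> \<Gamma> \<and> f - e \<in> K"
        using less.prems(2) unfolding \<Phi>_def by blast
      from bchoice[OF this] obtain f where f: "\<And>e. e \<in> E \<Longrightarrow> (e, f e) \<in> \<Gamma> \<and> f e - e \<in> K"
        by blast
      have sum\<Gamma>: "((\<Sum>e\<in>E. c e *s e), (\<Sum>e\<in>E. \<sigma> (c e) *s f e)) \<in> \<Gamma>" for c
      proof -
        have "(\<Sum>e\<in>E. pscale (c e) (e, f e)) \<in> \<Gamma>"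
          using f by (intro P.subspace_sum[OF subspace_\<Gamma>] P.subspace_scale[OF subspace_\<Gamma>]) auto
        then show ?thesis
          by (simp add: sum_Pair)
      qed
      define s where "s = (\<Sum>e\<in>E. \<sigma> (y e) *s f e)"
      have \<phi>s: "(\<phi>, s) \<in> \<Gamma>"
        unfolding \<phi>_def s_def by (rule sum\<Gamma>)
      have "s - (\<Sum>e\<in>E. \<sigma> (y e) *s e) = (\<Sum>e\<in>E. \<sigma> (y e) *s (f e - e))"
        unfolding s_def by (simp add: sum_subtractf scale_right_diff_distrib)
      also have "\<dots> \<in> K"
        using f by (intro subspace_sum[OF subspace_K] subspace_scale[OF subspace_K]) auto
      finally have sK: "s - (\<Sum>e\<in>E. \<sigma> (y e) *s e) \<in> K" .
      obtain c where c: "(b1, c) \<in> \<Gamma>"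
        using span_\<Phi>_image[of \<Phi> b1] K_subset_\<Phi> span_superset b1B B(3) by blast
      have cB: "c \<in> B"
        using stable[OF b1B c] .
      have cs: "c - s \<in> ?B'"
        using span_\<Phi>_closed[OF _ KB' b1\<phi> \<Gamma>_diff[OF c \<phi>s]] by blast
      \<comment> \<open>Modulo \<open>?B'\<close>, the difference \<open>c - b1\<close> has the
        coefficients \<open>d\<close>, and \<open>d e0 = 0\<close>. It lies in \<open>B\<close> and
        needs only the vectors of \<open>E - {e0}\<close>, so the induction hypothesis puts it into
        \<open>?B'\<close>.\<close>
      define d where "d e = \<sigma> (y e) - y e" for e
      have d0: "d e0 = 0"
        unfolding d_def y_def using e0(2) \<sigma>_one by simp
      have sumd: "(\<Sum>e\<in>E. d e *s e) = (\<Sum>e\<in>E. \<sigma> (y e) *s e) - \<phi>"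
        unfolding d_def \<phi>_def by (simp add: scale_left_diff_distrib sum_subtractf)
      have sumd': "(\<Sum>e\<in>E. d e *s e) = (\<Sum>e\<in>E - {e0}. d e *s e)"
        using d0 less.prems(1) e0(1) by (subst sum.remove[of E e0]) auto
      have "(c - b1) - (\<Sum>e\<in>E. d e *s e) = (c - s) + (s - (\<Sum>e\<in>E. \<sigma> (y e) *s e)) - (b1 - \<phi>)"
        unfolding sumd by simp
      also have "\<dots> \<in> ?B'"
        by (rule span_diff[OF span_add[OF cs subsetD[OF KB' sK]] b1\<phi>])
      finally have cb: "(c - b1) - (\<Sum>e\<in>E. d e *s e) \<in> ?B'" .
      have "(\<Sum>e\<in>E. d e *s e) \<in> span (E - {e0})"
        unfolding sumd' by (intro span_sum span_scale span_base)
      then have "(\<Sum>e\<in>E. d e *s e) + ((c - b1) - (\<Sum>e\<in>E. d e *s e)) \<in> span ((E - {e0}) \<union> (\<Phi> \<inter> B))"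
        using cb unfolding span_Un by blast
      then have "c - b1 \<in> span ((E - {e0}) \<union> (\<Phi> \<inter> B))"
        by simp
      then have "c - b1 \<in> ?B'"
        using less.prems(1,2) by (intro less.hyps[of "E - {e0}" "c - b1"] card_Diff1_less e0(1)
            subspace_diff[OF B(1) cB b1B]) auto
      from span_diff[OF this cb] have dB': "(\<Sum>e\<in>E. d e *s e) \<in> ?B'"
        by simp
      show ?thesis
      proof (cases "\<forall>e\<in>E. d e = 0")
        case True
        then have "(\<Sum>e\<in>E. \<sigma> (y e) *s e) = \<phi>"
          using sumd by simp
        then have "s - \<phi> \<in> K"
          using sK by simp
        then have "\<phi> \<in> \<Phi>"
          unfolding \<Phi>_def using \<phi>s by blast
        moreover have "b1 - (b1 - \<phi>) \<in> B"
          by (rule subspace_diff[OF B(1) b1B subsetD[OF B'B b1\<phi>]])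
        ultimately have "\<phi> \<in> ?B'"
          using span_base by auto
        from span_add[OF b1\<phi> this] have "b1 \<in> ?B'"
          by simp
        then show ?thesis
          unfolding b_b1 by (rule span_scale)
      next
        case False
        then obtain e1 where e1: "e1 \<in> E" "d e1 \<noteq> 0"
          by blast
        let ?T = "(E - {e1}) \<union> (\<Phi> \<inter> B)"
        have "(\<Sum>e\<in>E. d e *s e) = d e1 *s e1 + (\<Sum>e\<in>E - {e1}. d e *s e)"
          using less.prems(1) e1(1) by (rule sum.remove)
        moreover have "(\<Sum>e\<in>E - {e1}. d e *s e) \<in> span ?T"
          by (intro span_sum span_scale span_base) blast
        moreover have "(\<Sum>e\<in>E. d e *s e) \<in> span ?T"
          using dB' span_mono[of "\<Phi> \<inter> B" ?T] by blast
        ultimately have "d e1 *s e1 \<in> span ?T"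
          by (simp add: span_add_eq2)
        then have "e1 \<in> span ?T"
          using e1(2) span_scale[of "d e1 *s e1" ?T "inverse (d e1)"] by simp
        then have "span (insert e1 ?T) = span ?T"
          by (rule span_redundant)
        moreover have "insert e1 ?T = E \<union> (\<Phi> \<inter> B)"
          using e1(1) by blast
        ultimately have "b \<in> span ?T"
          using less.prems(4) by simp
        then show ?thesis
          using less.prems by (intro less.hyps[of "E - {e1}" b] card_Diff1_less e1(1)) auto
      qed
    qed
  qed
  show "B \<subseteq> ?B'"
  proof
    fix b assume b: "b \<in> B"
    then have "b \<in> span \<Phi>"
      using B(3) by blast
    then obtain E c where E: "finite E" "E \<subseteq> \<Phi>" "b = (\<Sum>e\<in>E. c e *s e)"
      unfolding span_explicit by blast
    then have "b \<in> span E"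
      by (simp add: span_sum span_scale span_base)
    then have "b \<in> span (E \<union> (\<Phi> \<inter> B))"
      using span_mono[of E] by blast
    then show "b \<in> ?B'"
      using main E b by blast
  qed
qed

text \<open>Compatibility of the domain of \<open>\<Gamma>\<close> shows that \<open>u\<close> also
  has a successor under \<open>\<Gamma>\<^sub>0\<close>, and there the kernel component can be
  taken. Hence the semilinear map modulo \<open>K\<close> restricts to the kernel of \<pi>.\<close>

lemma kernel_total:
  assumes "(u, y) \<in> \<Gamma>" "\<pi> u = 0"
  shows "\<exists>z. \<pi> z = 0 \<and> (u, z) \<in> \<Gamma>"
proof -
  have "u \<in> \<Gamma>\<inverse> `` X"
    using assms(1) \<Gamma>_X by blast
  then have "u \<in> \<Gamma>\<^sub>0\<inverse> `` X"
    using compatD(5)[OF compat_preimage[OF compat_X] assms(2)] by blast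
  then obtain z where "(u, z) \<in> \<Gamma>\<^sub>0"
    by blast
  then have "(u, z - \<pi> z) \<in> \<Gamma>"
    using \<Gamma>\<^sub>0_complement assms(2) by fastforce
  moreover have "\<pi> (z - \<pi> z) = 0"
    by (simp add: \<pi>.diff \<pi>_idem)
  ultimately show ?thesis
    by blast
qed

lemma span_\<Phi>_total: "x \<in> span \<Phi> \<Longrightarrow> \<exists>y\<in>span \<Phi>. (x, y) \<in> \<Gamma>"
  using span_\<Phi>_image[of \<Phi> x] K_subset_\<Phi> span_superset by blast

lemma span_\<Phi>_stable: "x \<in> span \<Phi> \<Longrightarrow> (x, y) \<in> \<Gamma> \<Longrightarrow> y \<in> span \<Phi>"
  using span_\<Phi>_closed[of \<Phi> x y] K_subset_\<Phi> span_superset by blast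

lemma K_span_\<Phi>: "K \<subseteq> span \<Phi>"
  using K_subset_\<Phi> span_superset by blast

lemma K\<^sub>0_span_\<Phi>\<^sub>0: "K\<^sub>0 \<subseteq> span \<Phi>\<^sub>0"
  using Kd(3) K_subset_\<Phi> span_superset unfolding \<Phi>\<^sub>0_eq by blast

text \<open>The successor witnessing membership in \<open>\<Phi>\<close> may leave the kernel of
  \<pi>. It can be exchanged for one inside, since successors differ by elements of
  \<open>K\<close>; inside the kernel, \<open>\<Gamma>\<close> agrees with
  \<open>\<Gamma>\<^sub>0\<close> and \<open>K\<close> with \<open>K\<^sub>0\<close>.\<close>

lemma kernel_\<Phi>: "x \<in> \<Phi> \<Longrightarrow> \<pi> x = 0 \<Longrightarrow> x \<in> \<Phi>\<^sub>0"
proof -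
  assume x: "x \<in> \<Phi>" "\<pi> x = 0"
  then obtain y where y: "(x, y) \<in> \<Gamma>" "y - x \<in> K"
    by (metis \<Phi>E)
  obtain z where z: "\<pi> z = 0" "(x, z) \<in> \<Gamma>"
    using kernel_total[OF y(1) x(2)] by blast
  have "(z - y) + (y - x) \<in> K"
    using \<Gamma>_unique[OF z(2) y(1)] y(2) by (rule subspace_add[OF subspace_K])
  then have "z - x \<in> K\<^sub>0"
    using Kd(5)[of "z - x"] x(2) z(1) by (simp add: \<pi>.diff)
  moreover have "(x, z) \<in> \<Gamma>\<^sub>0"
    using z \<Gamma>_kernel x(2) by blast
  ultimately show "x \<in> \<Phi>\<^sub>0"
    unfolding \<Phi>\<^sub>0_def by blast
qed

lemma subspace_ker_\<pi>: "subspace {x. \<pi> x = 0}"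
  by (rule \<pi>.subspace_kernel)

text \<open>The delicate half of left exactness is the kernel: a combination of fixed vectors that
  lies in the kernel of \<pi> must be, modulo \<open>K\<close>, a combination of fixed vectors of
  the kernel. Descent supplies this.\<close>

lemma compat_span_\<Phi>: "compat (span \<Phi>) (span \<Phi>\<^sub>0)"
proof (rule compatI)
  show "span \<Phi> \<subseteq> X"
    using span_minimal[OF \<Phi>_X subspace_X] .
  show "span \<Phi>\<^sub>0 = \<theta> ` span \<Phi>"
    unfolding \<Phi>\<^sub>0_eq by (rule \<theta>.span_image)
  have span_\<pi>: "\<pi> x \<in> span \<Phi>\<^sub>0" if "\<And>x. x \<in> S \<Longrightarrow> \<pi> x \<in> \<Phi>\<^sub>0" "x \<in> span S" for S x
  proof -
    have "\<pi> x \<in> span (\<pi> ` S)"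
      using that(2) \<pi>.span_image by blast
    then show ?thesis
      using span_mono[of "\<pi> ` S" \<Phi>\<^sub>0] that(1) by blast
  qed
  show "\<pi> x \<in> span \<Phi>\<^sub>0" if "x \<in> span \<Phi>\<^sub>0" for x
    using span_\<pi>[OF \<Phi>\<^sub>0_\<pi> that] .
  have "u \<in> span \<Phi>\<^sub>0" if u: "u \<in> span \<Phi>" "\<pi> u = 0" for u
  proof -
    define U where "U = span \<Phi> \<inter> {x. \<pi> x = 0}"
    \<comment> \<open>Descent is stated for stable subspaces containing \<open>K\<close>, hence the
      sum. The \<open>K\<close>-part of a fixed vector of \<open>B\<close> can be split off
      afterwards because \<open>K\<close> is contained in \<open>\<Phi>\<close>.\<close>
    define B where "B = {x + k |x k. x \<in> U \<and> k \<in> K}"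
    have sU: "subspace U"
      unfolding U_def using subspace_inter[OF subspace_span subspace_ker_\<pi>] .
    have KB: "K \<subseteq> B"
      unfolding B_def using subspace_0[OF sU] by force
    have uB: "U \<subseteq> B"
      unfolding B_def using subspace_0[OF subspace_K] by force
    have "B = span (\<Phi> \<inter> B)"
    proof (rule stable_subspace_spanned_by_fixed)
      show "subspace B"
        unfolding B_def by (rule subspace_sums[OF sU subspace_K])
      show "K \<subseteq> B"
        by (rule KB)
      show "B \<subseteq> span \<Phi>"
        unfolding B_def U_def using K_span_\<Phi> by (auto intro!: span_add)
      fix x y assume x: "x \<in> B" and xy: "(x, y) \<in> \<Gamma>"
      obtain v k where v: "x = v + k" "v \<in> span \<Phi>" "\<pi> v = 0" "k \<in> K"
        using x unfolding B_def U_def by blast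
      obtain z where z: "\<pi> z = 0" "(v, z) \<in> \<Gamma>"
        using kernel_total v(3) span_\<Phi>_total[OF v(2)] by blast
      have "(k, y - z) \<in> \<Gamma>"
        using \<Gamma>_diff[OF xy z(2)] v(1) by simp
      then have "y - z \<in> K"
        using K_closed[OF v(4)] by blast
      moreover have "z \<in> U"
        unfolding U_def using span_\<Phi>_stable[OF v(2) z(2)] z(1) by blast
      moreover have "y = z + (y - z)"
        by simp
      ultimately show "y \<in> B"
        unfolding B_def by blast
    qed
    moreover have "\<Phi> \<inter> B \<subseteq> span ((\<Phi> \<inter> {x. \<pi> x = 0}) \<union> K)"
    proof
      fix x assume x: "x \<in> \<Phi> \<inter> B"
      then obtain v k where v: "x = v + k" "\<pi> v = 0" "k \<in> K"
        unfolding B_def U_def by blast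
      have "v \<in> \<Phi>"
        using \<Phi>_diff[of x k] x v K_subset_\<Phi> by auto
      then show "x \<in> span ((\<Phi> \<inter> {x. \<pi> x = 0}) \<union> K)"
        unfolding v(1) using v(2,3) by (intro span_add span_base) auto
    qed
    ultimately have "u \<in> span ((\<Phi> \<inter> {x. \<pi> x = 0}) \<union> K)"
      using uB u span_minimal[OF _ subspace_span] unfolding U_def by blast
    then obtain v k where v: "u = v + k" "v \<in> span (\<Phi> \<inter> {x. \<pi> x = 0})" "k \<in> K"
      unfolding span_Un span_eq_iff[THEN iffD2, OF subspace_K] by blast
    have "\<pi> v = 0"
      using span_minimal[OF _ subspace_ker_\<pi>, of "\<Phi> \<inter> {x. \<pi> x = 0}"] v(2) by blast
    then have "k \<in> K\<^sub>0"
      using Kd(5)[of k] v(1,3) u(2) by (simp add: \<pi>.add)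
    moreover have "v \<in> span \<Phi>\<^sub>0"
      using v(2) span_mono[of "\<Phi> \<inter> {x. \<pi> x = 0}" \<Phi>\<^sub>0] kernel_\<Phi> by blast
    ultimately show ?thesis
      unfolding v(1) using K\<^sub>0_span_\<Phi>\<^sub>0 by (intro span_add) auto
  qed
  moreover have "\<pi> x \<in> span \<Phi>\<^sub>0" if "x \<in> span \<Phi>" for x
    using span_\<pi>[OF \<Phi>_\<pi> that] .
  ultimately show "(\<forall>x\<in>span \<Phi>. \<pi> x = 0 \<longrightarrow> x \<in> span \<Phi>\<^sub>0) \<and> (\<forall>x\<in>span \<Phi>. \<pi> x \<in> span \<Phi>\<^sub>0) \<or>
      (\<forall>x\<in>span \<Phi>\<^sub>0. \<pi> x = 0 \<longrightarrow> x \<in> span \<Phi>) \<and> (\<forall>x\<in>span \<Phi>\<^sub>0. \<exists>y\<in>span \<Phi>. \<pi> y = \<pi> x)"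
    by blast
qed auto

text \<open>Compatibility of the spans lifts \<open>w\<close> to the span of \<open>\<Phi>\<close>,
  though not to \<open>\<Phi>\<close>. Descent is applied to the preimage of the line through
  \<open>w\<close> modulo \<open>K\<^sub>0\<close>: if no fixed vector lifted \<open>w\<close>, all
  fixed vectors of this preimage would project into \<open>K\<^sub>0\<close>, and with them the lift
  in the span.\<close>

lemma fixed_lift_mod_K:
  assumes w: "(w, w) \<in> \<Gamma>\<^sub>0" "\<pi> w = w"
  shows "\<exists>v\<in>\<Phi>. \<pi> v - w \<in> K\<^sub>0"
proof (rule ccontr)
  assume neg: "\<not> ?thesis"
  note sK0 = Kd(8)
  have w0: "w \<notin> K\<^sub>0"
  proof
    assume "w \<in> K\<^sub>0"
    then have "\<pi> 0 - w \<in> K\<^sub>0"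
      using subspace_neg[OF sK0] by (simp add: \<pi>.zero)
    then show False
      using neg K_subset_\<Phi> subspace_0[OF subspace_K] by blast
  qed
  have "w \<in> \<Phi>\<^sub>0"
    unfolding \<Phi>\<^sub>0_def using w(1) subspace_0[OF sK0] by auto
  then obtain v0 where v0: "v0 \<in> span \<Phi>" "\<pi> v0 = w"
    using compatD(12)[OF compat_span_\<Phi>, of w] w(2) span_base by auto
  define B where "B = {v \<in> span \<Phi>. \<exists>z. \<pi> v - z *s w \<in> K\<^sub>0}"
  have "B = span (\<Phi> \<inter> B)"
  proof (rule stable_subspace_spanned_by_fixed)
    show "subspace B"
    proof (rule subspaceI)
      have "\<pi> 0 - 0 *s w \<in> K\<^sub>0"
        using subspace_0[OF sK0] by (simp add: \<pi>.zero)
      then show "0 \<in> B"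
        unfolding B_def using span_zero by blast
    next
      fix x y assume "x \<in> B" "y \<in> B"
      then obtain a b where xy: "x \<in> span \<Phi>" "y \<in> span \<Phi>" "\<pi> x - a *s w \<in> K\<^sub>0" "\<pi> y - b *s w \<in> K\<^sub>0"
        unfolding B_def by blast
      have "\<pi> (x + y) - (a + b) *s w = (\<pi> x - a *s w) + (\<pi> y - b *s w)"
        by (simp add: \<pi>.add scale_left_distrib)
      then show "x + y \<in> B"
        unfolding B_def using xy span_add subspace_add[OF sK0] by (metis (mono_tags, lifting) mem_Collect_eq)
    next
      fix x c assume "x \<in> B"
      then obtain a where xy: "x \<in> span \<Phi>" "\<pi> x - a *s w \<in> K\<^sub>0"
        unfolding B_def by blast
      have "\<pi> (c *s x) - (c * a) *s w = c *s (\<pi> x - a *s w)"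
        by (simp add: \<pi>.scale scale_right_diff_distrib)
      then show "c *s x \<in> B"
        unfolding B_def using xy span_scale subspace_scale[OF sK0] by (metis (mono_tags, lifting) mem_Collect_eq)
    qed
    show "K \<subseteq> B"
    proof
      fix k assume k: "k \<in> K"
      then have "\<pi> k - 0 *s w \<in> K\<^sub>0"
        using Kd(7) by simp
      then show "k \<in> B"
        unfolding B_def using k K_span_\<Phi> by blast
    qed
    show "B \<subseteq> span \<Phi>"
      unfolding B_def by blast
    fix x y assume x: "x \<in> B" and xy: "(x, y) \<in> \<Gamma>"
    obtain z where z: "x \<in> span \<Phi>" "\<pi> x - z *s w \<in> K\<^sub>0"
      using x unfolding B_def by blast
    have "(\<pi> x - z *s w, \<pi> y - \<sigma> z *s w) \<in> \<Gamma>\<^sub>0"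
      using \<Gamma>\<^sub>0_diff[OF \<Gamma>_\<pi>[OF xy] \<Gamma>\<^sub>0_scale[OF w(1)]] .
    then have "\<pi> y - \<sigma> z *s w \<in> K\<^sub>0"
      using K\<^sub>0_closed[OF z(2)] by blast
    then show "y \<in> B"
      unfolding B_def using span_\<Phi>_stable[OF z(1) xy] by blast
  qed
  moreover have "\<pi> x \<in> K\<^sub>0" if x: "x \<in> \<Phi> \<inter> B" for x
  proof -
    obtain z where z: "\<pi> x - z *s w \<in> K\<^sub>0"
      using x unfolding B_def by blast
    obtain y where y: "(x, y) \<in> \<Gamma>" "y - x \<in> K"
      using x by (metis IntD1 \<Phi>E)
    have "(\<pi> x - z *s w, \<pi> y - \<sigma> z *s w) \<in> \<Gamma>\<^sub>0"
      using \<Gamma>\<^sub>0_diff[OF \<Gamma>_\<pi>[OF y(1)] \<Gamma>\<^sub>0_scale[OF w(1)]] .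
    then have 1: "\<pi> y - \<sigma> z *s w \<in> K\<^sub>0"
      using K\<^sub>0_closed[OF z] by blast
    have 2: "\<pi> y - \<pi> x \<in> K\<^sub>0"
      using Kd(7)[OF y(2)] by (simp add: \<pi>.diff)
    \<comment> \<open>Both \<open>\<pi> x\<close> and \<open>w\<close> are fixed modulo
      \<open>K\<^sub>0\<close>, and \<open>w\<close> is not in \<open>K\<^sub>0\<close>, so the
      coefficient \<open>z\<close> is fixed by \<sigma>. If it were nonzero, dividing
      \<open>x\<close> by \<open>z\<close> would stay in \<open>\<Phi>\<close> and lift
      \<open>w\<close>.\<close>
    have "(\<sigma> z - z) *s w = (\<pi> y - \<pi> x) + (\<pi> x - z *s w) - (\<pi> y - \<sigma> z *s w)"
      by (simp add: scale_left_diff_distrib)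
    also have "\<dots> \<in> K\<^sub>0"
      by (rule subspace_diff[OF sK0 subspace_add[OF sK0 2 z] 1])
    finally have "(\<sigma> z - z) *s w \<in> K\<^sub>0" .
    then have "inverse (\<sigma> z - z) *s ((\<sigma> z - z) *s w) \<in> K\<^sub>0"
      by (rule subspace_scale[OF sK0])
    then have \<sigma>z: "\<sigma> z = z"
      using w0 by (cases "\<sigma> z = z") auto
    have "z = 0"
    proof (rule ccontr)
      assume nz: "z \<noteq> 0"
      have "\<sigma> (inverse z) * z = 1"
        using \<sigma>_mult[of "inverse z" z] \<sigma>z \<sigma>_one nz by simp
      then have "\<sigma> (inverse z) = inverse z"
        using nz by (metis inverse_unique mult.commute)
      then have "inverse z *s x \<in> \<Phi>"
        using \<Phi>_scale x by blast
      moreover have "\<pi> (inverse z *s x) - w = inverse z *s (\<pi> x - z *s w)"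
        using nz by (simp add: \<pi>.scale scale_right_diff_distrib)
      ultimately show False
        using neg subspace_scale[OF sK0 z] by metis
    qed
    then show ?thesis
      using z by simp
  qed
  then have "\<pi> ` (\<Phi> \<inter> B) \<subseteq> K\<^sub>0"
    by blast
  then have "\<pi> ` span (\<Phi> \<inter> B) \<subseteq> K\<^sub>0"
    unfolding \<pi>.span_image[symmetric] using span_minimal sK0 by blast
  moreover have "\<pi> v0 - 1 *s w \<in> K\<^sub>0"
    using v0(2) subspace_0[OF sK0] by simp
  then have "v0 \<in> B"
    unfolding B_def using v0(1) by blast
  ultimately show False
    using v0(2) w0 by blast
qed

text \<open>Three corrections, none of which spoils the earlier ones: an element of \<open>K\<close>
  makes the projection equal to \<open>w\<close>, a change of successor moves the defect into the
  kernel of \<pi>, and a solution of the coboundary equation inside that kernel removes the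
  defect.\<close>

lemma fixed_lift_total:
  assumes w: "(w, w) \<in> \<Gamma>\<^sub>0" "\<pi> w = w"
  shows "\<exists>v. \<pi> v = w \<and> (v, v) \<in> \<Gamma>"
proof -
  obtain v1 where v1: "v1 \<in> \<Phi>" "\<pi> v1 - w \<in> K\<^sub>0"
    using fixed_lift_mod_K[OF w] by blast
  obtain k where k: "k \<in> K" "\<pi> k = \<pi> v1 - w"
    using Kd(12)[OF v1(2)] w(2) by (auto simp: \<pi>.diff \<pi>_idem)
  define v where "v = v1 - k"
  have v: "v \<in> \<Phi>" "\<pi> v = w"
    unfolding v_def using \<Phi>_diff[OF v1(1)] k K_subset_\<Phi> by (auto simp: \<pi>.diff)
  obtain y where y: "(v, y) \<in> \<Gamma>" "y - v \<in> K"
    using v(1) by (metis \<Phi>E)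
  have "(0, \<pi> y - w) \<in> \<Gamma>\<^sub>0"
    using \<Gamma>\<^sub>0_diff[OF \<Gamma>_\<pi>[OF y(1)] w(1)] v(2) by simp
  then have "\<pi> y - w \<in> reach\<^sub>0 1"
    by auto
  \<comment> \<open>An element of \<open>reach 1\<close> is a successor of 0, so it can be
    subtracted from \<open>y\<close> while \<open>v\<close> is kept. Membership in \<open>K\<close>
    alone would not justify this.\<close>
  then obtain k1 where k1: "k1 \<in> reach 1" "\<pi> k1 = \<pi> y - w"
    using compatD(12)[OF compat_reach, of "\<pi> y - w" 1] w(2) by (auto simp: \<pi>.diff \<pi>_idem)
  have k1K: "k1 \<in> K"
    unfolding K_def using k1(1) by blast
  have "(0, k1) \<in> \<Gamma>"
    using k1(1) by auto
  then have vy: "(v, y - k1) \<in> \<Gamma>"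
    using \<Gamma>_diff[OF y(1)] by fastforce
  have "y - k1 - v = (y - v) - k1"
    by simp
  also have "\<dots> \<in> K"
    using subspace_diff[OF subspace_K y(2) k1K] .
  finally have \<kappa>: "y - k1 - v \<in> K" .
  have \<pi>\<kappa>: "\<pi> (y - k1 - v) = 0"
    using k1(2) v(2) by (simp add: \<pi>.diff)
  then have "y - k1 - v \<in> K\<^sub>0"
    using \<kappa> Kd(5) by blast
  then obtain s where s: "(s, s + (y - k1 - v)) \<in> \<Gamma>\<^sub>0"
    using K\<^sub>0_coboundary by blast
  have "s + (y - k1 - v) - (\<pi> s + 0) = s - \<pi> s + (y - k1 - v)"
    by simp
  then have "(s - \<pi> s, s - \<pi> s + (y - k1 - v)) \<in> \<Gamma>"
    using \<Gamma>\<^sub>0_complement[OF s, unfolded \<pi>.add \<pi>\<kappa>] by argo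
  then have "(v - (s - \<pi> s), y - k1 - (s - \<pi> s + (y - k1 - v))) \<in> \<Gamma>"
    by (rule \<Gamma>_diff[OF vy])
  moreover have "y - k1 - (s - \<pi> s + (y - k1 - v)) = v - (s - \<pi> s)"
    by simp
  moreover have "\<pi> (v - (s - \<pi> s)) = w"
    using v(2) by (simp add: \<pi>.diff \<pi>_idem)
  ultimately show ?thesis
    by metis
qed

end

section \<open>Iterated domains and the reduction to relations with successors\<close>

context roth_relation
begin

primrec dom :: "nat \<Rightarrow> 'v set" where
  "dom 0 = X"
| "dom (Suc n) = \<Gamma>\<inverse> `` dom n"

primrec dom\<^sub>0 :: "nat \<Rightarrow> 'v set" where
  "dom\<^sub>0 0 = X"
| "dom\<^sub>0 (Suc n) = \<Gamma>\<^sub>0\<inverse> `` dom\<^sub>0 n"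

lemma compat_dom: "compat (dom n) (dom\<^sub>0 n)"
  by (induction n) (auto intro: compat_X compat_preimage)

lemma dom_antimono: "dom (Suc n) \<subseteq> dom n"
proof (induction n)
  case 0
  then show ?case
    using \<Gamma>_X by auto
next
  case (Suc n)
  then show ?case
    by auto
qed

lemma dom_stabilizes: "\<exists>n. dom (Suc n) = dom n"
proof (rule ccontr)
  assume neg: "\<not> ?thesis"
  have "dim (dom (Suc n)) < dim (dom n)" for n
  proof (rule ccontr)
    assume "\<not> dim (dom (Suc n)) < dim (dom n)"
    then have "dom (Suc n) = dom n"
      using subspace_dim_equal_fin_dim[OF compatD(1)[OF compat_dom[of "Suc n"]] _ dom_antimono]
        fin_dim_subset[OF fin_dim_X compatD(2)[OF compat_dom[of n]]] by simp
    then show False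
      using neg by blast
  qed
  then have less: "dim (dom (Suc n)) < dim (dom n)" for n .
  have "dim (dom n) + n \<le> dim (dom 0)" for n
  proof (induction n)
    case (Suc n)
    then show ?case
      using less[of n] by linarith
  qed simp
  from this[of "Suc (dim (dom 0))"] show False
    by linarith
qed

text \<open>Where the descending chain of domains is stationary, each vector has a successor in the
  same domain, and compatibility lets all axioms survive the restriction. The vector
  \<open>w\<close> is not lost, because it starts a constant sequence under
  \<open>\<Gamma>\<^sub>0\<close>.\<close>

theorem fixed_lift:
  assumes w: "(w, w) \<in> \<Gamma>\<^sub>0" "\<pi> w = w"
  shows "\<exists>v. \<pi> v = w \<and> (v, v) \<in> \<Gamma>"
proof -
  obtain n where n: "dom (Suc n) = dom n"
    using dom_stabilizes by blast
  note D = compatD[OF compat_dom[of n]]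
  interpret T: total_roth_relation scale \<sigma> X \<pi> \<theta> "\<Gamma> \<inter> dom n \<times> dom n" "\<Gamma>\<^sub>0 \<inter> dom\<^sub>0 n \<times> dom\<^sub>0 n"
  proof unfold_locales
    fix x y x' y'
    assume "(x, y) \<in> \<Gamma> \<inter> dom n \<times> dom n" "(x', y') \<in> \<Gamma> \<inter> dom n \<times> dom n"
    then show "(x + x', y + y') \<in> \<Gamma> \<inter> dom n \<times> dom n"
      using \<Gamma>_add subspace_add[OF D(1)] by blast
  next
    fix x y z
    assume "(x, y) \<in> \<Gamma> \<inter> dom n \<times> dom n"
    then show "(z *s x, \<sigma> z *s y) \<in> \<Gamma> \<inter> dom n \<times> dom n"
      using \<Gamma>_scale subspace_scale[OF D(1)] by blast
  next
    show "\<Gamma>\<^sub>0 \<inter> dom\<^sub>0 n \<times> dom\<^sub>0 n = map_prod \<theta> \<theta> ` (\<Gamma> \<inter> dom n \<times> dom n)"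
    proof
      show "map_prod \<theta> \<theta> ` (\<Gamma> \<inter> dom n \<times> dom n) \<subseteq> \<Gamma>\<^sub>0 \<inter> dom\<^sub>0 n \<times> dom\<^sub>0 n"
        using \<Gamma>_\<theta> D(10) by auto
      show "\<Gamma>\<^sub>0 \<inter> dom\<^sub>0 n \<times> dom\<^sub>0 n \<subseteq> map_prod \<theta> \<theta> ` (\<Gamma> \<inter> dom n \<times> dom n)"
      proof (rule subrelI)
        fix x y assume xy: "(x, y) \<in> \<Gamma>\<^sub>0 \<inter> dom\<^sub>0 n \<times> dom\<^sub>0 n"
        then obtain a b where ab: "(a, b) \<in> \<Gamma>" "x = \<theta> a" "y = \<theta> b"
          by (metis IntD1 \<Gamma>\<^sub>0_E)
        have "a \<in> X" "b \<in> X" "\<theta> a \<in> \<theta> ` dom n" "\<theta> b \<in> \<theta> ` dom n"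
          using ab \<Gamma>_X xy D(3) by auto
        then have "a \<in> dom n" "b \<in> dom n"
          using inj_on_image_mem_iff[OF inj_\<theta>] D(2) by blast+
        then show "(x, y) \<in> map_prod \<theta> \<theta> ` (\<Gamma> \<inter> dom n \<times> dom n)"
          using ab by force
      qed
    qed
  next
    fix x y
    assume "(x, y) \<in> \<Gamma>\<^sub>0 \<inter> dom\<^sub>0 n \<times> dom\<^sub>0 n"
    then show "(\<pi> x, \<pi> y) \<in> \<Gamma>\<^sub>0 \<inter> dom\<^sub>0 n \<times> dom\<^sub>0 n"
      using \<Gamma>\<^sub>0_\<pi> D(4) by blast
  next
    fix x y
    assume "(x, y) \<in> \<Gamma> \<inter> dom n \<times> dom n"
    then show "(\<pi> x, \<pi> y) \<in> \<Gamma>\<^sub>0 \<inter> dom\<^sub>0 n \<times> dom\<^sub>0 n"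
      using \<Gamma>_\<pi> D(7) by blast
  next
    fix x y
    assume "\<pi> x = 0" "\<pi> y = 0"
    then show "(x, y) \<in> \<Gamma> \<inter> dom n \<times> dom n \<longleftrightarrow> (x, y) \<in> \<Gamma>\<^sub>0 \<inter> dom\<^sub>0 n \<times> dom\<^sub>0 n"
      using \<Gamma>_kernel[of x y] D(5)[of x] D(5)[of y] by blast
  next
    fix x y
    assume xy: "(x, y) \<in> \<Gamma> \<inter> dom n \<times> dom n"
    then have "y \<in> dom (Suc n)"
      using n by simp
    then show "\<exists>z. (y, z) \<in> \<Gamma> \<inter> dom n \<times> dom n"
      using xy by auto
  next
    show "\<Gamma> \<inter> dom n \<times> dom n \<subseteq> X \<times> X"
      using \<Gamma>_X by blast
  next
    show "(0, 0) \<in> \<Gamma> \<inter> dom n \<times> dom n"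
      using \<Gamma>_zero subspace_0[OF D(1)] by blast
  qed (fact \<sigma>_add \<sigma>_mult \<sigma>_one surj_\<sigma> subspace_X fin_dim_X \<pi>_idem \<pi>_X inj_\<theta> \<theta>_X)+
  have "w \<in> dom\<^sub>0 m" for m
    using w \<Gamma>\<^sub>0_X by (induction m) auto
  then show ?thesis
    using T.fixed_lift_total[of w] w by blast
qed

end

subsection \<open>The center as a field\<close>

text \<open>As a type of class \<open>field\<close> the center can serve as the scalars of the
  vector space locales.\<close>

typedef (overloaded) 'a center = "ring_center :: 'a::division_ring set"
  by (auto simp: ring_center_def intro!: exI[of _ 0])

setup_lifting type_definition_center

lemma center_commute: "Rep_center z * a = a * Rep_center z"
  using Rep_center[of z] by (simp add: ring_center_def)

lemma center_inverse:
  assumes "z \<in> ring_center"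
  shows "inverse z \<in> ring_center"
proof (cases "z = 0")
  case False
  have "inverse z * a = a * inverse z" for a
  proof -
    have "inverse z * a = inverse z * (a * z) * inverse z"
      using False by (simp add: mult.assoc)
    also have "a * z = z * a"
      using assms unfolding ring_center_def by simp
    also have "inverse z * (z * a) * inverse z = a * inverse z"
      using False by (simp flip: mult.assoc)
    finally show ?thesis .
  qed
  then show ?thesis
    unfolding ring_center_def by blast
qed (use assms in simp)

instantiation center :: (division_ring) field
begin

lift_definition zero_center :: "'a center" is 0
  by (simp add: ring_center_def)

lift_definition one_center :: "'a center" is 1
  by (simp add: ring_center_def)

lift_definition plus_center :: "'a center \<Rightarrow> 'a center \<Rightarrow> 'a center" is "(+)"
  by (simp add: ring_center_def distrib_left distrib_right)

lift_definition minus_center :: "'a center \<Rightarrow> 'a center \<Rightarrow> 'a center" is "(-)"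
  by (simp add: ring_center_def left_diff_distrib right_diff_distrib)

lift_definition uminus_center :: "'a center \<Rightarrow> 'a center" is uminus
  by (simp add: ring_center_def)

lift_definition times_center :: "'a center \<Rightarrow> 'a center \<Rightarrow> 'a center" is "(*)"
  by (unfold ring_center_def mem_Collect_eq) (metis mult.assoc)

lift_definition inverse_center :: "'a center \<Rightarrow> 'a center" is inverse
  by (rule center_inverse)

definition divide_center :: "'a center \<Rightarrow> 'a center \<Rightarrow> 'a center" where
  "divide_center x y = x * inverse y"

instance
proof
  fix a b c :: "'a center"
  show "a * b * c = a * (b * c)" "a + b + c = a + (b + c)" "a + b = b + a" "0 + a = a" "1 * a = a"
    "- a + a = 0" "a - b = a + - b" "(a + b) * c = a * c + b * c" "(0::'a center) \<noteq> 1"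
    "inverse (0::'a center) = 0"
    by (transfer, simp add: mult.assoc add.assoc add.commute distrib_right)+
  show "a * b = b * a"
    by transfer (unfold ring_center_def, blast)
  show "a \<noteq> 0 \<Longrightarrow> inverse a * a = 1"
    by transfer simp
  show "a div b = a * inverse b"
    by (rule divide_center_def)
qed

end

definition cscale :: "'a::division_ring center \<Rightarrow> ('i \<Rightarrow> 'a) \<Rightarrow> 'i \<Rightarrow> 'a" where
  "cscale z x = (\<lambda>i. Rep_center z * x i)"

lemma cscale_apply [simp]: "cscale z x i = Rep_center z * x i"
  by (simp add: cscale_def)

interpretation cscale: vector_space_fin "cscale :: 'a::division_ring center \<Rightarrow> ('i \<Rightarrow> 'a) \<Rightarrow> 'i \<Rightarrow> 'a"
  by unfold_locales
    (auto simp: fun_eq_iff plus_center.rep_eq times_center.rep_eq one_center.rep_eq distrib_left distrib_right mult.assoc)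

lemma finite_center_span:
  assumes "finite_dimensional_over_center TYPE('a::division_ring)"
  obtains S :: "'a::division_ring set" where "finite S" "\<And>a. \<exists>z. a = (\<Sum>s\<in>S. Rep_center (z s) * s)"
proof -
  let ?R = "class_ring :: 'a ring"
  note R = ring_of_division_ring[where ?'a = 'a]
  have "\<exists>n. ring.dimension ?R n ring_center UNIV"
    using assms unfolding finite_dimensional_over_center_def ring.finite_dimension_def[OF R] .
  then obtain Us :: "'a list" where Us: "ring.Span ?R ring_center Us = UNIV"
    using ring.exists_base[OF R subfield_ring_center] by fast
  have span: "\<exists>z. a = (\<Sum>s\<in>set us. Rep_center (z s) * s)" if "a = ring.combine ?R Ks us" "set Ks \<subseteq> ring_center" for a Ks us
    using that
  proof (induction Ks us arbitrary: a rule: ring.combine.induct[OF R])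
    case (1 k Ks u us)
    have a: "a = k * u + ring.combine ?R Ks us"
      using 1(2) by (simp add: ring.combine.simps[OF R])
    have ks: "set Ks \<subseteq> ring_center" "k \<in> ring_center"
      using 1(3) by simp_all
    obtain z where z: "ring.combine ?R Ks us = (\<Sum>s\<in>set us. Rep_center (z s) * s)"
      using 1(1)[OF refl ks(1)] by blast
    have k: "Rep_center (Abs_center k) = k"
      using ks(2) by (rule Abs_center_inverse)
    show ?case
    \<comment> \<open>The list may repeat an entry while the sum ranges over a set, so coefficients
      of repeated entries are accumulated.\<close>
    proof (cases "u \<in> set us")
      case True
      let ?z = "z(u := Abs_center k + z u)"
      have "(\<Sum>s\<in>set us. Rep_center (?z s) * s) =
          Rep_center (?z u) * u + (\<Sum>s\<in>set us - {u}. Rep_center (?z s) * s)"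
        using True by (intro sum.remove) auto
      also have "(\<Sum>s\<in>set us - {u}. Rep_center (?z s) * s) = (\<Sum>s\<in>set us - {u}. Rep_center (z s) * s)"
        by (intro sum.cong) auto
      also have "Rep_center (?z u) * u + \<dots> = k * u + (Rep_center (z u) * u + \<dots>)"
        by (simp add: plus_center.rep_eq k distrib_right add.assoc)
      also have "Rep_center (z u) * u + (\<Sum>s\<in>set us - {u}. Rep_center (z s) * s) =
          (\<Sum>s\<in>set us. Rep_center (z s) * s)"
        using True by (intro sum.remove[symmetric]) auto
      finally have "a = (\<Sum>s\<in>set us. Rep_center (?z s) * s)"
        using a z by simp
      moreover have "set (u # us) = set us"
        using True by auto
      ultimately show ?thesis
        by metis
    next
      case False
      let ?z = "z(u := Abs_center k)"
      have "(\<Sum>s\<in>set us. Rep_center (z s) * s) = (\<Sum>s\<in>set us. Rep_center (?z s) * s)"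
        using False by (intro sum.cong) auto
      then have "a = (\<Sum>s\<in>set (u # us). Rep_center (?z s) * s)"
        using False k a z by simp
      then show ?thesis
        by blast
    qed
  qed (use ring.combine.simps[OF R] in \<open>auto intro!: exI[of _ "\<lambda>_. 0"] simp: zero_center.rep_eq\<close>)
  have "\<exists>z. a = (\<Sum>s\<in>set Us. Rep_center (z s) * s)" for a
  proof -
    have "set Us \<subseteq> carrier ?R"
      by simp
    then have "ring.Span ?R ring_center Us = {ring.combine ?R Ks Us |Ks. set Ks \<subseteq> ring_center}"
      by (rule ring.Span_eq_combine_set[OF R subfield_ring_center])
    moreover have "a \<in> ring.Span ?R ring_center Us"
      by (simp only: Us UNIV_I)
    ultimately obtain Ks where "a = ring.combine ?R Ks Us" "set Ks \<subseteq> ring_center"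
      by blast
    then show ?thesis
      by (rule span)
  qed
  from that[OF finite_set this] show thesis .
qed

lemma sum_fun_apply: "(\<Sum>i\<in>T. h i) j = (\<Sum>i\<in>T. h i j)"
  by (induction T rule: infinite_finite_induct) simp_all

lemma fin_dim_finite_support:
  assumes fd: "finite_dimensional_over_center TYPE('a::division_ring)" and D: "finite (D :: 'i set)"
  shows "cscale.fin_dim {x :: 'i \<Rightarrow> 'a. \<forall>i. i \<notin> D \<longrightarrow> x i = 0}"
proof -
  obtain S :: "'a set" where S: "finite S" "\<And>a. \<exists>z. a = (\<Sum>s\<in>S. Rep_center (z s) * s)"
    using finite_center_span[OF fd] by blast
  let ?e = "\<lambda>(i, s). (\<lambda>j. if j = i then s else 0)"
  have "x \<in> cscale.span (?e ` (D \<times> S))" if x: "\<forall>i. i \<notin> D \<longrightarrow> x i = 0" for x :: "'i \<Rightarrow> 'a"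
  proof -
    obtain z where z: "\<And>a. a = (\<Sum>s\<in>S. Rep_center (z a s) * s)"
      using S(2) by metis
    have "x = (\<Sum>i\<in>D. \<Sum>s\<in>S. cscale (z (x i) s) (?e (i, s)))"
    proof
      fix j
      have "(\<Sum>i\<in>D. \<Sum>s\<in>S. cscale (z (x i) s) (?e (i, s))) j =
          (\<Sum>i\<in>D. if j = i then (\<Sum>s\<in>S. Rep_center (z (x i) s) * s) else 0)"
        unfolding sum_fun_apply by (intro sum.cong) auto
      also have "\<dots> = (\<Sum>i\<in>D. if j = i then x i else 0)"
        using z by (intro sum.cong) auto
      also have "\<dots> = x j"
        using D x by simp
      finally show "x j = (\<Sum>i\<in>D. \<Sum>s\<in>S. cscale (z (x i) s) (?e (i, s))) j"
        by simp
    qed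
    also have "\<dots> \<in> cscale.span (?e ` (D \<times> S))"
      by (intro cscale.span_sum cscale.span_scale cscale.span_base) blast
    finally show ?thesis .
  qed
  moreover have "finite (?e ` (D \<times> S))"
    using D S(1) by simp
  ultimately show ?thesis
    unfolding cscale.fin_dim_def by blast
qed

subsection \<open>Matrices over a skew field\<close>

definition skew_field_auto :: "('a::division_ring \<Rightarrow> 'a) \<Rightarrow> bool" where
  "skew_field_auto f \<longleftrightarrow> bij f \<and> (\<forall>a b. f (a + b) = f a + f b) \<and> (\<forall>a b. f (a * b) = f a * f b)"

lemma skew_field_autoD:
  assumes "skew_field_auto f"
  shows "bij f" "f (a + b) = f a + f b" "f (a * b) = f a * f b" "f 0 = 0" "f 1 = 1" "f (- a) = - f a"
proof -
  show *: "bij f" "f (a + b) = f a + f b" "f (a * b) = f a * f b" for a b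
    using assms by (auto simp: skew_field_auto_def)
  show 0: "f 0 = 0"
    using *(2)[of 0 0] by (simp only: add_0_right add_cancel_right_right)
  have "f 1 \<noteq> f 0"
    using *(1) by (metis bij_is_inj inj_eq zero_neq_one)
  moreover have "f 1 * f 1 = f 1"
    using *(3)[of 1 1] by simp
  ultimately show "f 1 = 1"
    using 0 by simp
  show "f (- a) = - f a"
    using *(2)[of "- a" a] 0 by (simp add: eq_neg_iff_add_eq_0)
qed

lemma skew_field_auto_inv:
  assumes "skew_field_auto f"
  shows "skew_field_auto (inv_into UNIV f)"
proof -
  note f = skew_field_autoD[OF assms]
  have inj: "inj f" and surj: "\<And>y. f (inv_into UNIV f y) = y"
    using f(1) by (auto simp: bij_is_inj bij_is_surj surj_f_inv_f)
  have "inv_into UNIV f (a + b) = inv_into UNIV f a + inv_into UNIV f b" "inv_into UNIV f (a * b) = inv_into UNIV f a * inv_into UNIV f b" for a b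
    using injD[OF inj] f(2,3) surj by metis+
  then show ?thesis
    unfolding skew_field_auto_def using bij_imp_bij_inv[OF f(1)] by blast
qed

lemma map_mat_auto_mult:
  assumes f: "skew_field_auto f" and "A \<in> carrier_mat nr n" "B \<in> carrier_mat n nc"
  shows "map_mat f (A * B) = map_mat f A * map_mat f B"
proof -
  have sum: "f (sum h S) = (\<Sum>x\<in>S. f (h x))" for h :: "nat \<Rightarrow> _" and S
    by (induction S rule: infinite_finite_induct) (auto simp: skew_field_autoD[OF f])
  show ?thesis
    by (rule eq_matI) (use assms(2,3) in \<open>auto simp: scalar_prod_def sum skew_field_autoD[OF f]\<close>)
qed

lemma map_mat_auto_one: "skew_field_auto f \<Longrightarrow> map_mat f (1\<^sub>m n) = 1\<^sub>m n"
  by (rule eq_matI) (auto simp: skew_field_autoD)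

lemma append_rows_mult:
  fixes A :: "'a::semiring_0 mat"
  assumes "A \<in> carrier_mat nr1 n" "B \<in> carrier_mat nr2 n" "C \<in> carrier_mat n nc"
  shows "(A @\<^sub>r B) * C = (A * C) @\<^sub>r (B * C)"
proof (rule eq_matI)
  fix i j assume "i < dim_row ((A * C) @\<^sub>r (B * C))" "j < dim_col ((A * C) @\<^sub>r (B * C))"
  then have i: "i < nr1 + nr2" and j: "j < nc"
    using assms by (auto simp: append_rows_def)
  have "row (A @\<^sub>r B) i = (if i < nr1 then row A i else row B (i - nr1))"
    using assms i by (intro eq_vecI) (auto simp: append_rows_def)
  then show "((A @\<^sub>r B) * C) $$ (i, j) = ((A * C) @\<^sub>r (B * C)) $$ (i, j)"
    using assms i j by (auto simp: append_rows_def)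
qed (use assms in \<open>auto simp: append_rows_def\<close>)

lemma four_block_mult_append_rows:
  fixes A :: "'a::semiring_0 mat"
  assumes c: "A \<in> carrier_mat nr1 n1" "B \<in> carrier_mat nr1 n2" "C \<in> carrier_mat nr2 n1" "D \<in> carrier_mat nr2 n2"
    and X: "X \<in> carrier_mat n1 nc" "Y \<in> carrier_mat n2 nc"
  shows "four_block_mat A B C D * (X @\<^sub>r Y) = (A * X + B * Y) @\<^sub>r (C * X + D * Y)"
  unfolding append_rows_def
  by (subst mult_four_block_mat[OF c X(1) _ X(2)]) (use assms in auto)

lemma append_rows_eq_iff:
  assumes "A \<in> carrier_mat nr1 nc" "A' \<in> carrier_mat nr1 nc" "B \<in> carrier_mat nr2 nc" "B' \<in> carrier_mat nr2 nc"
  shows "A @\<^sub>r B = A' @\<^sub>r B' \<longleftrightarrow> A = A' \<and> B = B'"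
proof
  assume eq: "A @\<^sub>r B = A' @\<^sub>r B'"
  have "A $$ (i, j) = A' $$ (i, j)" if "i < nr1" "j < nc" for i j
    using arg_cong[OF eq, of "\<lambda>M. M $$ (i, j)"] assms that by (simp add: append_rows_def)
  moreover have "B $$ (i, j) = B' $$ (i, j)" if "i < nr2" "j < nc" for i j
    using arg_cong[OF eq, of "\<lambda>M. M $$ (i + nr1, j)"] assms that by (simp add: append_rows_def)
  ultimately show "A = A' \<and> B = B'"
    using assms by (intro conjI eq_matI) auto
qed simp

lemma map_mat_append_rows: 
  assumes "A \<in> carrier_mat nr1 nc" "B \<in> carrier_mat nr2 nc"
  shows "map_mat f (A @\<^sub>r B) = map_mat f A @\<^sub>r map_mat f B"
  by (rule eq_matI) (use assms in \<open>auto simp: append_rows_def\<close>)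

text \<open>The inverse is carried along as data, so that the definite description in
  \<open>inverse_mat\<close> stays out of the computations.\<close>

definition inverse_pair :: "nat \<Rightarrow> 'a::semiring_1 mat \<Rightarrow> 'a mat \<Rightarrow> bool" where
  "inverse_pair l P P' \<longleftrightarrow> P \<in> carrier_mat l l \<and> P' \<in> carrier_mat l l \<and> P * P' = 1\<^sub>m l \<and> P' * P = 1\<^sub>m l"

lemma inverse_pairD:
  assumes "inverse_pair l P P'"
  shows "P \<in> carrier_mat l l" "P' \<in> carrier_mat l l" "P * P' = 1\<^sub>m l" "P' * P = 1\<^sub>m l"
  using assms by (auto simp: inverse_pair_def)

lemma intertwine_inverse:
  fixes D E U U' V V' :: "'a::semiring_1 mat"
  assumes c: "E \<in> carrier_mat a b" "D \<in> carrier_mat a b" "U \<in> carrier_mat a a" "U' \<in> carrier_mat a a"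
      "V \<in> carrier_mat b b" "V' \<in> carrier_mat b b"
    and inv: "U' * U = 1\<^sub>m a" "V * V' = 1\<^sub>m b" and eq: "E * V = U * D"
  shows "D * V' = U' * E"
proof -
  have "U' * E = U' * (E * (V * V'))"
    using c inv by simp
  also have "\<dots> = U' * (E * V * V')"
    by (simp add: assoc_mult_mat[OF c(1,5,6)])
  also have "\<dots> = U' * (U * (D * V'))"
    unfolding eq by (simp add: assoc_mult_mat[OF c(3,2,6)])
  also have "\<dots> = U' * U * (D * V')"
    by (rule assoc_mult_mat[OF c(4,3) mult_carrier_mat[OF c(2,6)], symmetric])
  also have "\<dots> = D * V'"
    unfolding inv by (rule left_mult_one_mat[OF mult_carrier_mat[OF c(2,6)]])
  finally show ?thesis
    by (rule sym)
qed

lemma uminus_diff_eqI: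
  fixes S T C :: "'a::ab_group_add mat"
  assumes "S \<in> carrier_mat nr nc" "T \<in> carrier_mat nr nc" "C \<in> carrier_mat nr nc" and eq: "S + C = T"
  shows "- S - - T = C"
  unfolding eq[symmetric] by (rule eq_matI) (use assms(1,3) in auto)

abbreviation center_smult :: "'a::division_ring center \<Rightarrow> 'a mat \<Rightarrow> 'a mat" where
  "center_smult z \<equiv> map_mat ((*) (Rep_center z))"

lemma mult_center_smult:
  fixes A :: "'a::division_ring mat"
  assumes "A \<in> carrier_mat nr n" "B \<in> carrier_mat n nc"
  shows "A * center_smult z B = center_smult z (A * B)" "center_smult z A * B = center_smult z (A * B)"
proof -
  have "a * (Rep_center z * b) = Rep_center z * (a * b)" for a b :: 'a
    by (metis center_commute mult.assoc)
  then show "A * center_smult z B = center_smult z (A * B)" "center_smult z A * B = center_smult z (A * B)"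
    by (auto intro!: eq_matI sum.cong simp: scalar_prod_def sum_distrib_left mult.assoc assms[THEN carrier_matD(1)]
        assms[THEN carrier_matD(2)])
qed

subsection \<open>Systems twisted by one automorphism\<close>

type_synonym ('j, 'i, 'a) coords = "('j + 'i) \<times> nat \<times> nat \<Rightarrow> 'a"

text \<open>The flags \<open>\<alpha>\<close> and \<open>\<beta>\<close> are exponents of \<tau>.
  The index types are left arbitrary because unknowns will be indexed by pairs with a superscript,
  and equations together with their conjugates.\<close>

locale twisted_matrix_system =
  fixes \<tau> :: "'a::division_ring \<Rightarrow> 'a" and J :: "'j set" and I :: "'i set"
    and m n :: "'j \<Rightarrow> nat" and k r :: "'i \<Rightarrow> nat" and f g :: "'i \<Rightarrow> 'j" and \<alpha> \<beta> :: "'i \<Rightarrow> bool"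
    and A B M N :: "'i \<Rightarrow> 'a mat"
  assumes auto_\<tau>: "skew_field_auto \<tau>" and finite_J: "finite J" and finite_I: "finite I"
    and f_J: "i \<in> I \<Longrightarrow> f i \<in> J" and g_J: "i \<in> I \<Longrightarrow> g i \<in> J"
    and A_carrier: "i \<in> I \<Longrightarrow> A i \<in> carrier_mat (k i) (m (f i))"
    and M_carrier: "i \<in> I \<Longrightarrow> M i \<in> carrier_mat (n (f i)) (r i)"
    and N_carrier: "i \<in> I \<Longrightarrow> N i \<in> carrier_mat (k i) (m (g i))"
    and B_carrier: "i \<in> I \<Longrightarrow> B i \<in> carrier_mat (n (g i)) (r i)"
begin

text \<open>The two matrices are the values of one unknown at consecutive times: an untwisted
  occurrence reads the first, a twisted one \<tau> of the second. If they coincide, this is the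
  actual power of \<tau> in the equation.\<close>

definition tw :: "bool \<Rightarrow> 'a mat \<Rightarrow> 'a mat \<Rightarrow> 'a mat" where
  "tw a U V = (if a then map_mat \<tau> V else U)"

lemma tw_carrier: "U \<in> carrier_mat nr nc \<Longrightarrow> V \<in> carrier_mat nr nc \<Longrightarrow> tw a U V \<in> carrier_mat nr nc"
  by (simp add: tw_def)

lemma tw_mult:
  assumes "U \<in> carrier_mat nr l" "V \<in> carrier_mat nr l" "U' \<in> carrier_mat l nc" "V' \<in> carrier_mat l nc"
  shows "tw a (U * U') (V * V') = tw a U V * tw a U' V'"
  using map_mat_auto_mult[OF auto_\<tau>] assms by (simp add: tw_def)

lemma tw_add:
  assumes "U \<in> carrier_mat nr nc" "V \<in> carrier_mat nr nc" "U' \<in> carrier_mat nr nc" "V' \<in> carrier_mat nr nc"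
  shows "tw a (U + U') (V + V') = tw a U V + tw a U' V'"
  using assms by (auto intro!: eq_matI simp: tw_def skew_field_autoD[OF auto_\<tau>])

lemma tw_append_rows:
  assumes "U \<in> carrier_mat nr1 nc" "V \<in> carrier_mat nr1 nc" "U' \<in> carrier_mat nr2 nc" "V' \<in> carrier_mat nr2 nc"
  shows "tw a (U @\<^sub>r U') (V @\<^sub>r V') = tw a U V @\<^sub>r tw a U' V'"
  using assms by (auto simp: tw_def map_mat_append_rows)

lemma tw_zero: "tw a (0\<^sub>m nr nc) (0\<^sub>m nr nc) = 0\<^sub>m nr nc"
  by (rule eq_matI) (auto simp: tw_def skew_field_autoD[OF auto_\<tau>])

lemma tw_one: "tw a (1\<^sub>m l) (1\<^sub>m l) = 1\<^sub>m l"
  by (simp add: tw_def map_mat_auto_one[OF auto_\<tau>])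

text \<open>Matrices of different sizes share one function space: \<open>Inl j\<close> addresses the
  component of a morphism at the unknown \<open>j\<close>, \<open>Inr i\<close> the one at the
  equation \<open>i\<close>. Forcing entries outside this finite set to 0 gives a space of finite
  dimension over the center.\<close>

definition ix :: "(('j + 'i) \<times> nat \<times> nat) set" where
  "ix = (\<Union>j\<in>J. {Inl j} \<times> {..<m j + n j} \<times> {..<n j}) \<union>
    (\<Union>i\<in>I. {Inr i} \<times> {..<m (f i) + r i} \<times> {..<r i})"

definition X :: "('j, 'i, 'a) coords set" where
  "X = {x. \<forall>p. p \<notin> ix \<longrightarrow> x p = 0}"

definition Gt :: "('j, 'i, 'a) coords \<Rightarrow> 'j \<Rightarrow> 'a mat" where
  "Gt x j = mat (m j) (n j) (\<lambda>(a, b). x (Inl j, a, b))"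

definition Gb :: "('j, 'i, 'a) coords \<Rightarrow> 'j \<Rightarrow> 'a mat" where
  "Gb x j = mat (n j) (n j) (\<lambda>(a, b). x (Inl j, m j + a, b))"

definition Ht :: "('j, 'i, 'a) coords \<Rightarrow> 'i \<Rightarrow> 'a mat" where
  "Ht x i = mat (m (f i)) (r i) (\<lambda>(a, b). x (Inr i, a, b))"

definition Hb :: "('j, 'i, 'a) coords \<Rightarrow> 'i \<Rightarrow> 'a mat" where
  "Hb x i = mat (r i) (r i) (\<lambda>(a, b). x (Inr i, m (f i) + a, b))"

definition G :: "('j, 'i, 'a) coords \<Rightarrow> 'j \<Rightarrow> 'a mat" where
  "G x j = Gt x j @\<^sub>r Gb x j"

definition H :: "('j, 'i, 'a) coords \<Rightarrow> 'i \<Rightarrow> 'a mat" where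
  "H x i = Ht x i @\<^sub>r Hb x i"

definition enc :: "('j \<Rightarrow> 'a mat) \<Rightarrow> ('i \<Rightarrow> 'a mat) \<Rightarrow> ('j, 'i, 'a) coords" where
  "enc Gs Hs = (\<lambda>(l, a, b). if (l, a, b) \<in> ix
     then (case l of Inl j \<Rightarrow> Gs j $$ (a, b) | Inr i \<Rightarrow> Hs i $$ (a, b)) else 0)"

lemma block_carriers [simp]:
  "Gt x j \<in> carrier_mat (m j) (n j)" "Gb x j \<in> carrier_mat (n j) (n j)"
  "Ht x i \<in> carrier_mat (m (f i)) (r i)" "Hb x i \<in> carrier_mat (r i) (r i)"
  "G x j \<in> carrier_mat (m j + n j) (n j)" "H x i \<in> carrier_mat (m (f i) + r i) (r i)"
  unfolding G_def H_def by (auto simp: Gt_def Gb_def Ht_def Hb_def)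

lemma G_index: "a < m j + n j \<Longrightarrow> b < n j \<Longrightarrow> G x j $$ (a, b) = x (Inl j, a, b)"
  by (auto simp: G_def append_rows_def Gt_def Gb_def)

lemma H_index: "a < m (f i) + r i \<Longrightarrow> b < r i \<Longrightarrow> H x i $$ (a, b) = x (Inr i, a, b)"
  by (auto simp: H_def append_rows_def Ht_def Hb_def)

lemma ix_iff:
  "(Inl j, a, b) \<in> ix \<longleftrightarrow> j \<in> J \<and> a < m j + n j \<and> b < n j"
  "(Inr i, a, b) \<in> ix \<longleftrightarrow> i \<in> I \<and> a < m (f i) + r i \<and> b < r i"
  by (auto simp: ix_def)

lemma finite_ix: "finite ix"
  unfolding ix_def using finite_I finite_J by auto

lemma enc_X: "enc Gs Hs \<in> X"
  by (auto simp: X_def enc_def)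

lemma G_enc: "j \<in> J \<Longrightarrow> Gs j \<in> carrier_mat (m j + n j) (n j) \<Longrightarrow> G (enc Gs Hs) j = Gs j"
  using block_carriers(5)[of "enc Gs Hs" j]
  by (intro eq_matI) (auto simp: G_index enc_def ix_iff simp del: block_carriers)

lemma H_enc: "i \<in> I \<Longrightarrow> Hs i \<in> carrier_mat (m (f i) + r i) (r i) \<Longrightarrow> H (enc Gs Hs) i = Hs i"
  using block_carriers(6)[of "enc Gs Hs" i]
  by (intro eq_matI) (auto simp: H_index enc_def ix_iff simp del: block_carriers)

lemma X_eqI:
  assumes "x \<in> X" "y \<in> X" and G: "\<And>j. j \<in> J \<Longrightarrow> G x j = G y j" and H: "\<And>i. i \<in> I \<Longrightarrow> H x i = H y i"
  shows "x = y"
proof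
  fix p :: "('j + 'i) \<times> nat \<times> nat"
  obtain l a b where p: "p = (l, a, b)"
    by (metis surj_pair)
  show "x p = y p"
  proof (cases "p \<in> ix")
    case True
    then show ?thesis
      using G_index[of a _ b] H_index[of a _ b] G H by (cases l) (metis p ix_iff)+
  next
    case False
    then have "x p = 0" "y p = 0"
      using assms(1,2) unfolding X_def mem_Collect_eq by blast+
    then show ?thesis
      by simp
  qed
qed

lemma blocks_add:
  "G (x + y) j = G x j + G y j" "H (x + y) i = H x i + H y i"
  by (auto intro!: eq_matI simp: Gt_def Gb_def Ht_def Hb_def G_def H_def append_rows_def)

lemma blocks_cscale:
  "G (cscale z x) j = center_smult z (G x j)" "H (cscale z x) i = center_smult z (H x i)"
  by (auto intro!: eq_matI simp: Gt_def Gb_def Ht_def Hb_def G_def H_def append_rows_def)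

lemma X_add: "x \<in> X \<Longrightarrow> y \<in> X \<Longrightarrow> x + y \<in> X"
  and X_cscale: "x \<in> X \<Longrightarrow> cscale z x \<in> X"
  by (auto simp: X_def)

abbreviation corner :: "('i \<Rightarrow> 'a mat) \<Rightarrow> 'i \<Rightarrow> 'a mat" where
  "corner C i \<equiv> four_block_mat (A i) (C i) (0\<^sub>m (n (g i)) (m (f i))) (B i)"

abbreviation left :: "'i \<Rightarrow> 'a mat" where
  "left i \<equiv> diag_block_mat2 (1\<^sub>m (m (f i))) (M i)"

abbreviation right :: "'i \<Rightarrow> 'a mat" where
  "right i \<equiv> diag_block_mat2 (N i) (1\<^sub>m (n (g i)))"

lemma left_right_corner_carrier:
  assumes "i \<in> I"
  shows "left i \<in> carrier_mat (m (f i) + n (f i)) (m (f i) + r i)"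
    "right i \<in> carrier_mat (k i + n (g i)) (m (g i) + n (g i))"
    "C i \<in> carrier_mat (k i) (r i) \<Longrightarrow> corner C i \<in> carrier_mat (k i + n (g i)) (m (f i) + r i)"
  using A_carrier[OF assms] M_carrier[OF assms] N_carrier[OF assms] B_carrier[OF assms] by auto

text \<open>A morphism from W also has a component at the common target of \<open>corner C i\<close>
  and \<open>right i\<close>. The W-part of \<open>right i\<close> is an identity block, so that
  component must be \<open>right i * tw ...\<close>; it is substituted, and only \<open>G\<close>
  and \<open>H\<close> are recorded.\<close>

definition rel :: "('i \<Rightarrow> 'a mat) \<Rightarrow>
    (('j, 'i, 'a) coords \<times> ('j, 'i, 'a) coords) set" where
  "rel C = {(x, y). x \<in> X \<and> y \<in> X \<and> (\<forall>i\<in>I.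
     left i * H x i = tw (\<alpha> i) (G x (f i)) (G y (f i)) * M i \<and>
     corner C i * H x i =
       right i * (tw (\<beta> i) (G x (g i)) (G y (g i)) * B i))}"

text \<open>The lower block rows involve \<open>Gb\<close> and \<open>Hb\<close> alone and express a
  morphism from W to W. The matrix \<open>C\<close> occurs only multiplied by \<open>Hb\<close>, so
  it disappears when the lower blocks vanish.\<close>

lemma rel_iff:
  assumes C: "\<And>i. i \<in> I \<Longrightarrow> C i \<in> carrier_mat (k i) (r i)"
  shows "(x, y) \<in> rel C \<longleftrightarrow> x \<in> X \<and> y \<in> X \<and> (\<forall>i\<in>I.
     Ht x i = tw (\<alpha> i) (Gt x (f i)) (Gt y (f i)) * M i \<and>
     M i * Hb x i = tw (\<alpha> i) (Gb x (f i)) (Gb y (f i)) * M i \<and>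
     A i * Ht x i + C i * Hb x i = N i * (tw (\<beta> i) (Gt x (g i)) (Gt y (g i)) * B i) \<and>
     B i * Hb x i = tw (\<beta> i) (Gb x (g i)) (Gb y (g i)) * B i)"
proof -
  have "(left i * H x i = tw (\<alpha> i) (G x (f i)) (G y (f i)) * M i \<longleftrightarrow>
      Ht x i = tw (\<alpha> i) (Gt x (f i)) (Gt y (f i)) * M i \<and>
      M i * Hb x i = tw (\<alpha> i) (Gb x (f i)) (Gb y (f i)) * M i) \<and>
    (corner C i * H x i =
       right i * (tw (\<beta> i) (G x (g i)) (G y (g i)) * B i) \<longleftrightarrow>
     A i * Ht x i + C i * Hb x i = N i * (tw (\<beta> i) (Gt x (g i)) (Gt y (g i)) * B i) \<and>
     B i * Hb x i = tw (\<beta> i) (Gb x (g i)) (Gb y (g i)) * B i)" if i: "i \<in> I" for i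
  proof -
    note c = A_carrier[OF i] M_carrier[OF i] N_carrier[OF i] B_carrier[OF i] C[OF i]
    note d = c[THEN carrier_matD(1)] c[THEN carrier_matD(2)]
    have tG: "tw a (G x j) (G y j) = tw a (Gt x j) (Gt y j) @\<^sub>r tw a (Gb x j) (Gb y j)" for a j
      unfolding G_def by (rule tw_append_rows) (rule block_carriers)+
    have tc: "tw a (Gt x j) (Gt y j) \<in> carrier_mat (m j) (n j)" "tw a (Gb x j) (Gb y j) \<in> carrier_mat (n j) (n j)" for a j
      by (simp_all add: tw_carrier)
    note ht = block_carriers(3)[of x i] and hb = block_carriers(4)[of x i]
    have 1: "left i * H x i = Ht x i @\<^sub>r (M i * Hb x i)"
      unfolding H_def
      by (subst four_block_mult_append_rows[OF _ _ _ _ ht hb])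
        (use c d in \<open>auto simp: left_mult_one_mat[OF ht] left_mult_zero_mat[OF ht] left_mult_zero_mat[OF hb]
          right_add_zero_mat[OF ht] left_add_zero_mat[OF mult_carrier_mat[OF c(2) hb]]\<close>)
    have 2: "tw (\<alpha> i) (G x (f i)) (G y (f i)) * M i =
        (tw (\<alpha> i) (Gt x (f i)) (Gt y (f i)) * M i) @\<^sub>r (tw (\<alpha> i) (Gb x (f i)) (Gb y (f i)) * M i)"
      unfolding tG by (rule append_rows_mult[OF tc c(2)])
    have 3: "corner C i * H x i =
        (A i * Ht x i + C i * Hb x i) @\<^sub>r (B i * Hb x i)"
      unfolding H_def
      by (subst four_block_mult_append_rows[OF c(1) c(5) _ c(4) ht hb])
        (simp_all add: left_mult_zero_mat[OF ht] left_add_zero_mat[OF mult_carrier_mat[OF c(4) hb]])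
    have 4: "tw (\<beta> i) (G x (g i)) (G y (g i)) * B i =
        (tw (\<beta> i) (Gt x (g i)) (Gt y (g i)) * B i) @\<^sub>r (tw (\<beta> i) (Gb x (g i)) (Gb y (g i)) * B i)"
      unfolding tG by (rule append_rows_mult[OF tc c(4)])
    note t4 = mult_carrier_mat[OF tc(1)[of "\<beta> i" "g i"] c(4)] mult_carrier_mat[OF tc(2)[of "\<beta> i" "g i"] c(4)]
    have 5: "right i * (tw (\<beta> i) (G x (g i)) (G y (g i)) * B i) =
        (N i * (tw (\<beta> i) (Gt x (g i)) (Gt y (g i)) * B i)) @\<^sub>r (tw (\<beta> i) (Gb x (g i)) (Gb y (g i)) * B i)"
      unfolding 4
      by (subst four_block_mult_append_rows[OF _ _ _ _ t4])
        (use c d in \<open>auto simp: left_mult_one_mat[OF t4(2)] left_mult_zero_mat[OF t4(1)] left_mult_zero_mat[OF t4(2)]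
          right_add_zero_mat[OF mult_carrier_mat[OF c(3) t4(1)]] left_add_zero_mat[OF t4(2)]\<close>)
    show ?thesis
      unfolding 1 2 3 5
        append_rows_eq_iff[OF ht mult_carrier_mat[OF tc(1) c(2)] mult_carrier_mat[OF c(2) hb] mult_carrier_mat[OF tc(2) c(2)]]
        append_rows_eq_iff[OF add_carrier_mat[OF mult_carrier_mat[OF c(5) hb]] mult_carrier_mat[OF c(3) t4(1)]
          mult_carrier_mat[OF c(4) hb] t4(2)]
      by blast
  qed
  then show ?thesis
    unfolding rel_def by simp
qed

definition act :: "('j \<Rightarrow> 'a mat) \<Rightarrow> ('i \<Rightarrow> 'a mat) \<Rightarrow> ('j, 'i, 'a) coords \<Rightarrow> ('j, 'i, 'a) coords" where
  "act P Q x = enc (\<lambda>j. P j * G x j) (\<lambda>i. Q i * H x i)"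

context
  fixes P :: "'j \<Rightarrow> 'a mat" and Q :: "'i \<Rightarrow> 'a mat"
  assumes P: "\<And>j. j \<in> J \<Longrightarrow> P j \<in> carrier_mat (m j + n j) (m j + n j)"
    and Q: "\<And>i. i \<in> I \<Longrightarrow> Q i \<in> carrier_mat (m (f i) + r i) (m (f i) + r i)"
begin

lemma G_act:
  assumes "j \<in> J"
  shows "G (act P Q x) j = P j * G x j"
  unfolding act_def by (rule G_enc[where Gs = "\<lambda>j. P j * G x j", OF assms mult_carrier_mat[OF P[OF assms] block_carriers(5)]])

lemma H_act:
  assumes "i \<in> I"
  shows "H (act P Q x) i = Q i * H x i"
  unfolding act_def by (rule H_enc[where Hs = "\<lambda>i. Q i * H x i", OF assms mult_carrier_mat[OF Q[OF assms] block_carriers(6)]])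

lemma act_X: "act P Q x \<in> X"
  unfolding act_def by (rule enc_X)

lemma act_add: "act P Q (x + y) = act P Q x + act P Q y"
proof (rule X_eqI)
  show "act P Q x + act P Q y \<in> X"
    by (intro X_add act_X)
  fix j assume "j \<in> J"
  then show "G (act P Q (x + y)) j = G (act P Q x + act P Q y) j"
    by (simp add: G_act blocks_add mult_add_distrib_mat[OF P block_carriers(5) block_carriers(5)])
next
  fix i assume "i \<in> I"
  then show "H (act P Q (x + y)) i = H (act P Q x + act P Q y) i"
    by (simp add: H_act blocks_add mult_add_distrib_mat[OF Q block_carriers(6) block_carriers(6)])
qed (rule act_X)

lemma act_cscale: "act P Q (cscale z x) = cscale z (act P Q x)"
proof (rule X_eqI)
  show "cscale z (act P Q x) \<in> X"
    by (intro X_cscale act_X)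
  fix j assume "j \<in> J"
  then show "G (act P Q (cscale z x)) j = G (cscale z (act P Q x)) j"
    by (simp add: G_act blocks_cscale mult_center_smult(1)[OF P block_carriers(5)])
next
  fix i assume "i \<in> I"
  then show "H (act P Q (cscale z x)) i = H (cscale z (act P Q x)) i"
    by (simp add: H_act blocks_cscale mult_center_smult(1)[OF Q block_carriers(6)])
qed (rule act_X)

lemma act_act:
  assumes P': "\<And>j. j \<in> J \<Longrightarrow> P' j \<in> carrier_mat (m j + n j) (m j + n j)" "\<And>j. j \<in> J \<Longrightarrow> P' j * P j = 1\<^sub>m (m j + n j)"
    and Q': "\<And>i. i \<in> I \<Longrightarrow> Q' i \<in> carrier_mat (m (f i) + r i) (m (f i) + r i)"
      "\<And>i. i \<in> I \<Longrightarrow> Q' i * Q i = 1\<^sub>m (m (f i) + r i)"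
    and x: "x \<in> X"
  shows "enc (\<lambda>j. P' j * G (act P Q x) j) (\<lambda>i. Q' i * H (act P Q x) i) = x"
proof (rule X_eqI)
  fix j assume j: "j \<in> J"
  have "P' j * (P j * G x j) = G x j"
    by (simp add: assoc_mult_mat[OF P'(1)[OF j] P[OF j] block_carriers(5), symmetric] P'(2)[OF j]
        left_mult_one_mat[OF block_carriers(5)])
  then show "G (enc (\<lambda>j. P' j * G (act P Q x) j) (\<lambda>i. Q' i * H (act P Q x) i)) j = G x j"
    using j by (subst G_enc) (auto simp: G_act)
next
  fix i assume i: "i \<in> I"
  have "Q' i * (Q i * H x i) = H x i"
    by (simp add: assoc_mult_mat[OF Q'(1)[OF i] Q[OF i] block_carriers(6), symmetric] Q'(2)[OF i]
        left_mult_one_mat[OF block_carriers(6)])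
  then show "H (enc (\<lambda>j. P' j * G (act P Q x) j) (\<lambda>i. Q' i * H (act P Q x) i)) i = H x i"
    using i by (subst H_enc) (auto simp: H_act)
qed (use x enc_X in auto)

text \<open>
  A triple \<open>(P, Q, R)\<close> is a morphism between the representations with corner blocks \<open>C\<close> and \<open>C'\<close>; it acts by
  composition on the morphisms encoded by \<^term>\<open>rel C\<close>.
\<close>

lemma act_rel:
  assumes R: "\<And>i. i \<in> I \<Longrightarrow> R i \<in> carrier_mat (k i + n (g i)) (k i + n (g i))"
    and C: "\<And>i. i \<in> I \<Longrightarrow> C i \<in> carrier_mat (k i) (r i)" and C': "\<And>i. i \<in> I \<Longrightarrow> C' i \<in> carrier_mat (k i) (r i)"
    and 1: "\<And>i. i \<in> I \<Longrightarrow> corner C' i * Q i = R i * corner C i"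
    and 2: "\<And>i. i \<in> I \<Longrightarrow> left i * Q i = tw (\<alpha> i) (P (f i)) (P (f i)) * left i"
    and 3: "\<And>i. i \<in> I \<Longrightarrow> right i * tw (\<beta> i) (P (g i)) (P (g i)) = R i * right i"
    and xy: "(x, y) \<in> rel C"
  shows "(act P Q x, act P Q y) \<in> rel C'"
proof -
  have "left i * H (act P Q x) i =
      tw (\<alpha> i) (G (act P Q x) (f i)) (G (act P Q y) (f i)) * M i \<and>
    corner C' i * H (act P Q x) i =
      right i * (tw (\<beta> i) (G (act P Q x) (g i)) (G (act P Q y) (g i)) * B i)"
    if i: "i \<in> I" for i
  proof -
    note c = A_carrier[OF i] M_carrier[OF i] N_carrier[OF i] B_carrier[OF i] C[OF i] C'[OF i]
    let ?tG = "\<lambda>a j. tw a (G x j) (G y j)" and ?tP = "\<lambda>a j. tw a (P j) (P j)"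
    note lr = left_right_corner_carrier[OF i]
    note d = lr(3)[of C, OF C[OF i]] lr(3)[of C', OF C'[OF i]] lr(1,2)
    have h: "H x i \<in> carrier_mat (m (f i) + r i) (r i)"
      by simp
    have t: "?tG a j \<in> carrier_mat (m j + n j) (n j)" "j \<in> J \<Longrightarrow> ?tP a j \<in> carrier_mat (m j + n j) (m j + n j)" for a j
      by (simp_all add: tw_carrier P)
    have tact: "tw a (G (act P Q x) j) (G (act P Q y) j) = ?tP a j * ?tG a j" if "j \<in> J" for a j
      unfolding G_act[OF that] by (rule tw_mult[OF P[OF that] P[OF that] block_carriers(5) block_carriers(5)])
    have r: "left i * H x i = ?tG (\<alpha> i) (f i) * M i" "corner C i * H x i = right i * (?tG (\<beta> i) (g i) * B i)"
      using xy i unfolding rel_def by auto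
    have "left i * H (act P Q x) i = left i * Q i * H x i"
      unfolding H_act[OF i] by (rule assoc_mult_mat[OF d(3) Q[OF i] h, symmetric])
    also have "\<dots> = ?tP (\<alpha> i) (f i) * (left i * H x i)"
      unfolding 2[OF i] by (rule assoc_mult_mat[OF t(2)[OF f_J[OF i]] d(3) h])
    also have "\<dots> = ?tP (\<alpha> i) (f i) * ?tG (\<alpha> i) (f i) * M i"
      unfolding r(1) by (rule assoc_mult_mat[OF t(2)[OF f_J[OF i]] t(1) c(2), symmetric])
    finally have E: "left i * H (act P Q x) i = tw (\<alpha> i) (G (act P Q x) (f i)) (G (act P Q y) (f i)) * M i"
      unfolding tact[OF f_J[OF i]] .
    have "corner C' i * H (act P Q x) i = corner C' i * Q i * H x i"
      unfolding H_act[OF i] by (rule assoc_mult_mat[OF d(2) Q[OF i] h, symmetric])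
    also have "\<dots> = R i * (corner C i * H x i)"
      unfolding 1[OF i] by (rule assoc_mult_mat[OF R[OF i] d(1) h])
    also have "\<dots> = R i * right i * (?tG (\<beta> i) (g i) * B i)"
      unfolding r(2) by (rule assoc_mult_mat[OF R[OF i] d(4) mult_carrier_mat[OF t(1) c(4)], symmetric])
    also have "\<dots> = right i * (?tP (\<beta> i) (g i) * (?tG (\<beta> i) (g i) * B i))"
      unfolding 3[OF i, symmetric]
      by (rule assoc_mult_mat[OF d(4) t(2)[OF g_J[OF i]] mult_carrier_mat[OF t(1) c(4)]])
    also have "?tP (\<beta> i) (g i) * (?tG (\<beta> i) (g i) * B i) = ?tP (\<beta> i) (g i) * ?tG (\<beta> i) (g i) * B i"
      by (rule assoc_mult_mat[OF t(2)[OF g_J[OF i]] t(1) c(4), symmetric])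
    finally have D: "corner C' i * H (act P Q x) i = right i * (tw (\<beta> i) (G (act P Q x) (g i)) (G (act P Q y) (g i)) * B i)"
      unfolding tact[OF g_J[OF i]] .
    show ?thesis
      by (rule conjI[OF E D])
  qed
  then show ?thesis
    unfolding rel_def using act_X by blast
qed

end

lemma rel_zero: "(\<And>i. i \<in> I \<Longrightarrow> C i \<in> carrier_mat (k i) (r i)) \<Longrightarrow> (0, 0) \<in> rel C"
proof -
  assume C: "\<And>i. i \<in> I \<Longrightarrow> C i \<in> carrier_mat (k i) (r i)"
  have z: "Gt 0 j = 0\<^sub>m (m j) (n j)" "Gb 0 j = 0\<^sub>m (n j) (n j)" "Ht 0 i = 0\<^sub>m (m (f i)) (r i)"
    "Hb 0 i = 0\<^sub>m (r i) (r i)" for i j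
    by (auto intro!: eq_matI simp: Gt_def Gb_def Ht_def Hb_def)
  have "(0 :: ('j, 'i, 'a) coords) \<in> X"
    by (simp add: X_def)
  moreover have "A i * 0\<^sub>m (m (f i)) (r i) + C i * 0\<^sub>m (r i) (r i) = N i * (0\<^sub>m (m (g i)) (n (g i)) * B i)"
    "B i * 0\<^sub>m (r i) (r i) = 0\<^sub>m (n (g i)) (n (g i)) * B i"
    "M i * 0\<^sub>m (r i) (r i) = 0\<^sub>m (n (f i)) (n (f i)) * M i"
    "0\<^sub>m (m (f i)) (r i) = 0\<^sub>m (m (f i)) (n (f i)) * M i" if "i \<in> I" for i
    using A_carrier[OF that] M_carrier[OF that] N_carrier[OF that] B_carrier[OF that] C[OF that]
    by (simp_all add: left_mult_zero_mat right_mult_zero_mat)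
  ultimately show ?thesis
    using C by (subst rel_iff) (simp_all add: z tw_zero)
qed

lemma rel_add:
  assumes C: "\<And>i. i \<in> I \<Longrightarrow> C i \<in> carrier_mat (k i) (r i)"
    and "(x, y) \<in> rel C" "(x', y') \<in> rel C"
  shows "(x + x', y + y') \<in> rel C"
proof -
  have "left i * (H x i + H x' i) = left i * H x i + left i * H x' i" (is ?a)
    "corner C i * (H x i + H x' i) = corner C i * H x i + corner C i * H x' i" (is ?b)
    "(tw a (G x (f i)) (G y (f i)) + tw a (G x' (f i)) (G y' (f i))) * M i =
      tw a (G x (f i)) (G y (f i)) * M i + tw a (G x' (f i)) (G y' (f i)) * M i" (is ?c)
    "right i * ((tw a (G x (g i)) (G y (g i)) + tw a (G x' (g i)) (G y' (g i))) * B i) =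
      right i * (tw a (G x (g i)) (G y (g i)) * B i) +
      right i * (tw a (G x' (g i)) (G y' (g i)) * B i)" (is ?d)
    if i: "i \<in> I" for i a
  proof -
    note c = left_right_corner_carrier(1,2)[OF i] left_right_corner_carrier(3)[of i C, OF i]
    have t: "tw a (G x j) (G y j) \<in> carrier_mat (m j + n j) (n j)" for a j x y
      by (simp add: tw_carrier)
    note tB = mult_carrier_mat[OF t B_carrier[OF i]]
    show ?a
      by (rule mult_add_distrib_mat[OF c(1) block_carriers(6) block_carriers(6)])
    show ?b
      by (rule mult_add_distrib_mat[OF c(3)[OF C[OF i]] block_carriers(6) block_carriers(6)])
    show ?c
      by (rule add_mult_distrib_mat[OF t t M_carrier[OF i]])
    show ?d
      unfolding add_mult_distrib_mat[OF t t B_carrier[OF i]] by (rule mult_add_distrib_mat[OF c(2) tB tB])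
  qed
  moreover have "tw a (G (x + x') j) (G (y + y') j) = tw a (G x j) (G y j) + tw a (G x' j) (G y' j)" for a j
    unfolding blocks_add by (rule tw_add) (rule block_carriers)+
  ultimately show ?thesis
    using assms(2,3) unfolding rel_def by (auto simp: X_add blocks_add)
qed

text \<open>A twisted occurrence reads \<tau> of the second value; to scale it by \<open>z\<close>,
  the second value has to be scaled by the preimage of \<open>z\<close> under \<tau>. For this
  reason the \<sigma> of the abstract relation will be the inverse of \<tau> on the center.\<close>

lemma rel_scale:
  assumes C: "\<And>i. i \<in> I \<Longrightarrow> C i \<in> carrier_mat (k i) (r i)"
    and xy: "(x, y) \<in> rel C" and z': "\<tau> (Rep_center z') = Rep_center z"
  shows "(cscale z x, cscale z' y) \<in> rel C"
proof -
  have tw: "tw a (center_smult z U) (center_smult z' V) = center_smult z (tw a U V)" for a U V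
    by (rule eq_matI) (auto simp: tw_def skew_field_autoD[OF auto_\<tau>] z')
  have t: "tw a (G x j) (G y j) \<in> carrier_mat (m j + n j) (n j)" for a j
    by (simp add: tw_carrier)
  have "left i * center_smult z (H x i) = center_smult z (left i * H x i)" (is ?a)
    "corner C i * center_smult z (H x i) = center_smult z (corner C i * H x i)" (is ?b)
    "center_smult z (tw a (G x (f i)) (G y (f i))) * M i = center_smult z (tw a (G x (f i)) (G y (f i)) * M i)" (is ?c)
    "right i * (center_smult z (tw a (G x (g i)) (G y (g i))) * B i) =
      center_smult z (right i * (tw a (G x (g i)) (G y (g i)) * B i))" (is ?d)
    if i: "i \<in> I" for i a
  proof -
    note d = left_right_corner_carrier(1,2)[OF i] left_right_corner_carrier(3)[of i C, OF i]
    show ?a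
      by (rule mult_center_smult(1)[OF d(1) block_carriers(6)])
    show ?b
      by (rule mult_center_smult(1)[OF d(3)[OF C[OF i]] block_carriers(6)])
    show ?c
      by (rule mult_center_smult(2)[OF t M_carrier[OF i]])
    show ?d
      unfolding mult_center_smult(2)[OF t B_carrier[OF i]]
      by (rule mult_center_smult(1)[OF d(2) mult_carrier_mat[OF t B_carrier[OF i]]])
  qed
  then show ?thesis
    using xy unfolding rel_def by (auto simp: X_cscale blocks_cscale tw)
qed

text \<open>Composition with the projection onto W, followed by the inclusion of W as the lower
  summand of the split extension.\<close>

definition proj :: "('j, 'i, 'a) coords \<Rightarrow> ('j, 'i, 'a) coords" where
  "proj x = (\<lambda>(l, a, b). if a < (case l of Inl j \<Rightarrow> m j | Inr i \<Rightarrow> m (f i)) then 0 else x (l, a, b))"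

lemma proj_add: "proj (x + y) = proj x + proj y"
  by (rule ext) (auto simp: proj_def)

lemma proj_cscale: "proj (cscale z x) = cscale z (proj x)"
  by (rule ext) (auto simp: proj_def)

lemma proj_proj: "proj (proj x) = proj x"
  by (rule ext) (auto simp: proj_def)

lemma proj_X: "x \<in> X \<Longrightarrow> proj x \<in> X"
  by (auto simp: proj_def X_def)

lemma blocks_proj:
  "Gt (proj x) j = 0\<^sub>m (m j) (n j)" "Gb (proj x) j = Gb x j"
  "Ht (proj x) i = 0\<^sub>m (m (f i)) (r i)" "Hb (proj x) i = Hb x i"
  by (auto intro!: eq_matI simp: Gt_def Gb_def Ht_def Hb_def proj_def)

lemma Hb_zero: "Hb 0 i = 0\<^sub>m (r i) (r i)"
  by (auto intro!: eq_matI simp: Hb_def)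

lemma rel_proj:
  assumes C: "\<And>i. i \<in> I \<Longrightarrow> C i \<in> carrier_mat (k i) (r i)" and C': "\<And>i. i \<in> I \<Longrightarrow> C' i = 0\<^sub>m (k i) (r i)"
    and xy: "(x, y) \<in> rel C"
  shows "(proj x, proj y) \<in> rel C'"
proof -
  have C'c: "C' i \<in> carrier_mat (k i) (r i)" if "i \<in> I" for i
    using C'[OF that] by simp
  have "A i * 0\<^sub>m (m (f i)) (r i) + C' i * Hb x i = N i * (0\<^sub>m (m (g i)) (n (g i)) * B i)"
    "0\<^sub>m (m (f i)) (r i) = 0\<^sub>m (m (f i)) (n (f i)) * M i" if i: "i \<in> I" for i
    using A_carrier[OF i] M_carrier[OF i] N_carrier[OF i] B_carrier[OF i]
    unfolding C'[OF i] by (simp_all add: left_mult_zero_mat[OF block_carriers(4)])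
  then show ?thesis
    using xy rel_iff[of C x y] rel_iff[of C' "proj x" "proj y"] C C'c
    by (simp add: blocks_proj tw_zero proj_X)
qed

lemma rel_kernel:
  assumes C: "\<And>i. i \<in> I \<Longrightarrow> C i \<in> carrier_mat (k i) (r i)" and C': "\<And>i. i \<in> I \<Longrightarrow> C' i \<in> carrier_mat (k i) (r i)"
    and x: "proj x = 0"
  shows "(x, y) \<in> rel C \<longleftrightarrow> (x, y) \<in> rel C'"
proof -
  have "Hb x i = 0\<^sub>m (r i) (r i)" for i
    using blocks_proj(4)[of x i] x Hb_zero by simp
  then have "C i * Hb x i = C' i * Hb x i" if "i \<in> I" for i
    using C[OF that] C'[OF that] by simp
  then show ?thesis
    using rel_iff[of C x y] rel_iff[of C' x y] C C' by simp
qed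

theorem twisted_roth:
  assumes fd: "finite_dimensional_over_center TYPE('a)"
    and C: "\<And>i. i \<in> I \<Longrightarrow> C i \<in> carrier_mat (k i) (r i)"
    and P: "\<And>j. j \<in> J \<Longrightarrow> inverse_pair (m j + n j) (P j) (P' j)"
    and Q: "\<And>i. i \<in> I \<Longrightarrow> inverse_pair (m (f i) + r i) (Q i) (Q' i)"
    and R: "\<And>i. i \<in> I \<Longrightarrow> inverse_pair (k i + n (g i)) (R i) (R' i)"
    and 1: "\<And>i. i \<in> I \<Longrightarrow> diag_block_mat2 (A i) (B i) * Q i =
      R i * corner C i"
    and 2: "\<And>i. i \<in> I \<Longrightarrow> left i * Q i = tw (\<alpha> i) (P (f i)) (P (f i)) * left i"
    and 3: "\<And>i. i \<in> I \<Longrightarrow> right i * tw (\<beta> i) (P (g i)) (P (g i)) = R i * right i"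
  shows "\<exists>Y. (\<forall>j. Y j \<in> carrier_mat (m j) (n j)) \<and>
    (\<forall>i\<in>I. A i * tw (\<alpha> i) (Y (f i)) (Y (f i)) * M i - N i * tw (\<beta> i) (Y (g i)) (Y (g i)) * B i = C i)"
proof -
  define Z :: "'i \<Rightarrow> 'a mat" where "Z i = 0\<^sub>m (k i) (r i)" for i
  have Zc: "Z i \<in> carrier_mat (k i) (r i)" for i
    by (simp add: Z_def)
  note Pc = inverse_pairD(1)[OF P] inverse_pairD(2)[OF P] and Qc = inverse_pairD(1)[OF Q] inverse_pairD(2)[OF Q]
    and Rc = inverse_pairD(1)[OF R] inverse_pairD(2)[OF R]
  have twP: "tw a (P j) (P j) * tw a (P' j) (P' j) = 1\<^sub>m (m j + n j)"
    "tw a (P' j) (P' j) * tw a (P j) (P j) = 1\<^sub>m (m j + n j)"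
    "tw a (P j) (P j) \<in> carrier_mat (m j + n j) (m j + n j)"
    "tw a (P' j) (P' j) \<in> carrier_mat (m j + n j) (m j + n j)" if j: "j \<in> J" for j a
  proof -
    show "tw a (P j) (P j) * tw a (P' j) (P' j) = 1\<^sub>m (m j + n j)"
      unfolding tw_mult[OF Pc(1,1)[OF j] Pc(2,2)[OF j], symmetric] using inverse_pairD[OF P[OF j]] by (simp add: tw_one)
    show "tw a (P' j) (P' j) * tw a (P j) (P j) = 1\<^sub>m (m j + n j)"
      unfolding tw_mult[OF Pc(2,2)[OF j] Pc(1,1)[OF j], symmetric] using inverse_pairD[OF P[OF j]] by (simp add: tw_one)
  qed (use Pc[OF j] in \<open>simp_all add: tw_carrier\<close>)
  have carr: "left i \<in> carrier_mat (m (f i) + n (f i)) (m (f i) + r i)"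
    "corner C i \<in> carrier_mat (k i + n (g i)) (m (f i) + r i)"
    "corner Z i \<in> carrier_mat (k i + n (g i)) (m (f i) + r i)"
    "right i \<in> carrier_mat (k i + n (g i)) (m (g i) + n (g i))" if i: "i \<in> I" for i
    using left_right_corner_carrier[OF i] C[OF i] Zc[of i] by blast+
  have 1: "corner Z i * Q i = R i * corner C i" if i: "i \<in> I" for i
    using 1[OF i] A_carrier[OF i] B_carrier[OF i] by (simp add: Z_def)
  have eq1': "corner C i * Q' i = R' i * corner Z i" if i: "i \<in> I" for i
    by (rule intertwine_inverse[OF carr(3,2)[OF i] Rc[OF i] Qc[OF i] inverse_pairD(4)[OF R[OF i]] inverse_pairD(3)[OF Q[OF i]] 1[OF i]])
  have eq2': "left i * Q' i = tw (\<alpha> i) (P' (f i)) (P' (f i)) * left i" if i: "i \<in> I" for i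
    by (rule intertwine_inverse[OF carr(1,1)[OF i] twP(3,4)[OF f_J[OF i]] Qc[OF i] twP(2)[OF f_J[OF i]]
          inverse_pairD(3)[OF Q[OF i]] 2[OF i]])
  have eq3': "right i * tw (\<beta> i) (P' (g i)) (P' (g i)) = R' i * right i" if i: "i \<in> I" for i
    by (rule intertwine_inverse[OF carr(4,4)[OF i] Rc[OF i] twP(3,4)[OF g_J[OF i]] inverse_pairD(4)[OF R[OF i]]
          twP(1)[OF g_J[OF i]] 3[OF i]])
  have act_rel1: "(act P Q x, act P Q y) \<in> rel Z" if "(x, y) \<in> rel C" for x y
    by (rule act_rel[OF Pc(1) Qc(1) Rc(1) C Zc 1 2 3 that])
  have act_rel2: "(act P' Q' x, act P' Q' y) \<in> rel C" if "(x, y) \<in> rel Z" for x y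
    by (rule act_rel[OF Pc(2) Qc(2) Rc(2) Zc C eq1' eq2' eq3' that])
  have act1: "act P' Q' (act P Q x) = x" if "x \<in> X" for x
    unfolding act_def[of P' Q'] by (rule act_act[OF Pc(1) Qc(1) Pc(2) inverse_pairD(4)[OF P] Qc(2) inverse_pairD(4)[OF Q] that])
  have act2: "act P Q (act P' Q' x) = x" if "x \<in> X" for x
    unfolding act_def[of P Q] by (rule act_act[OF Pc(2) Qc(2) Pc(1) inverse_pairD(3)[OF P] Qc(1) inverse_pairD(3)[OF Q] that])
  note tau = skew_field_autoD[OF auto_\<tau>]
  note taui = skew_field_autoD[OF skew_field_auto_inv[OF auto_\<tau>]]
  have tau_inv: "\<tau> (inv_into UNIV \<tau> a) = a" "inv_into UNIV \<tau> (\<tau> a) = a" for a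
    using tau(1) by (auto simp: bij_is_inj bij_is_surj surj_f_inv_f)
  have center_auto: "h a \<in> ring_center" if h: "skew_field_auto h" and a: "a \<in> ring_center" for h :: "'a \<Rightarrow> 'a" and a
  proof -
    note hD = skew_field_autoD[OF h]
    have "h a * b = b * h a" for b
    proof -
      obtain b' where "b = h b'"
        using hD(1) by (metis bij_pointE)
      moreover have "a * b' = b' * a"
        using a unfolding ring_center_def by blast
      ultimately show ?thesis
        by (metis hD(3))
    qed
    then show ?thesis
      unfolding ring_center_def by blast
  qed
  define \<sigma> where "\<sigma> z = Abs_center (inv_into UNIV \<tau> (Rep_center z))" for z :: "'a center"
  have Rep\<sigma>: "Rep_center (\<sigma> z) = inv_into UNIV \<tau> (Rep_center z)" for z
    unfolding \<sigma>_def by (rule Abs_center_inverse[OF center_auto[OF skew_field_auto_inv[OF auto_\<tau>] Rep_center]])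
  have X_enc: "X = {x. \<forall>p. p \<notin> ix \<longrightarrow> x p = 0}"
    by (simp add: X_def)
  have subX: "module.subspace cscale X"
    by (rule cscale.subspaceI) (auto intro: X_add X_cscale simp: X_def)
  interpret V: roth_relation "cscale :: 'a center \<Rightarrow> ('j, 'i, 'a) coords \<Rightarrow> _" \<sigma> X proj "act P Q" "rel C" "rel Z"
  proof unfold_locales
    show "\<sigma> (a + b) = \<sigma> a + \<sigma> b" "\<sigma> (a * b) = \<sigma> a * \<sigma> b" for a b
      by (simp_all add: Rep_center_inject[symmetric] Rep\<sigma> plus_center.rep_eq times_center.rep_eq taui(2,3))
    show "\<sigma> 1 = 1"
      by (simp add: Rep_center_inject[symmetric] Rep\<sigma> one_center.rep_eq taui(5))
    show "surj \<sigma>"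
    proof (rule surjI)
      fix z :: "'a center"
      show "\<sigma> (Abs_center (\<tau> (Rep_center z))) = z"
        by (simp add: Rep_center_inject[symmetric] Rep\<sigma> tau_inv
            Abs_center_inverse[OF center_auto[OF auto_\<tau> Rep_center]])
    qed
    show "cscale.fin_dim X"
      unfolding X_enc by (rule fin_dim_finite_support[OF fd finite_ix])
    show "inj_on (act P Q) X"
      by (rule inj_on_inverseI[of _ "act P' Q'"]) (rule act1)
    show "rel Z = map_prod (act P Q) (act P Q) ` rel C"
    proof
      show "map_prod (act P Q) (act P Q) ` rel C \<subseteq> rel Z"
        using act_rel1 by auto
      show "rel Z \<subseteq> map_prod (act P Q) (act P Q) ` rel C"
      proof (rule subrelI)
        fix x y assume xy: "(x, y) \<in> rel Z"
        then have "x \<in> X" "y \<in> X"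
          by (auto simp: rel_def)
        then have "(x, y) = map_prod (act P Q) (act P Q) (act P' Q' x, act P' Q' y)"
          by (simp add: act2)
        then show "(x, y) \<in> map_prod (act P Q) (act P Q) ` rel C"
          using act_rel2[OF xy] by blast
      qed
    qed
    show "module.subspace cscale X"
      by (rule subX)
    show "rel C \<subseteq> X \<times> X"
      by (auto simp: rel_def)
    show "(0, 0) \<in> rel C"
      by (rule rel_zero[OF C])
    show "proj (x + y) = proj x + proj y" "proj (cscale z x) = cscale z (proj x)" "proj (proj x) = proj x" for x y z
      by (rule proj_add proj_cscale proj_proj)+
    show "act P Q (x + y) = act P Q x + act P Q y" "act P Q (cscale z x) = cscale z (act P Q x)" for x y z
      by (rule act_add[OF Pc(1) Qc(1)] act_cscale[OF Pc(1) Qc(1)]; assumption)+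
    show "x \<in> X \<Longrightarrow> proj x \<in> X" "x \<in> X \<Longrightarrow> act P Q x \<in> X" for x
      by (auto simp: proj_X act_X[OF Pc(1) Qc(1)])
    show "(x, y) \<in> rel C \<Longrightarrow> (x', y') \<in> rel C \<Longrightarrow> (x + x', y + y') \<in> rel C" for x y x' y'
      by (rule rel_add[OF C])
    show "(x, y) \<in> rel C \<Longrightarrow> (cscale z x, cscale (\<sigma> z) y) \<in> rel C" for x y z
      by (rule rel_scale[OF C]) (auto simp: Rep\<sigma> tau_inv)
    show "(proj x, proj y) \<in> rel Z" if "(x, y) \<in> rel Z" for x y
      using Zc that by (rule rel_proj[OF _ Z_def])
    show "(proj x, proj y) \<in> rel Z" if "(x, y) \<in> rel C" for x y
      using C that by (rule rel_proj[OF _ Z_def])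
    show "proj x = 0 \<Longrightarrow> proj y = 0 \<Longrightarrow> (x, y) \<in> rel C \<longleftrightarrow> (x, y) \<in> rel Z" for x y
      by (rule rel_kernel[OF C Zc])
  qed
  \<comment> \<open>The identity of W, viewed as a morphism into the split extension. A fixed lift
    of it along \<open>proj\<close> is a splitting of the extension.\<close>
  define w where "w = enc (\<lambda>j. 0\<^sub>m (m j) (n j) @\<^sub>r 1\<^sub>m (n j)) (\<lambda>i. 0\<^sub>m (m (f i)) (r i) @\<^sub>r 1\<^sub>m (r i))"
  have blocks_w: "Gt w j = 0\<^sub>m (m j) (n j)" "Gb w j = 1\<^sub>m (n j)" if j: "j \<in> J" for j
  proof -
    have "Gt w j @\<^sub>r Gb w j = 0\<^sub>m (m j) (n j) @\<^sub>r 1\<^sub>m (n j)"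
      unfolding w_def G_def[symmetric] by (rule G_enc[OF j]) auto
    then show "Gt w j = 0\<^sub>m (m j) (n j)" "Gb w j = 1\<^sub>m (n j)"
      using append_rows_eq_iff[OF block_carriers(1) zero_carrier_mat block_carriers(2) one_carrier_mat] by blast+
  qed
  have blocks_w': "Ht w i = 0\<^sub>m (m (f i)) (r i)" "Hb w i = 1\<^sub>m (r i)" if i: "i \<in> I" for i
  proof -
    have "Ht w i @\<^sub>r Hb w i = 0\<^sub>m (m (f i)) (r i) @\<^sub>r 1\<^sub>m (r i)"
      unfolding w_def H_def[symmetric] by (rule H_enc[OF i]) auto
    then show "Ht w i = 0\<^sub>m (m (f i)) (r i)" "Hb w i = 1\<^sub>m (r i)"
      using append_rows_eq_iff[OF block_carriers(3) zero_carrier_mat block_carriers(4) one_carrier_mat] by blast+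
  qed
  have wX: "w \<in> X"
    unfolding w_def by (rule enc_X)
  have w_rel: "(w, w) \<in> rel Z"
  proof -
    have "A i * 0\<^sub>m (m (f i)) (r i) + Z i * 1\<^sub>m (r i) = N i * (0\<^sub>m (m (g i)) (n (g i)) * B i)"
      "0\<^sub>m (m (f i)) (r i) = 0\<^sub>m (m (f i)) (n (f i)) * M i" "M i * 1\<^sub>m (r i) = 1\<^sub>m (n (f i)) * M i"
      "B i * 1\<^sub>m (r i) = 1\<^sub>m (n (g i)) * B i" if i: "i \<in> I" for i
      using A_carrier[OF i] M_carrier[OF i] N_carrier[OF i] B_carrier[OF i] by (simp_all add: Z_def)
    then show ?thesis
      using wX by (subst rel_iff[OF Zc]) (simp add: blocks_w blocks_w' f_J g_J tw_zero tw_one)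
  qed
  have w_proj: "proj w = w"
  proof (rule X_eqI[OF proj_X[OF wX] wX])
    show "G (proj w) j = G w j" if "j \<in> J" for j
      using that by (simp add: G_def blocks_proj blocks_w)
    show "H (proj w) i = H w i" if "i \<in> I" for i
      using that by (simp add: H_def blocks_proj blocks_w')
  qed
  obtain v where v: "proj v = w" "(v, v) \<in> rel C"
    using V.fixed_lift[OF w_rel w_proj] by blast
  have Hbv: "Hb v i = 1\<^sub>m (r i)" if "i \<in> I" for i
    using blocks_proj(4)[of v i] v(1) blocks_w'(2)[OF that] by simp
  \<comment> \<open>The lower blocks of \<open>v\<close> are identities, so the conditions become
    \<open>Ht = tw (Gt) * M\<close> and \<open>A * Ht + C = N * tw (Gt) * B\<close>. The position of
    \<open>C\<close> explains the sign in the solution \<open>- Gt v\<close>.\<close>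
  have "A i * tw (\<alpha> i) (- Gt v (f i)) (- Gt v (f i)) * M i - N i * tw (\<beta> i) (- Gt v (g i)) (- Gt v (g i)) * B i = C i"
    if i: "i \<in> I" for i
  proof -
    have tm: "tw a (- U) (- U) = - tw a U U" for a U
      by (rule eq_matI) (auto simp: tw_def tau(6))
    have t: "tw a (Gt v j) (Gt v j) \<in> carrier_mat (m j) (n j)" for a j
      by (simp add: tw_carrier)
    note c = A_carrier[OF i] M_carrier[OF i] N_carrier[OF i] B_carrier[OF i] C[OF i]
    let ?S = "A i * tw (\<alpha> i) (Gt v (f i)) (Gt v (f i)) * M i" and ?T = "N i * tw (\<beta> i) (Gt v (g i)) (Gt v (g i)) * B i"
    have ST: "?S \<in> carrier_mat (k i) (r i)" "?T \<in> carrier_mat (k i) (r i)"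
      using mult_carrier_mat[OF mult_carrier_mat[OF c(1) t] c(2)] mult_carrier_mat[OF mult_carrier_mat[OF c(3) t] c(4)]
      by auto
    have "A i * (tw (\<alpha> i) (Gt v (f i)) (Gt v (f i)) * M i) + C i * 1\<^sub>m (r i) =
        N i * (tw (\<beta> i) (Gt v (g i)) (Gt v (g i)) * B i)"
      using iffD1[OF rel_iff v(2)] C i Hbv[OF i] by metis
    then have eq: "?S + C i = ?T"
      using c(5) assoc_mult_mat[OF c(1) t c(2)] assoc_mult_mat[OF c(3) t c(4)] by simp
    have "- ?S - - ?T = C i"
      using ST c(5) eq by (rule uminus_diff_eqI)
    moreover have "A' * - T' * M' = - (A' * T' * M')"
      if "A' \<in> carrier_mat a b" "T' \<in> carrier_mat b l" "M' \<in> carrier_mat l l'" for A' T' M' :: "'a mat" and a b l l'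
      using that by simp
    ultimately show ?thesis
      unfolding tm using c t by metis
  qed
  then show ?thesis
    by (intro exI[of _ "\<lambda>j. - Gt v j"]) auto
qed

end

subsection \<open>Conjugate transposes and the duality on block matrices\<close>

definition skew_field_anti_auto :: "('a::division_ring \<Rightarrow> 'a) \<Rightarrow> bool" where
  "skew_field_anti_auto d \<longleftrightarrow> (\<forall>a b. d (a + b) = d a + d b) \<and> (\<forall>a b. d (a * b) = d b * d a) \<and> (\<forall>a. d (d a) = a)"

definition J_inv :: "nat \<Rightarrow> nat \<Rightarrow> 'a::division_ring mat" where
  "J_inv m n = four_block_mat (0\<^sub>m m n) (- 1\<^sub>m m) (1\<^sub>m n) (0\<^sub>m n m)"

lemma J_carrier: "J_mat m n \<in> carrier_mat (n + m) (m + n)" "J_inv m n \<in> carrier_mat (m + n) (n + m)"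
  by (simp_all add: J_mat_def J_inv_def)

lemma J_inverse:
  "J_mat m n * J_inv m n = (1\<^sub>m (n + m) :: 'a::division_ring mat)"
  "J_inv m n * J_mat m n = (1\<^sub>m (m + n) :: 'a mat)"
proof -
  have u: "- 0\<^sub>m a b = (0\<^sub>m a b :: 'a mat)" for a b
    by (rule eq_matI) auto
  show "J_mat m n * J_inv m n = (1\<^sub>m (n + m) :: 'a mat)"
    unfolding J_mat_def J_inv_def by (subst mult_four_block_mat[of _ n m _ n _ m]) (auto simp: u)
  show "J_inv m n * J_mat m n = (1\<^sub>m (m + n) :: 'a mat)"
    unfolding J_mat_def J_inv_def by (subst mult_four_block_mat[of _ m n _ m _ n]) (auto simp: u)
qed

lemma inverse_J_mat: "inverse_mat (J_mat m n) = J_inv m n"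
proof (rule inverse_mat_eqI)
  show "J_mat m n \<in> carrier_mat (n + m) (n + m)"
    using J_carrier(1)[of m n] by (simp add: add.commute)
  show "inverts_mat (J_mat m n) (J_inv m n)" "inverts_mat (J_inv m n) (J_mat m n)"
    unfolding inverts_mat_def J_inverse carrier_matD(1)[OF J_carrier(1)] carrier_matD(1)[OF J_carrier(2)] by simp_all
qed

locale conjugations =
  fixes c d :: "'a::division_ring \<Rightarrow> 'a"
  assumes auto_c: "skew_field_auto c" and c_c [simp]: "c (c a) = a" and anti_d: "skew_field_anti_auto d"
begin

lemma d_d [simp]: "d (d a) = a"
  and d_add: "d (a + b) = d a + d b"
  and d_mult: "d (a * b) = d b * d a"
  using anti_d by (auto simp: skew_field_anti_auto_def)

lemma d_0 [simp]: "d 0 = 0"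
  using d_add[of 0 0] by (simp only: add_0_right add_cancel_right_right)

lemma d_1 [simp]: "d 1 = 1"
  using d_mult[of "d 1" 1] by simp

lemma d_uminus: "d (- a) = - d a"
  using d_add[of "- a" a] by (simp add: eq_neg_iff_add_eq_0)

lemma c_simps: "c (a + b) = c a + c b" "c (a * b) = c a * c b" "c 0 = 0" "c 1 = 1" "c (- a) = - c a"
  using skew_field_autoD[OF auto_c] by auto

definition dag :: "'a mat \<Rightarrow> 'a mat" where "dag A = transpose_mat (map_mat d A)"

lemma dag_carrier [simp]: "dag A \<in> carrier_mat nr nc \<longleftrightarrow> A \<in> carrier_mat nc nr"
  by (auto simp: dag_def)

lemma dag_dim [simp]: "dim_row (dag A) = dim_col A" "dim_col (dag A) = dim_row A"
  by (simp_all add: dag_def)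

lemma dag_index: "i < dim_col A \<Longrightarrow> j < dim_row A \<Longrightarrow> dag A $$ (i, j) = d (A $$ (j, i))"
  by (simp add: dag_def)

lemma dag_dag [simp]: "dag (dag A) = A"
  by (rule eq_matI) (auto simp: dag_def)

lemma dag_zero [simp]: "dag (0\<^sub>m a b) = 0\<^sub>m b a"
  by (rule eq_matI) (auto simp: dag_def)

lemma dag_one [simp]: "dag (1\<^sub>m a) = 1\<^sub>m a"
  by (rule eq_matI) (auto simp: dag_def)

lemma dag_uminus: "dag (- A) = - dag A"
  by (rule eq_matI) (auto simp: dag_def d_uminus)

lemma dag_mult:
  assumes "A \<in> carrier_mat nr l" "B \<in> carrier_mat l nc"
  shows "dag (A * B) = dag B * dag A"
proof -
  have sum: "d (sum h S) = (\<Sum>x\<in>S. d (h x))" for h :: "nat \<Rightarrow> _" and S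
    by (induction S rule: infinite_finite_induct) (auto simp: d_add)
  show ?thesis
    by (rule eq_matI) (use assms in \<open>auto simp: dag_def scalar_prod_def sum d_mult\<close>)
qed

lemma dag_four_block:
  assumes "A \<in> carrier_mat nr1 nc1" "B \<in> carrier_mat nr1 nc2" "C \<in> carrier_mat nr2 nc1" "D \<in> carrier_mat nr2 nc2"
  shows "dag (four_block_mat A B C D) = four_block_mat (dag A) (dag C) (dag B) (dag D)"
  unfolding dag_def map_four_block_mat[OF assms]
  by (rule transpose_four_block_mat[of _ nr1 nc1 _ nc2 _ nr2]) (use assms in auto)

text \<open>
  For a block matrix with row blocks \<open>r1, r2\<close> and column blocks \<open>c1, c2\<close>; on blocks it is
  \<open>[A, B; C, D] \<mapsto> [D\<dagger>, -B\<dagger>; -C\<dagger>, A\<dagger>]\<close>.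
\<close>

definition adj :: "nat \<Rightarrow> nat \<Rightarrow> nat \<Rightarrow> nat \<Rightarrow> 'a mat \<Rightarrow> 'a mat" where
  "adj r1 r2 c1 c2 A = J_mat c1 c2 * dag A * J_inv r1 r2"

lemma adj_carrier: "A \<in> carrier_mat (r1 + r2) (c1 + c2) \<Longrightarrow> adj r1 r2 c1 c2 A \<in> carrier_mat (c2 + c1) (r2 + r1)"
  unfolding adj_def
  by (rule mult_carrier_mat[OF mult_carrier_mat[OF J_carrier(1)] J_carrier(2)]) simp

lemma adj_mult:
  assumes A: "A \<in> carrier_mat (r1 + r2) (l1 + l2)" and B: "B \<in> carrier_mat (l1 + l2) (c1 + c2)"
  shows "adj r1 r2 c1 c2 (A * B) = adj l1 l2 c1 c2 B * adj r1 r2 l1 l2 A"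
proof -
  have A': "dag A \<in> carrier_mat (l1 + l2) (r1 + r2)" and B': "dag B \<in> carrier_mat (c1 + c2) (l1 + l2)"
    using A B by auto
  note J = J_carrier
  let ?U = "J_mat c1 c2 * dag B" and ?V = "dag A * J_inv r1 r2"
  have U: "?U \<in> carrier_mat (c2 + c1) (l1 + l2)" and V: "?V \<in> carrier_mat (l1 + l2) (r2 + r1)"
    using mult_carrier_mat[OF J(1) B'] mult_carrier_mat[OF A' J(2)] .
  have "adj l1 l2 c1 c2 B * adj r1 r2 l1 l2 A = ?U * J_inv l1 l2 * (J_mat l1 l2 * dag A * J_inv r1 r2)"
    by (simp add: adj_def)
  also have "\<dots> = ?U * J_inv l1 l2 * (J_mat l1 l2 * ?V)"
    by (simp add: assoc_mult_mat[OF J(1) A' J(2)])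
  also have "\<dots> = ?U * (J_inv l1 l2 * (J_mat l1 l2 * ?V))"
    by (rule assoc_mult_mat[OF U J(2) mult_carrier_mat[OF J(1) V]])
  also have "J_inv l1 l2 * (J_mat l1 l2 * ?V) = J_inv l1 l2 * J_mat l1 l2 * ?V"
    by (rule assoc_mult_mat[OF J(2) J(1) V, symmetric])
  also have "\<dots> = ?V"
    unfolding J_inverse by (rule left_mult_one_mat[OF V])
  also have "?U * ?V = J_mat c1 c2 * dag B * dag A * J_inv r1 r2"
    by (rule assoc_mult_mat[OF U A' J(2), symmetric])
  also have "J_mat c1 c2 * dag B * dag A = J_mat c1 c2 * (dag B * dag A)"
    by (rule assoc_mult_mat[OF J(1) B' A'])
  finally show ?thesis
    unfolding adj_def dag_mult[OF A B] by simp
qed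

lemma adj_four_block:
  assumes c: "A \<in> carrier_mat r1 c1" "B \<in> carrier_mat r1 c2" "C \<in> carrier_mat r2 c1" "D \<in> carrier_mat r2 c2"
  shows "adj r1 r2 c1 c2 (four_block_mat A B C D) = four_block_mat (dag D) (- dag B) (- dag C) (dag A)"
proof -
  have c': "dag A \<in> carrier_mat c1 r1" "dag B \<in> carrier_mat c2 r1" "dag C \<in> carrier_mat c1 r2" "dag D \<in> carrier_mat c2 r2"
    using c by auto
  have "J_mat c1 c2 * dag (four_block_mat A B C D) = four_block_mat (dag B) (dag D) (- dag A) (- dag C)"
    unfolding J_mat_def dag_four_block[OF c]
    by (subst mult_four_block_mat[where ?nr1.0 = c2 and ?n1.0 = c1 and ?n2.0 = c2 and ?nr2.0 = c1 and ?nc1.0 = r1 and ?nc2.0 = r2])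
      (use c' in \<open>auto simp: left_mult_zero_mat[OF c'(1)] left_mult_zero_mat[OF c'(2)] left_mult_zero_mat[OF c'(3)] left_mult_zero_mat[OF c'(4)]
        left_mult_one_mat[OF c'(1)] left_mult_one_mat[OF c'(2)] left_mult_one_mat[OF c'(3)] left_mult_one_mat[OF c'(4)]\<close>)
  moreover have "four_block_mat (dag B) (dag D) (- dag A) (- dag C) * J_inv r1 r2 =
      four_block_mat (dag D) (- dag B) (- dag C) (dag A)"
    unfolding J_inv_def
    by (subst mult_four_block_mat[where ?nr1.0 = c2 and ?n1.0 = r1 and ?n2.0 = r2 and ?nr2.0 = c1 and ?nc1.0 = r2 and ?nc2.0 = r1])
      (use c' in \<open>auto simp: right_mult_zero_mat[OF c'(1)] right_mult_zero_mat[OF c'(2)] right_mult_zero_mat[OF c'(3)] right_mult_zero_mat[OF c'(4)]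
        right_mult_one_mat[OF c'(1)] right_mult_one_mat[OF c'(2)] right_mult_one_mat[OF c'(3)] right_mult_one_mat[OF c'(4)]\<close>)
  ultimately show ?thesis
    by (simp add: adj_def)
qed

lemma adj_adj:
  assumes A: "A \<in> carrier_mat (r1 + r2) (c1 + c2)"
  shows "adj c2 c1 r2 r1 (adj r1 r2 c1 c2 A) = A"
proof -
  obtain A1 A2 A3 A4 where s: "split_block A r1 c1 = (A1, A2, A3, A4)"
    by (metis prod_cases4)
  have "A = four_block_mat A1 A2 A3 A4" "A1 \<in> carrier_mat r1 c1" "A2 \<in> carrier_mat r1 c2"
    "A3 \<in> carrier_mat r2 c1" "A4 \<in> carrier_mat r2 c2"
    using split_block[OF s, of r2 c2] A by auto
  then show ?thesis
    by (simp add: adj_four_block adj_four_block[of _ c2 r2 _ r1 _ c1] dag_uminus)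
qed

lemma adj_one: "adj r1 r2 r1 r2 (1\<^sub>m (r1 + r2)) = 1\<^sub>m (r2 + r1)"
  by (simp add: adj_def J_inverse right_mult_one_mat[OF J_carrier(1)])

lemma adj_inverse:
  assumes "P \<in> carrier_mat (m + n) (m + n)" "P' \<in> carrier_mat (m + n) (m + n)" "P * P' = 1\<^sub>m (m + n)"
  shows "adj m n m n P' * adj m n m n P = 1\<^sub>m (n + m)"
  using adj_mult[OF assms(1,2)] assms(3) adj_one by simp

text \<open>The matrix \<open>angle_mat\<close> with the inverse of \<open>P\<close> supplied as an
  argument; inverting the result amounts to swapping the last two arguments.\<close>

definition ang :: "nat \<Rightarrow> nat \<Rightarrow> superscript \<Rightarrow> 'a mat \<Rightarrow> 'a mat \<Rightarrow> 'a mat" where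
  "ang m n \<sigma> P P' = (case \<sigma> of One \<Rightarrow> P | Compl \<Rightarrow> map_mat c P
     | Dagger \<Rightarrow> adj m n m n P' | Star \<Rightarrow> adj m n m n (map_mat c P'))"

abbreviation srow :: "nat \<Rightarrow> nat \<Rightarrow> superscript \<Rightarrow> nat" where "srow m n \<sigma> \<equiv> superscript_rows \<sigma> m n"
abbreviation scol :: "nat \<Rightarrow> nat \<Rightarrow> superscript \<Rightarrow> nat" where "scol m n \<sigma> \<equiv> superscript_cols \<sigma> m n"

lemma ang_carrier:
  assumes "P \<in> carrier_mat (m + n) (m + n)" "P' \<in> carrier_mat (m + n) (m + n)"
  shows "ang m n \<sigma> P P' \<in> carrier_mat (srow m n \<sigma> + scol m n \<sigma>) (srow m n \<sigma> + scol m n \<sigma>)"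
  using assms adj_carrier[of P' m n m n] adj_carrier[of "map_mat c P'" m n m n]
  by (cases \<sigma>) (auto simp: ang_def)

lemma ang_inverse:
  assumes P: "P \<in> carrier_mat (m + n) (m + n)" "P' \<in> carrier_mat (m + n) (m + n)" "P * P' = 1\<^sub>m (m + n)"
  shows "ang m n \<sigma> P P' * ang m n \<sigma> P' P = 1\<^sub>m (srow m n \<sigma> + scol m n \<sigma>)"
proof -
  have "map_mat c P * map_mat c P' = 1\<^sub>m (m + n)"
    using map_mat_auto_mult[OF auto_c P(1,2)] P(3) map_mat_auto_one[OF auto_c] by simp
  then show ?thesis
    using P adj_inverse[OF P] adj_inverse[of "map_mat c P" m n "map_mat c P'"]
    by (cases \<sigma>) (auto simp: ang_def)
qed

lemma angle_mat_eq_ang: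
  assumes P: "P \<in> carrier_mat (m + n) (m + n)" "P' \<in> carrier_mat (m + n) (m + n)"
    and inv: "P * P' = 1\<^sub>m (m + n)" "P' * P = 1\<^sub>m (m + n)"
  shows "angle_mat c d m n \<sigma> P = ang m n \<sigma> P P'"
proof -
  have dag: "inverse_mat (dag U) = dag U'"
    if U: "U \<in> carrier_mat (m + n) (m + n)" "U' \<in> carrier_mat (m + n) (m + n)"
      "U * U' = 1\<^sub>m (m + n)" "U' * U = 1\<^sub>m (m + n)" for U U'
  proof (rule inverse_mat_eqI)
    show "dag U \<in> carrier_mat (m + n) (m + n)"
      using U(1) by simp
    show "inverts_mat (dag U) (dag U')" "inverts_mat (dag U') (dag U)"
      unfolding inverts_mat_def dag_mult[OF U(1,2), symmetric] dag_mult[OF U(2,1), symmetric] using U by simp_all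
  qed
  have "map_mat c P * map_mat c P' = 1\<^sub>m (m + n)" "map_mat c P' * map_mat c P = 1\<^sub>m (m + n)"
    unfolding map_mat_auto_mult[OF auto_c P(1,2), symmetric] map_mat_auto_mult[OF auto_c P(2,1), symmetric]
    by (simp_all add: inv map_mat_auto_one[OF auto_c])
  then show ?thesis
    using dag[OF P inv] dag[of "map_mat c P" "map_mat c P'"] P
    by (cases \<sigma>) (auto simp: ang_def adj_def inverse_J_mat dag_def)
qed

text \<open>Taking \<dagger> of X^\<sigma> gives exactly X with superscript
  \<open>dual_sup \<sigma>\<close>. Its companion \<open>conj_sup\<close> records the effect of
  \<kappa>, which is correct only up to \<tau>.\<close>

fun dual_sup :: "superscript \<Rightarrow> superscript" where
  "dual_sup One = Dagger" | "dual_sup Compl = Star" | "dual_sup Dagger = One" | "dual_sup Star = Compl"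

fun conj_sup :: "superscript \<Rightarrow> superscript" where
  "conj_sup One = Compl" | "conj_sup Compl = One" | "conj_sup Dagger = Star" | "conj_sup Star = Dagger"

lemma srow_dual [simp]: "srow m n (dual_sup \<sigma>) = scol m n \<sigma>" "scol m n (dual_sup \<sigma>) = srow m n \<sigma>"
  "srow m n (conj_sup \<sigma>) = srow m n \<sigma>" "scol m n (conj_sup \<sigma>) = scol m n \<sigma>"
  by (cases \<sigma>; simp)+

lemma dual_dual [simp]: "dual_sup (dual_sup \<sigma>) = \<sigma>"
  by (cases \<sigma>) auto

lemma ang_dual:
  assumes P: "P \<in> carrier_mat (m + n) (m + n)"
  shows "ang m n (dual_sup \<sigma>) P P' = adj (srow m n \<sigma>) (scol m n \<sigma>) (srow m n \<sigma>) (scol m n \<sigma>) (ang m n \<sigma> P' P)"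
  using adj_adj[of P m n m n] adj_adj[of "map_mat c P" m n m n] P by (cases \<sigma>) (auto simp: ang_def)

text \<open>The automorphism \<open>c\<close> transported through \<open>d\<close>; it is again an
  involution, and it moves past \<open>d\<close> at the price of becoming \<open>c\<close>.\<close>

definition \<kappa> :: "'a \<Rightarrow> 'a" where "\<kappa> a = d (c (d a))"

definition \<tau> :: "'a \<Rightarrow> 'a" where "\<tau> a = d (c (d (c a)))"

lemma \<kappa>_\<kappa> [simp]: "\<kappa> (\<kappa> a) = a"
  by (simp add: \<kappa>_def)

lemma auto_\<kappa>: "skew_field_auto \<kappa>"
  unfolding skew_field_auto_def
proof (intro conjI allI)
  show "bij \<kappa>"
    by (rule involuntory_imp_bij) simp
qed (simp_all add: \<kappa>_def d_add d_mult c_simps)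

lemma auto_\<tau>: "skew_field_auto \<tau>"
  unfolding skew_field_auto_def
proof (intro conjI allI)
  show "bij \<tau>"
    by (rule o_bij[of "\<lambda>a. c (d (c (d a)))"]) (auto simp: \<tau>_def)
qed (simp_all add: \<tau>_def d_add d_mult c_simps)

text \<open>The superscripts at which \<kappa> leaves a factor \<tau>:
  \<open>\<kappa> o id = \<tau> o c\<close> and \<open>\<kappa> o c = \<tau>\<close>, as against
  \<open>\<kappa> o d = d o c\<close> and \<open>\<kappa> o d o c = d\<close>. Thus no power of
  \<tau> beyond the first arises.\<close>

fun twisted :: "superscript \<Rightarrow> bool" where
  "twisted One = True" | "twisted Compl = True" | "twisted Dagger = False" | "twisted Star = False"

lemma map_J: "skew_field_auto h \<Longrightarrow> map_mat h (J_mat m n) = J_mat m n" "skew_field_auto h \<Longrightarrow> map_mat h (J_inv m n) = J_inv m n"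
  using skew_field_autoD[of h] by (auto intro!: eq_matI simp: J_mat_def J_inv_def)

lemma map_ang:
  assumes P: "P \<in> carrier_mat (m + n) (m + n)" "P' \<in> carrier_mat (m + n) (m + n)"
  shows "map_mat \<kappa> (ang m n \<sigma> P P') = (if twisted \<sigma> then map_mat \<tau> (ang m n (conj_sup \<sigma>) P P') else ang m n (conj_sup \<sigma>) P P')"
proof -
  have adj: "map_mat \<kappa> (adj m n m n U) = J_mat m n * map_mat \<kappa> (dag U) * J_inv m n"
    if U: "U \<in> carrier_mat (m + n) (m + n)" for U
  proof -
    have U': "dag U \<in> carrier_mat (m + n) (m + n)"
      using U by simp
    show ?thesis
      unfolding adj_def map_mat_auto_mult[OF auto_\<kappa> mult_carrier_mat[OF J_carrier(1) U'] J_carrier(2)]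
        map_mat_auto_mult[OF auto_\<kappa> J_carrier(1) U'] map_J[OF auto_\<kappa>] ..
  qed
  have 1: "map_mat \<kappa> (dag P') = dag (map_mat c P')"
    by (rule eq_matI) (auto simp: dag_def \<kappa>_def)
  have 2: "map_mat \<kappa> (dag (map_mat c P')) = dag P'"
    by (rule eq_matI) (auto simp: dag_def \<kappa>_def)
  have 3: "map_mat \<kappa> P = map_mat \<tau> (map_mat c P)" "map_mat \<kappa> (map_mat c P) = map_mat \<tau> P"
    by (auto intro!: eq_matI simp: \<kappa>_def \<tau>_def)
  show ?thesis
    using adj[of P'] adj[of "map_mat c P'"] P 1 2 3 by (cases \<sigma>) (auto simp: ang_def adj_def)
qed

end

subsection \<open>Conjugating a single equation\<close>

definition shape :: "nat \<Rightarrow> nat \<Rightarrow> nat \<Rightarrow> nat \<Rightarrow> nat \<Rightarrow> nat \<Rightarrow>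
    'a mat \<Rightarrow> 'a mat \<Rightarrow> 'a mat \<Rightarrow> 'a mat \<Rightarrow> 'a mat \<Rightarrow> bool" where
  "shape k p q p' q' r A B C M N \<longleftrightarrow> A \<in> carrier_mat k p \<and> B \<in> carrier_mat q' r \<and> C \<in> carrier_mat k r \<and>
     M \<in> carrier_mat q r \<and> N \<in> carrier_mat k p'"

definition eqn :: "'a::ring mat \<Rightarrow> 'a mat \<Rightarrow> 'a mat \<Rightarrow> 'a mat \<Rightarrow> 'a mat \<Rightarrow> 'a mat \<Rightarrow> 'a mat \<Rightarrow> bool" where
  "eqn A B C M N U V \<longleftrightarrow> A * U * M - N * V * B = C"

definition block_similar :: "nat \<Rightarrow> nat \<Rightarrow> 'a::semiring_1 mat \<Rightarrow> 'a mat \<Rightarrow> 'a mat \<Rightarrow> 'a mat \<Rightarrow> 'a mat \<Rightarrow>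
    'a mat \<Rightarrow> 'a mat \<Rightarrow> 'a mat \<Rightarrow> 'a mat \<Rightarrow> bool" where
  "block_similar p q' A B C M N U V Q R \<longleftrightarrow>
     diag_block_mat2 A B * Q = R * four_block_mat A C (0\<^sub>m q' p) B \<and>
     diag_block_mat2 (1\<^sub>m p) M * Q = U * diag_block_mat2 (1\<^sub>m p) M \<and>
     diag_block_mat2 N (1\<^sub>m q') * V = R * diag_block_mat2 N (1\<^sub>m q')"

lemma shapeD:
  assumes "shape k p q p' q' r A B C M N"
  shows "A \<in> carrier_mat k p" "B \<in> carrier_mat q' r" "C \<in> carrier_mat k r"
    "M \<in> carrier_mat q r" "N \<in> carrier_mat k p'"
  using assms by (auto simp: shape_def)

lemma eqn_add:
  fixes A :: "'a::ring mat"
  assumes sh: "shape k p q p' q' r A B C M N"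
    and U: "U \<in> carrier_mat p q" "U' \<in> carrier_mat p q" and V: "V \<in> carrier_mat p' q'" "V' \<in> carrier_mat p' q'"
    and e: "eqn A B C M N U V" "eqn A B C' M N U' V'"
  shows "eqn A B (C + C') M N (U + U') (V + V')"
proof -
  note c = shapeD[OF sh]
  have 1: "A * (U + U') * M = A * U * M + A * U' * M"
    by (simp only: mult_add_distrib_mat[OF c(1) U]
        add_mult_distrib_mat[OF mult_carrier_mat[OF c(1) U(1)] mult_carrier_mat[OF c(1) U(2)] c(4)])
  have 2: "N * (V + V') * B = N * V * B + N * V' * B"
    by (simp only: mult_add_distrib_mat[OF c(5) V]
        add_mult_distrib_mat[OF mult_carrier_mat[OF c(5) V(1)] mult_carrier_mat[OF c(5) V(2)] c(2)])
  have S: "A * U * M \<in> carrier_mat k r" "A * U' * M \<in> carrier_mat k r" "N * V * B \<in> carrier_mat k r" "N * V' * B \<in> carrier_mat k r"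
    by (rule mult_carrier_mat[OF mult_carrier_mat[OF c(1) U(1)] c(4)] mult_carrier_mat[OF mult_carrier_mat[OF c(1) U(2)] c(4)]
        mult_carrier_mat[OF mult_carrier_mat[OF c(5) V(1)] c(2)] mult_carrier_mat[OF mult_carrier_mat[OF c(5) V(2)] c(2)])+
  have gen: "(S1 + S2) - (T1 + T2) = (S1 - T1) + (S2 - T2)"
    if "S1 \<in> carrier_mat k r" "S2 \<in> carrier_mat k r" "T1 \<in> carrier_mat k r" "T2 \<in> carrier_mat k r" for S1 S2 T1 T2 :: "'a mat"
    by (rule eq_matI) (use that in auto)
  show ?thesis
    using e unfolding eqn_def 1 2 gen[OF S] by simp
qed

lemma eqn_center_smult:
  fixes A :: "'a::division_ring mat"
  assumes sh: "shape k p q p' q' r A B C M N" and U: "U \<in> carrier_mat p q" and V: "V \<in> carrier_mat p' q'"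
    and e: "eqn A B C M N U V"
  shows "eqn A B (center_smult z C) M N (center_smult z U) (center_smult z V)"
proof -
  note c = shapeD[OF sh]
  have 1: "A * center_smult z U * M = center_smult z (A * U * M)" "N * center_smult z V * B = center_smult z (N * V * B)"
    by (simp_all only: mult_center_smult(1)[OF c(1) U] mult_center_smult(1)[OF c(5) V]
        mult_center_smult(2)[OF mult_carrier_mat[OF c(1) U] c(4)] mult_center_smult(2)[OF mult_carrier_mat[OF c(5) V] c(2)])
  have S: "A * U * M \<in> carrier_mat k r" "N * V * B \<in> carrier_mat k r"
    by (rule mult_carrier_mat[OF mult_carrier_mat[OF c(1) U] c(4)] mult_carrier_mat[OF mult_carrier_mat[OF c(5) V] c(2)])+
  have gen: "center_smult z S - center_smult z T = center_smult z (S - T)"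
    if "S \<in> carrier_mat k r" "T \<in> carrier_mat k r" for S T :: "'a mat"
    by (rule eq_matI) (use that in \<open>auto simp: right_diff_distrib\<close>)
  show ?thesis
    using e unfolding eqn_def 1 gen[OF S] by simp
qed

lemma eqn_map:
  assumes h: "skew_field_auto h" "\<And>a. h (h a) = a" and sh: "shape k p q p' q' r A B C M N"
    and U: "U \<in> carrier_mat p q" and V: "V \<in> carrier_mat p' q'"
    and e: "eqn (map_mat h A) (map_mat h B) (map_mat h C) (map_mat h M) (map_mat h N) U V"
  shows "eqn A B C M N (map_mat h U) (map_mat h V)"
proof -
  note c = shapeD[OF sh]
  have hh: "map_mat h (map_mat h D) = D" for D
    by (rule eq_matI) (auto simp: h(2))
  have c': "map_mat h A \<in> carrier_mat k p" "map_mat h M \<in> carrier_mat q r"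
    "map_mat h N \<in> carrier_mat k p'" "map_mat h B \<in> carrier_mat q' r"
    using c by simp_all
  note hm = map_mat_auto_mult[OF h(1)]
  let ?S = "map_mat h A * U * map_mat h M" and ?T = "map_mat h N * V * map_mat h B"
  have S: "?S \<in> carrier_mat k r" "?T \<in> carrier_mat k r"
    by (rule mult_carrier_mat[OF mult_carrier_mat[OF c'(1) U] c'(2)] mult_carrier_mat[OF mult_carrier_mat[OF c'(3) V] c'(4)])+
  have 1: "map_mat h ?S = A * map_mat h U * M" "map_mat h ?T = N * map_mat h V * B"
    by (simp_all only: hm[OF mult_carrier_mat[OF c'(1) U] c'(2)] hm[OF c'(1) U]
        hm[OF mult_carrier_mat[OF c'(3) V] c'(4)] hm[OF c'(3) V] hh)
  have gen: "map_mat h (S - T) = map_mat h S - map_mat h T"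
    if "S \<in> carrier_mat k r" "T \<in> carrier_mat k r" for S T
    using that skew_field_autoD(2,6)[OF h(1)] by (intro eq_matI) (auto simp flip: add_uminus_conv_diff)
  have "map_mat h ?S - map_mat h ?T = map_mat h (map_mat h C)"
    using e unfolding eqn_def gen[OF S, symmetric] by simp
  then show ?thesis
    unfolding eqn_def 1 hh .
qed

lemma map_mat_auto_zero: "skew_field_auto h \<Longrightarrow> map_mat h (0\<^sub>m a b) = 0\<^sub>m a b"
  by (rule eq_matI) (auto simp: skew_field_autoD)

lemma block_similar_map:
  assumes h: "skew_field_auto h" and sh: "shape k p q p' q' r A B C M N"
    and QR: "Q \<in> carrier_mat (p + r) (p + r)" "R \<in> carrier_mat (k + q') (k + q')"
    and UV: "U \<in> carrier_mat (p + q) (p + q)" "V \<in> carrier_mat (p' + q') (p' + q')"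
    and s: "block_similar p q' A B C M N U V Q R"
  shows "block_similar p q' (map_mat h A) (map_mat h B) (map_mat h C) (map_mat h M) (map_mat h N)
    (map_mat h U) (map_mat h V) (map_mat h Q) (map_mat h R)"
proof -
  note c = shapeD[OF sh]
  let ?E = "four_block_mat A (0\<^sub>m k r) (0\<^sub>m q' p) B" and ?D = "four_block_mat A C (0\<^sub>m q' p) B"
    and ?F = "four_block_mat (1\<^sub>m p) (0\<^sub>m p r) (0\<^sub>m q p) M" and ?G = "four_block_mat N (0\<^sub>m k q') (0\<^sub>m q' p') (1\<^sub>m q')"
  have car: "?E \<in> carrier_mat (k + q') (p + r)" "?D \<in> carrier_mat (k + q') (p + r)"
    "?F \<in> carrier_mat (p + q) (p + r)" "?G \<in> carrier_mat (k + q') (p' + q')"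
    using c by auto
  have s': "?E * Q = R * ?D" "?F * Q = U * ?F" "?G * V = R * ?G"
    using s unfolding block_similar_def
    by (simp_all add: carrier_matD[OF c(1)] carrier_matD[OF c(2)] carrier_matD[OF c(4)] carrier_matD[OF c(5)])
  note z = map_mat_auto_zero[OF h] map_mat_auto_one[OF h]
  have m: "map_mat h ?E = four_block_mat (map_mat h A) (0\<^sub>m k r) (0\<^sub>m q' p) (map_mat h B)"
    "map_mat h ?D = four_block_mat (map_mat h A) (map_mat h C) (0\<^sub>m q' p) (map_mat h B)"
    "map_mat h ?F = four_block_mat (1\<^sub>m p) (0\<^sub>m p r) (0\<^sub>m q p) (map_mat h M)"
    "map_mat h ?G = four_block_mat (map_mat h N) (0\<^sub>m k q') (0\<^sub>m q' p') (1\<^sub>m q')"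
    by (simp_all add: z map_four_block_mat[OF c(1) zero_carrier_mat zero_carrier_mat c(2)]
        map_four_block_mat[OF c(1) c(3) zero_carrier_mat c(2)]
        map_four_block_mat[OF one_carrier_mat zero_carrier_mat zero_carrier_mat c(4)]
        map_four_block_mat[OF c(5) zero_carrier_mat zero_carrier_mat one_carrier_mat])
  note hm = map_mat_auto_mult[OF h]
  have "map_mat h ?E * map_mat h Q = map_mat h R * map_mat h ?D"
    "map_mat h ?F * map_mat h Q = map_mat h U * map_mat h ?F"
    "map_mat h ?G * map_mat h V = map_mat h R * map_mat h ?G"
    using s' unfolding hm[OF car(1) QR(1), symmetric] hm[OF QR(2) car(2), symmetric] hm[OF car(3) QR(1), symmetric]
      hm[OF UV(1) car(3), symmetric] hm[OF car(4) UV(2), symmetric] hm[OF QR(2) car(4), symmetric] by simp_all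
  then show ?thesis
    unfolding block_similar_def m
    by (simp add: carrier_matD[OF c(1)] carrier_matD[OF c(2)] carrier_matD[OF c(4)] carrier_matD[OF c(5)])
qed

context conjugations
begin

text \<open>Since \<dagger> reverses products, restoring the form of the equation exchanges its two
  terms: \<open>A\<close> trades places with \<open>B\<close>, \<open>M\<close> with
  \<open>N\<close>, and \<open>C\<close> acquires a sign.\<close>

lemma eqn_dag:
  assumes sh: "shape k p q p' q' r A B C M N" and U: "U \<in> carrier_mat q p" and V: "V \<in> carrier_mat q' p'"
    and e: "eqn (dag B) (dag A) (- dag C) (dag N) (dag M) V U"
  shows "eqn A B C M N (dag U) (dag V)"
proof -
  note c = shapeD[OF sh]
  have c': "dag A \<in> carrier_mat p k" "dag M \<in> carrier_mat r q" "dag N \<in> carrier_mat p' k" "dag B \<in> carrier_mat r q'"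
    "dag U \<in> carrier_mat p q" "dag V \<in> carrier_mat p' q'"
    using c U V by simp_all
  have 1: "dag (dag B * V * dag N) = N * dag V * B" "dag (dag M * U * dag A) = A * dag U * M"
    by (simp_all only: dag_mult[OF mult_carrier_mat[OF c'(4) V] c'(3)] dag_mult[OF c'(4) V]
        dag_mult[OF mult_carrier_mat[OF c'(2) U] c'(1)] dag_mult[OF c'(2) U] dag_dag
        assoc_mult_mat[OF c(5) c'(6) c(2)] assoc_mult_mat[OF c(1) c'(5) c(4)])
  have S: "dag B * V * dag N \<in> carrier_mat r k" "dag M * U * dag A \<in> carrier_mat r k"
    by (rule mult_carrier_mat[OF mult_carrier_mat[OF c'(4) V] c'(3)] mult_carrier_mat[OF mult_carrier_mat[OF c'(2) U] c'(1)])+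
  have "S - T = - dag C \<Longrightarrow> dag T - dag S = C"
    if "S \<in> carrier_mat r k" "T \<in> carrier_mat r k" for S T
  proof -
    assume eq: "S - T = - dag C"
    have "C $$ (i, j) = d (T $$ (j, i)) - d (S $$ (j, i))" if ij: "i < k" "j < r" for i j
    proof -
      have "(S - T) $$ (j, i) = (- dag C) $$ (j, i)"
        using eq by simp
      then have "d (C $$ (i, j)) = T $$ (j, i) - S $$ (j, i)"
        using ij c(3) \<open>S \<in> _\<close> \<open>T \<in> _\<close> by (simp add: dag_index) (metis minus_diff_eq minus_minus)
      then have "d (d (C $$ (i, j))) = d (T $$ (j, i) - S $$ (j, i))"
        by simp
      then show ?thesis
        using d_add[of "T $$ (j, i)" "- S $$ (j, i)"] by (simp add: d_uminus)
    qed
    then show "dag T - dag S = C"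
      using that c by (intro eq_matI) (auto simp: dag_index)
  qed
  from this[OF S] show ?thesis
    using e unfolding eqn_def 1 by simp
qed

text \<open>The duality \<open>adj\<close> produces the block matrices of the dual equation,
  including the sign of \<open>C\<close>, and exchanges the second and third equalities. It reverses
  arrows, so the equalities are first rewritten for the inverse matrices, and \<open>Q\<close> and
  \<open>R\<close> swap roles.\<close>

lemma block_similar_dual:
  assumes sh: "shape k p q p' q' r A B C M N"
    and Q: "inverse_pair (p + r) Q Q'" and R: "inverse_pair (k + q') R R'"
    and U: "inverse_pair (p + q) U U'" and V: "inverse_pair (p' + q') V V'"
    and s: "block_similar p q' A B C M N U V Q R"
  shows "block_similar q' p (dag B) (dag A) (- dag C) (dag N) (dag M)
    (adj p' q' p' q' V') (adj p q p q U') (adj k q' k q' R') (adj p r p r Q')"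
proof -
  note c = shapeD[OF sh]
  note Q' = inverse_pairD[OF Q] and R' = inverse_pairD[OF R] and U' = inverse_pairD[OF U] and V' = inverse_pairD[OF V]
  let ?E = "four_block_mat A (0\<^sub>m k r) (0\<^sub>m q' p) B" and ?D = "four_block_mat A C (0\<^sub>m q' p) B"
    and ?F = "four_block_mat (1\<^sub>m p) (0\<^sub>m p r) (0\<^sub>m q p) M" and ?G = "four_block_mat N (0\<^sub>m k q') (0\<^sub>m q' p') (1\<^sub>m q')"
  have car: "?E \<in> carrier_mat (k + q') (p + r)" "?D \<in> carrier_mat (k + q') (p + r)"
    "?F \<in> carrier_mat (p + q) (p + r)" "?G \<in> carrier_mat (k + q') (p' + q')"
    using c by auto
  have s0: "?E * Q = R * ?D" "?F * Q = U * ?F" "?G * V = R * ?G"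
    using s unfolding block_similar_def
    by (simp_all add: carrier_matD[OF c(1)] carrier_matD[OF c(2)] carrier_matD[OF c(4)] carrier_matD[OF c(5)])
  have s': "?D * Q' = R' * ?E" "?F * Q' = U' * ?F" "?G * V' = R' * ?G"
    by (rule intertwine_inverse[OF car(1,2) R'(1,2) Q'(1,2) R'(4) Q'(3) s0(1)]
        intertwine_inverse[OF car(3,3) U'(1,2) Q'(1,2) U'(4) Q'(3) s0(2)]
        intertwine_inverse[OF car(4,4) R'(1,2) V'(1,2) R'(4) V'(3) s0(3)])+
  have z: "- 0\<^sub>m a b = (0\<^sub>m a b :: 'a mat)" for a b
    by (rule eq_matI) auto
  have m: "adj k q' p r ?E = four_block_mat (dag B) (0\<^sub>m r k) (0\<^sub>m p q') (dag A)"
    "adj k q' p r ?D = four_block_mat (dag B) (- dag C) (0\<^sub>m p q') (dag A)"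
    "adj p q p r ?F = four_block_mat (dag M) (0\<^sub>m r p) (0\<^sub>m p q) (1\<^sub>m p)"
    "adj k q' p' q' ?G = four_block_mat (1\<^sub>m q') (0\<^sub>m q' k) (0\<^sub>m p' q') (dag N)"
    by (simp_all add: adj_four_block[OF c(1) zero_carrier_mat zero_carrier_mat c(2)] adj_four_block[OF c(1) c(3) zero_carrier_mat c(2)]
        adj_four_block[OF one_carrier_mat zero_carrier_mat zero_carrier_mat c(4)]
        adj_four_block[OF c(5) zero_carrier_mat zero_carrier_mat one_carrier_mat] z)
  have "adj p r p r Q' * adj k q' p r ?D = adj k q' p r ?E * adj k q' k q' R'"
    "adj p r p r Q' * adj p q p r ?F = adj p q p r ?F * adj p q p q U'"
    "adj p' q' p' q' V' * adj k q' p' q' ?G = adj k q' p' q' ?G * adj k q' k q' R'"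
    by (simp_all only: s' adj_mult[OF car(2) Q'(2), symmetric] adj_mult[OF R'(2) car(1), symmetric]
        adj_mult[OF car(3) Q'(2), symmetric] adj_mult[OF U'(2) car(3), symmetric]
        adj_mult[OF car(4) V'(2), symmetric] adj_mult[OF R'(2) car(4), symmetric])
  then show ?thesis
    unfolding block_similar_def m
    by (simp add: carrier_matD[OF c(1)] carrier_matD[OF c(2)] carrier_matD[OF c(4)] carrier_matD[OF c(5)])
qed

lemma inverse_pair_adj:
  assumes "inverse_pair (m + n) P P'"
  shows "inverse_pair (n + m) (adj m n m n P') (adj m n m n P)"
  using assms adj_inverse[of P m n P'] adj_inverse[of P' m n P] adj_carrier[of P m n m n] adj_carrier[of P' m n m n]
  by (auto simp: inverse_pair_def)

lemma inverse_pair_ang: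
  "inverse_pair (m + n) P P' \<Longrightarrow>
    inverse_pair (srow m n \<sigma> + scol m n \<sigma>) (ang m n \<sigma> P P') (ang m n \<sigma> P' P)"
  using ang_inverse[of P m n P'] ang_inverse[of P' m n P] ang_carrier[of P m n P'] ang_carrier[of P' m n P]
  by (auto simp: inverse_pair_def)

end

abbreviation unipotent :: "nat \<Rightarrow> nat \<Rightarrow> 'a::{zero,one} mat \<Rightarrow> 'a mat" where
  "unipotent m n X \<equiv> four_block_mat (1\<^sub>m m) X (0\<^sub>m n m) (1\<^sub>m n)"

lemma inverse_pair_map:
  assumes h: "skew_field_auto h" and P: "inverse_pair l P P'"
  shows "inverse_pair l (map_mat h P) (map_mat h P')"
  using inverse_pairD[OF P] map_mat_auto_mult[OF h, of P l l P' l, symmetric] map_mat_auto_mult[OF h, of P' l l P l, symmetric]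
  by (simp add: inverse_pair_def map_mat_auto_one[OF h])

lemma shape_map: "shape k p q p' q' r A B C M N \<Longrightarrow>
    shape k p q p' q' r (map_mat h A) (map_mat h B) (map_mat h C) (map_mat h M) (map_mat h N)"
  by (simp add: shape_def)

lemma finite_superscript: "finite (UNIV :: superscript set)"
proof -
  have "(UNIV :: superscript set) = {One, Compl, Dagger, Star}"
    using superscript.exhaust by auto
  then show ?thesis
    by (metis finite.emptyI finite_insert)
qed

lemma four_neq_zero:
  assumes "CHAR('a::division_ring) \<noteq> 2"
  shows "(4 :: 'a) \<noteq> 0"
proof
  assume "(4 :: 'a) = 0"
  then have "(2 :: 'a) * 2 = 0"
    by simp
  then have "(2 :: 'a) = 0"
    by (metis mult_eq_0_iff)
  then have "of_nat 2 = (0 :: 'a)"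
    by simp
  then have "CHAR('a) dvd 2"
    by (simp only: of_nat_eq_0_iff_char_dvd)
  then have "CHAR('a) = 1"
    using assms prime_nat_iff two_is_prime_nat by blast
  then show False
    using of_nat_CHAR[where ?'a = 'a] by simp
qed

section \<open>Averaging the solutions of the conjugate equations\<close>

context conjugations
begin

lemma shape_dual: "shape k p q p' q' r A B C M N \<Longrightarrow>
    shape r q' p' q p k (dag B) (dag A) (- dag C) (dag N) (dag M)"
  by (simp add: shape_def)

lemma superscript_mat_eq: "superscript_mat c d \<sigma> A =
    (case \<sigma> of One \<Rightarrow> A | Compl \<Rightarrow> map_mat c A | Dagger \<Rightarrow> dag A | Star \<Rightarrow> dag (map_mat c A))"
  by (cases \<sigma>) (simp_all add: dag_def)

lemma superscript_carrier: "A \<in> carrier_mat m n \<Longrightarrow>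
    superscript_mat c d \<sigma> A \<in> carrier_mat (srow m n \<sigma>) (scol m n \<sigma>)"
  by (cases \<sigma>) simp_all

text \<open>
  The matrices \<open>X, X\<^sup>c, X\<^sup>\<dagger>, X\<^sup>*\<close> are treated as independent unknowns. Every equation is
  accompanied by its conjugates under \<open>\<dagger>\<close>, under \<^term>\<open>\<kappa>\<close> and under both; these involve only powers of the
  automorphism \<^term>\<open>\<tau>\<close>, which is trivial exactly when \<^term>\<open>c\<close> and \<^term>\<open>d\<close> commute. Averaging the four
  solutions of an equation restores the dependence.
\<close>

theorem similar_imp_solvable:
  fixes s t :: nat and m n k r i1 i2 :: "nat \<Rightarrow> nat" and \<epsilon> \<delta> :: "nat \<Rightarrow> superscript"
    and A B C M N P P' Q Q' R R' :: "nat \<Rightarrow> 'a mat"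
  defines "p \<equiv> \<lambda>i. srow (m (i1 i)) (n (i1 i)) (\<epsilon> i)" and "q \<equiv> \<lambda>i. scol (m (i1 i)) (n (i1 i)) (\<epsilon> i)"
    and "p' \<equiv> \<lambda>i. srow (m (i2 i)) (n (i2 i)) (\<delta> i)" and "q' \<equiv> \<lambda>i. scol (m (i2 i)) (n (i2 i)) (\<delta> i)"
  assumes char: "CHAR('a) \<noteq> 2" and fd: "finite_dimensional_over_center TYPE('a)"
    and i1: "\<And>i. i \<in> {1..s} \<Longrightarrow> i1 i \<in> {1..t}" and i2: "\<And>i. i \<in> {1..s} \<Longrightarrow> i2 i \<in> {1..t}"
    and sh: "\<And>i. i \<in> {1..s} \<Longrightarrow> shape (k i) (p i) (q i) (p' i) (q' i) (r i) (A i) (B i) (C i) (M i) (N i)"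
    and P: "\<And>j. j \<in> {1..t} \<Longrightarrow> inverse_pair (m j + n j) (P j) (P' j)"
    and Q: "\<And>i. i \<in> {1..s} \<Longrightarrow> inverse_pair (p i + r i) (Q i) (Q' i)"
    and R: "\<And>i. i \<in> {1..s} \<Longrightarrow> inverse_pair (k i + q' i) (R i) (R' i)"
    and sim: "\<And>i. i \<in> {1..s} \<Longrightarrow> block_similar (p i) (q' i) (A i) (B i) (C i) (M i) (N i)
      (ang (m (i1 i)) (n (i1 i)) (\<epsilon> i) (P (i1 i)) (P' (i1 i)))
      (ang (m (i2 i)) (n (i2 i)) (\<delta> i) (P (i2 i)) (P' (i2 i))) (Q i) (R i)"
  shows "\<exists>X. (\<forall>j\<in>{1..t}. X j \<in> carrier_mat (m j) (n j)) \<and>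
    (\<forall>i\<in>{1..s}. A i * superscript_mat c d (\<epsilon> i) (X (i1 i)) * M i
      - N i * superscript_mat c d (\<delta> i) (X (i2 i)) * B i = C i)"
proof -
  \<comment> \<open>The flag \<open>u\<close> selects the dual of equation \<open>i\<close>, and the
    flag \<open>v\<close> further below its conjugate under \<kappa>. Dualizing exchanges the
    unknowns at the two positions, hence the crossing of \<open>i1\<close> and
    \<open>i2\<close>.\<close>
  define fu where "fu i u = (if u then (i2 i, dual_sup (\<delta> i)) else (i1 i, \<epsilon> i))" for i u
  define gu where "gu i u = (if u then (i1 i, dual_sup (\<epsilon> i)) else (i2 i, \<delta> i))" for i u
  define ku where "ku i u = (if u then r i else k i)" for i u
  define ru where "ru i u = (if u then k i else r i)" for i u
  define Au where "Au i u = (if u then dag (B i) else A i)" for i u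
  define Bu where "Bu i u = (if u then dag (A i) else B i)" for i u
  define Cu where "Cu i u = (if u then - dag (C i) else C i)" for i u
  define Mu where "Mu i u = (if u then dag (N i) else M i)" for i u
  define Nu where "Nu i u = (if u then dag (M i) else N i)" for i u
  define Qu where "Qu i u = (if u then adj (k i) (q' i) (k i) (q' i) (R' i) else Q i)" for i u
  define Qu' where "Qu' i u = (if u then adj (k i) (q' i) (k i) (q' i) (R i) else Q' i)" for i u
  define Ru where "Ru i u = (if u then adj (p i) (r i) (p i) (r i) (Q' i) else R i)" for i u
  define Ru' where "Ru' i u = (if u then adj (p i) (r i) (p i) (r i) (Q i) else R' i)" for i u
  define mm where "mm j\<sigma> = (case j\<sigma> of (j, \<sigma>) \<Rightarrow> srow (m j) (n j) \<sigma>)" for j\<sigma> :: "nat \<times> superscript"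
  define nn where "nn j\<sigma> = (case j\<sigma> of (j, \<sigma>) \<Rightarrow> scol (m j) (n j) \<sigma>)" for j\<sigma> :: "nat \<times> superscript"
  define an where "an j\<sigma> = (case j\<sigma> of (j, \<sigma>) \<Rightarrow> ang (m j) (n j) \<sigma> (P j) (P' j))" for j\<sigma>
  define an' where "an' j\<sigma> = (case j\<sigma> of (j, \<sigma>) \<Rightarrow> ang (m j) (n j) \<sigma> (P' j) (P j))" for j\<sigma>
  define ca where "ca v j\<sigma> = (case j\<sigma> of (j, \<sigma>) \<Rightarrow> (j, if v then conj_sup \<sigma> else \<sigma>))" for v and j\<sigma> :: "nat \<times> superscript"
  define cm where "cm v U = (if v then map_mat \<kappa> U else U)" for v and U :: "'a mat"
  define J where "J = {1..t} \<times> (UNIV :: superscript set)"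
  define I where "I = {1..s} \<times> (UNIV :: bool set) \<times> (UNIV :: bool set)"
  have fg_J: "fu i u \<in> J" "gu i u \<in> J" if "i \<in> {1..s}" for i u
    using i1[OF that] i2[OF that] by (auto simp: fu_def gu_def J_def)
  have shu: "shape (ku i u) (mm (fu i u)) (nn (fu i u)) (mm (gu i u)) (nn (gu i u)) (ru i u)
      (Au i u) (Bu i u) (Cu i u) (Mu i u) (Nu i u)" if i: "i \<in> {1..s}" for i u
    using sh[OF i] shape_dual[OF sh[OF i]]
    by (cases u) (simp_all add: ku_def ru_def mm_def nn_def fu_def gu_def Au_def Bu_def Cu_def Mu_def Nu_def
        p_def q_def p'_def q'_def)
  have anu: "inverse_pair (mm j\<sigma> + nn j\<sigma>) (an j\<sigma>) (an' j\<sigma>)" if "j\<sigma> \<in> J" for j\<sigma>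
    using that inverse_pair_ang[OF P] by (auto simp: J_def mm_def nn_def an_def an'_def)
  have Qu: "inverse_pair (mm (fu i u) + ru i u) (Qu i u) (Qu' i u)" if i: "i \<in> {1..s}" for i u
    using Q[OF i] inverse_pair_adj[OF R[OF i]]
    by (cases u) (simp_all add: Qu_def Qu'_def ru_def mm_def fu_def p_def q'_def)
  have Ru: "inverse_pair (ku i u + nn (gu i u)) (Ru i u) (Ru' i u)" if i: "i \<in> {1..s}" for i u
    using R[OF i] inverse_pair_adj[OF Q[OF i]]
    by (cases u) (simp_all add: Ru_def Ru'_def ku_def nn_def gu_def p_def q'_def)
  have simu: "block_similar (mm (fu i u)) (nn (gu i u)) (Au i u) (Bu i u) (Cu i u) (Mu i u) (Nu i u)
      (an (fu i u)) (an (gu i u)) (Qu i u) (Ru i u)" if i: "i \<in> {1..s}" for i u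
  proof (cases u)
    case True
    note Pi = inverse_pairD(1)[OF P[OF i1[OF i]]] inverse_pairD(1)[OF P[OF i2[OF i]]]
    have "block_similar (q' i) (p i) (dag (B i)) (dag (A i)) (- dag (C i)) (dag (N i)) (dag (M i))
       (adj (p' i) (q' i) (p' i) (q' i) (ang (m (i2 i)) (n (i2 i)) (\<delta> i) (P' (i2 i)) (P (i2 i))))
       (adj (p i) (q i) (p i) (q i) (ang (m (i1 i)) (n (i1 i)) (\<epsilon> i) (P' (i1 i)) (P (i1 i))))
       (adj (k i) (q' i) (k i) (q' i) (R' i)) (adj (p i) (r i) (p i) (r i) (Q' i))"
      by (rule block_similar_dual[OF sh[OF i] Q[OF i] R[OF i] _ _ sim[OF i]])
        (unfold p_def q_def p'_def q'_def, (rule inverse_pair_ang[OF P[OF i1[OF i]]] inverse_pair_ang[OF P[OF i2[OF i]]])+)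
    then show ?thesis
      using True ang_dual[OF Pi(1), of "\<epsilon> i" "P' (i1 i)"] ang_dual[OF Pi(2), of "\<delta> i" "P' (i2 i)"]
      by (simp add: mm_def nn_def fu_def gu_def Au_def Bu_def Cu_def Mu_def Nu_def an_def Qu_def Ru_def
          p_def q_def p'_def q'_def)
  next
    case False
    then show ?thesis
      using sim[OF i]
      by (simp add: mm_def nn_def fu_def gu_def Au_def Bu_def Cu_def Mu_def Nu_def an_def Qu_def Ru_def
          p_def q_def p'_def q'_def)
  qed
  define tf where "tf v j\<sigma> = (v \<and> twisted (snd j\<sigma>))" for v and j\<sigma> :: "nat \<times> superscript"
  have ca_J: "ca v j\<sigma> \<in> J" if "j\<sigma> \<in> J" for v j\<sigma>
    using that by (auto simp: ca_def J_def)
  have ca_size [simp]: "mm (ca v j\<sigma>) = mm j\<sigma>" "nn (ca v j\<sigma>) = nn j\<sigma>" for v j\<sigma>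
    by (auto simp: ca_def mm_def nn_def split: prod.splits)
  have cm_an: "cm v (an j\<sigma>) = (if tf v j\<sigma> then map_mat \<tau> (an (ca v j\<sigma>)) else an (ca v j\<sigma>))"
    if j\<sigma>: "j\<sigma> \<in> J" for v j\<sigma>
  proof -
    obtain j \<sigma> where j: "j\<sigma> = (j, \<sigma>)" "j \<in> {1..t}"
      using j\<sigma> unfolding J_def by blast
    show ?thesis
      using map_ang[OF inverse_pairD(1,2)[OF P[OF j(2)]]] by (simp add: j(1) cm_def an_def ca_def tf_def)
  qed
  have shv: "shape (ku i u) (mm (fu i u)) (nn (fu i u)) (mm (gu i u)) (nn (gu i u)) (ru i u)
      (cm v (Au i u)) (cm v (Bu i u)) (cm v (Cu i u)) (cm v (Mu i u)) (cm v (Nu i u))" if i: "i \<in> {1..s}" for i u v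
    using shu[OF i] shape_map[OF shu[OF i], where h = \<kappa>] by (cases v) (simp_all add: cm_def)
  have simv: "block_similar (mm (fu i u)) (nn (gu i u)) (cm v (Au i u)) (cm v (Bu i u)) (cm v (Cu i u))
      (cm v (Mu i u)) (cm v (Nu i u)) (cm v (an (fu i u))) (cm v (an (gu i u))) (cm v (Qu i u)) (cm v (Ru i u))"
    if i: "i \<in> {1..s}" for i u v
    using simu[OF i] block_similar_map[OF auto_\<kappa> shu[OF i] inverse_pairD(1)[OF Qu[OF i]] inverse_pairD(1)[OF Ru[OF i]]
        inverse_pairD(1)[OF anu[OF fg_J(1)[OF i]]] inverse_pairD(1)[OF anu[OF fg_J(2)[OF i]]] simu[OF i]]
    by (cases v) (simp_all add: cm_def)
  have Qv: "inverse_pair (mm (fu i u) + ru i u) (cm v (Qu i u)) (cm v (Qu' i u))" if i: "i \<in> {1..s}" for i u v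
    using Qu[OF i] inverse_pair_map[OF auto_\<kappa> Qu[OF i]] by (cases v) (simp_all add: cm_def)
  have Rv: "inverse_pair (ku i u + nn (gu i u)) (cm v (Ru i u)) (cm v (Ru' i u))" if i: "i \<in> {1..s}" for i u v
    using Ru[OF i] inverse_pair_map[OF auto_\<kappa> Ru[OF i]] by (cases v) (simp_all add: cm_def)
  interpret S: twisted_matrix_system \<tau> J I mm nn "\<lambda>(i, u, v). ku i u" "\<lambda>(i, u, v). ru i u"
    "\<lambda>(i, u, v). ca v (fu i u)" "\<lambda>(i, u, v). ca v (gu i u)" "\<lambda>(i, u, v). tf v (fu i u)" "\<lambda>(i, u, v). tf v (gu i u)"
    "\<lambda>(i, u, v). cm v (Au i u)" "\<lambda>(i, u, v). cm v (Bu i u)" "\<lambda>(i, u, v). cm v (Mu i u)" "\<lambda>(i, u, v). cm v (Nu i u)"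
  proof unfold_locales
    show "skew_field_auto \<tau>"
      by (rule auto_\<tau>)
    show "finite J" "finite I"
      by (auto simp: J_def I_def finite_superscript)
  qed (auto simp: I_def fg_J ca_J shapeD[OF shv])
  have "\<exists>Y. (\<forall>j. Y j \<in> carrier_mat (mm j) (nn j)) \<and>
    (\<forall>x\<in>I. (case x of (i, u, v) \<Rightarrow> cm v (Au i u)) *
        S.tw (case x of (i, u, v) \<Rightarrow> tf v (fu i u)) (Y (case x of (i, u, v) \<Rightarrow> ca v (fu i u)))
          (Y (case x of (i, u, v) \<Rightarrow> ca v (fu i u))) * (case x of (i, u, v) \<Rightarrow> cm v (Mu i u)) -
      (case x of (i, u, v) \<Rightarrow> cm v (Nu i u)) *
        S.tw (case x of (i, u, v) \<Rightarrow> tf v (gu i u)) (Y (case x of (i, u, v) \<Rightarrow> ca v (gu i u)))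
          (Y (case x of (i, u, v) \<Rightarrow> ca v (gu i u))) * (case x of (i, u, v) \<Rightarrow> cm v (Bu i u)) =
      (case x of (i, u, v) \<Rightarrow> cm v (Cu i u)))"
  proof (rule S.twisted_roth[OF fd, where P = an and P' = an' and Q = "\<lambda>(i, u, v). cm v (Qu i u)" and Q' = "\<lambda>(i, u, v). cm v (Qu' i u)"
        and R = "\<lambda>(i, u, v). cm v (Ru i u)" and R' = "\<lambda>(i, u, v). cm v (Ru' i u)"], goal_cases)
    case (1 x)
    then obtain i u v where x: "x = (i, u, v)" and i: "i \<in> {1..s}"
      unfolding I_def by blast
    show ?case
      using shapeD(3)[OF shv[OF i]] by (simp add: x)
  next
    case (2 j)
    then show ?case
      by (rule anu)
  next
    case (3 x)
    then obtain i u v where x: "x = (i, u, v)" and i: "i \<in> {1..s}"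
      unfolding I_def by blast
    show ?case
      using Qv[OF i] by (simp add: x)
  next
    case (4 x)
    then obtain i u v where x: "x = (i, u, v)" and i: "i \<in> {1..s}"
      unfolding I_def by blast
    show ?case
      using Rv[OF i] by (simp add: x)
  next
    case (5 x)
    then obtain i u v where x: "x = (i, u, v)" and i: "i \<in> {1..s}"
      unfolding I_def by blast
    show ?case
      using simv[OF i, of u v] by (simp add: x block_similar_def)
  next
    case (6 x)
    then obtain i u v where x: "x = (i, u, v)" and i: "i \<in> {1..s}"
      unfolding I_def by blast
    show ?case
      using simv[OF i, of u v] by (simp add: x block_similar_def S.tw_def cm_an[OF fg_J(1)[OF i]])
  next
    case (7 x)
    then obtain i u v where x: "x = (i, u, v)" and i: "i \<in> {1..s}"
      unfolding I_def by blast
    show ?case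
      using simv[OF i, of u v] by (simp add: x block_similar_def S.tw_def cm_an[OF fg_J(2)[OF i]])
  qed
  then obtain Y where Yc: "\<And>j. Y j \<in> carrier_mat (mm j) (nn j)"
    and Yeq: "\<And>i u v. i \<in> {1..s} \<Longrightarrow> eqn (cm v (Au i u)) (cm v (Bu i u)) (cm v (Cu i u)) (cm v (Mu i u)) (cm v (Nu i u))
      (if tf v (fu i u) then map_mat \<tau> (Y (ca v (fu i u))) else Y (ca v (fu i u)))
      (if tf v (gu i u) then map_mat \<tau> (Y (ca v (gu i u))) else Y (ca v (gu i u)))"
    unfolding I_def S.tw_def eqn_def by force
  \<comment> \<open>\<open>Z\<close> is the matrix that actually stands in an equation conjugated
    according to \<open>v\<close>. Applying \<kappa> once more (\<open>T\<close>) and then \<dagger>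
    (\<open>W\<close>) transports it back, so each of the four choices of \<open>u\<close> and
    \<open>v\<close> solves the original equations with the X^\<sigma> still independent.\<close>
  define Z where "Z v j\<sigma> = (if tf v j\<sigma> then map_mat \<tau> (Y (ca v j\<sigma>)) else Y (ca v j\<sigma>))" for v j\<sigma>
  define T where "T v j\<sigma> = cm v (Z v j\<sigma>)" for v j\<sigma>
  have Zc: "Z v j\<sigma> \<in> carrier_mat (mm j\<sigma>) (nn j\<sigma>)" for v j\<sigma>
    using Yc[of "ca v j\<sigma>"] by (auto simp: Z_def)
  then have Tc: "T v j\<sigma> \<in> carrier_mat (mm j\<sigma>) (nn j\<sigma>)" for v j\<sigma>
    by (auto simp: T_def cm_def)
  have Teq: "eqn (Au i u) (Bu i u) (Cu i u) (Mu i u) (Nu i u) (T v (fu i u)) (T v (gu i u))"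
    if i: "i \<in> {1..s}" for i u v
  proof -
    have "eqn (cm v (Au i u)) (cm v (Bu i u)) (cm v (Cu i u)) (cm v (Mu i u)) (cm v (Nu i u))
        (Z v (fu i u)) (Z v (gu i u))"
      unfolding Z_def by (rule Yeq[OF i])
    then show ?thesis
      using eqn_map[OF auto_\<kappa> \<kappa>_\<kappa> shu[OF i] Zc Zc] by (cases v) (simp_all add: T_def cm_def)
  qed
  define W where "W u v j \<sigma> = (if u then dag (T v (j, dual_sup \<sigma>)) else T v (j, \<sigma>))" for u v j \<sigma>
  have Wc: "W u v j \<sigma> \<in> carrier_mat (srow (m j) (n j) \<sigma>) (scol (m j) (n j) \<sigma>)" for u v j \<sigma>
    using Tc[of v "(j, dual_sup \<sigma>)"] Tc[of v "(j, \<sigma>)"] by (simp add: W_def mm_def nn_def)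
  have Weq: "eqn (A i) (B i) (C i) (M i) (N i) (W u v (i1 i) (\<epsilon> i)) (W u v (i2 i) (\<delta> i))"
    if i: "i \<in> {1..s}" for i u v
  proof (cases u)
    case True
    have "eqn (A i) (B i) (C i) (M i) (N i) (dag (T v (i1 i, dual_sup (\<epsilon> i)))) (dag (T v (i2 i, dual_sup (\<delta> i))))"
      using Teq[OF i, of True v] Tc[of v "(i1 i, dual_sup (\<epsilon> i))"] Tc[of v "(i2 i, dual_sup (\<delta> i))"]
      by (intro eqn_dag[OF sh[OF i]])
        (simp_all add: Au_def Bu_def Cu_def Mu_def Nu_def fu_def gu_def mm_def nn_def p_def q_def p'_def q'_def)
    then show ?thesis
      using True by (simp add: W_def)
  next
    case False
    then show ?thesis
      using Teq[OF i, of False v] by (simp add: W_def Au_def Bu_def Cu_def Mu_def Nu_def fu_def gu_def)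
  qed
  \<comment> \<open>One quarter, for the average of four solutions. It is central and fixed by
    \<open>c\<close> and \<open>d\<close>, so scaling by it commutes with every superscript.\<close>
  define h :: 'a where "h = inverse 4"
  have h4: "h * 4 = 1"
    unfolding h_def by (rule left_inverse[OF four_neq_zero[OF char]])
  have h_comm: "h * a = a * h" for a
  proof -
    have "4 * a = a * 4" for a :: 'a
      using mult_of_nat_commute[of 4 a] by simp
    then have "h * (4 * a) * h = h * (a * 4) * h"
      by simp
    then have "(h * 4) * (a * h) = (h * a) * (4 * h)"
      by (simp only: mult.assoc)
    moreover have "4 * h = 1"
      unfolding h_def by (rule right_inverse[OF four_neq_zero[OF char]])
    ultimately show ?thesis
      by (simp add: h4)
  qed
  have h_fix: "f h = h" if "f 1 = 1" "\<And>a b. f (a + b) = f a + f b" "\<And>a b. f (a * b) = f a * f b \<or> f (a * b) = f b * f a"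
    for f :: "'a \<Rightarrow> 'a"
  proof -
    have "f (1 + 1 + (1 + 1)) = 1 + 1 + (1 + 1)"
      by (simp only: that(1,2))
    then have f4: "f 4 = 4"
      by simp
    have "f h * 4 = 1"
      using that(3)[of h 4] f4 h4 that(1) h_comm mult_of_nat_commute[of 4 "f h"] by auto
    then have "f h * 4 * h = h"
      by simp
    then show ?thesis
      using h4 h_comm[of 4] by (simp add: mult.assoc)
  qed
  have c_h: "c h = h" and d_h: "d h = h"
    by (rule h_fix; simp add: c_simps d_add d_mult)+
  define z where "z = Abs_center h"
  have z: "Rep_center z = h"
    unfolding z_def by (rule Abs_center_inverse) (unfold ring_center_def, use h_comm in blast)
  define S where "S j \<sigma> = W False False j \<sigma> + W False True j \<sigma> + (W True False j \<sigma> + W True True j \<sigma>)" for j \<sigma>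
  define X where "X j = center_smult z (S j One)" for j
  have X_sup: "superscript_mat c d \<sigma> (X j) = center_smult z (S j \<sigma>)" for j \<sigma>
  proof -
    let ?Y1 = "Y (j, One)" and ?Yc = "Y (j, Compl)" and ?Yd = "Y (j, Dagger)" and ?Ys = "Y (j, Star)"
    have Yj: "?Y1 \<in> carrier_mat (m j) (n j)" "?Yc \<in> carrier_mat (m j) (n j)"
      "?Yd \<in> carrier_mat (n j) (m j)" "?Ys \<in> carrier_mat (n j) (m j)"
      using Yc[of "(j, One)"] Yc[of "(j, Compl)"] Yc[of "(j, Dagger)"] Yc[of "(j, Star)"]
      by (simp_all add: mm_def nn_def)
    note dims = Yj[THEN carrier_matD(1)] Yj[THEN carrier_matD(2)]
    \<comment> \<open>Here \<tau> disappears, because \<open>\<kappa> o \<tau> = c\<close>.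
      Consequently a superscript \<sigma> carries the four summands of \<open>S j One\<close> to
      those of \<open>S j \<sigma>\<close> in another order, which is the dependence that the
      independent unknowns lacked.\<close>
    have \<kappa>\<tau>: "map_mat \<kappa> (map_mat \<tau> U) = map_mat c U" for U
      by (rule eq_matI) (auto simp: \<kappa>_def \<tau>_def)
    have S1: "S j One = ?Y1 + map_mat c ?Yc + (dag ?Yd + dag (map_mat \<kappa> ?Ys))"
      and S2: "S j Compl = ?Yc + map_mat c ?Y1 + (dag ?Ys + dag (map_mat \<kappa> ?Yd))"
      and S3: "S j Dagger = ?Yd + map_mat \<kappa> ?Ys + (dag ?Y1 + dag (map_mat c ?Yc))"
      and S4: "S j Star = ?Ys + map_mat \<kappa> ?Yd + (dag ?Yc + dag (map_mat c ?Y1))"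
      by (simp_all add: S_def W_def T_def Z_def cm_def tf_def ca_def \<kappa>\<tau>)
    show ?thesis
      by (cases \<sigma>; rule eq_matI)
        (auto simp: superscript_mat_eq X_def S1 S2 S3 S4 z dims dag_index c_simps c_h d_h d_add d_mult h_comm[symmetric]
          \<kappa>_def add.commute add.left_commute)
  qed
  have "A i * superscript_mat c d (\<epsilon> i) (X (i1 i)) * M i - N i * superscript_mat c d (\<delta> i) (X (i2 i)) * B i = C i"
    if i: "i \<in> {1..s}" for i
  proof -
    have W1: "W u v (i1 i) (\<epsilon> i) \<in> carrier_mat (p i) (q i)"
      and W2: "W u v (i2 i) (\<delta> i) \<in> carrier_mat (p' i) (q' i)" for u v
      unfolding p_def q_def p'_def q'_def by (rule Wc)+
    note sh2 = sh[OF i]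
    have CC: "shape (k i) (p i) (q i) (p' i) (q' i) (r i) (A i) (B i) (C i + C i) (M i) (N i)"
      "shape (k i) (p i) (q i) (p' i) (q' i) (r i) (A i) (B i) (C i + C i + (C i + C i)) (M i) (N i)"
      using sh2 by (simp_all add: shape_def)
    have Sc: "S (i1 i) (\<epsilon> i) \<in> carrier_mat (p i) (q i)" "S (i2 i) (\<delta> i) \<in> carrier_mat (p' i) (q' i)"
      unfolding S_def by (intro add_carrier_mat W1 W2)+
    have "eqn (A i) (B i) (C i + C i + (C i + C i)) (M i) (N i) (S (i1 i) (\<epsilon> i)) (S (i2 i) (\<delta> i))"
      unfolding S_def
      by (intro eqn_add[OF CC(1)] eqn_add[OF sh2] Weq[OF i] add_carrier_mat W1 W2)
    then have "eqn (A i) (B i) (center_smult z (C i + C i + (C i + C i))) (M i) (N i)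
        (center_smult z (S (i1 i) (\<epsilon> i))) (center_smult z (S (i2 i) (\<delta> i)))"
      by (rule eqn_center_smult[OF CC(2) Sc])
    moreover have "center_smult z (C i + C i + (C i + C i)) = C i"
    proof (rule eq_matI)
      fix a b assume "a < dim_row (C i)" "b < dim_col (C i)"
      moreover have "h * (x + x + (x + x)) = x" for x
      proof -
        have "(1 + 1 + (1 + 1)) * x = x + x + (x + x)"
          by (simp only: distrib_right mult_1_left)
        then have "x + x + (x + x) = 4 * x"
          by simp
        then show ?thesis
          using h4 by (simp flip: mult.assoc)
      qed
      ultimately show "center_smult z (C i + C i + (C i + C i)) $$ (a, b) = C i $$ (a, b)"
        by (simp add: z)
    qed simp_all
    ultimately show ?thesis
      unfolding X_sup eqn_def by simp
  qed
  moreover have "X j \<in> carrier_mat (m j) (n j)" for j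
    unfolding X_def S_def using Wc[of _ _ j One] by simp
  ultimately show ?thesis
    by blast
qed

text \<open>For \<open>Dagger\<close> and \<open>Star\<close>, transposing makes the matrix lower
  triangular and inverting changes the sign of its off-diagonal block; conjugation by J undoes both
  effects. This is what J is designed for.\<close>

lemma ang_unipotent:
  assumes X: "X \<in> carrier_mat m n"
  shows "ang m n \<sigma> (unipotent m n X) (unipotent m n (- X)) =
    unipotent (srow m n \<sigma>) (scol m n \<sigma>) (superscript_mat c d \<sigma> X)"
proof -
  have z: "- 0\<^sub>m a b = (0\<^sub>m a b :: 'a mat)" for a b
    by (rule eq_matI) auto
  have mc: "map_mat c (unipotent m n U) =
      unipotent m n (map_mat c U)" if "U \<in> carrier_mat m n" for U
    by (simp add: map_four_block_mat[OF one_carrier_mat that zero_carrier_mat one_carrier_mat]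
        map_mat_auto_one[OF auto_c] map_mat_auto_zero[OF auto_c])
  have mu: "map_mat c (- X) = - map_mat c X"
    by (rule eq_matI) (auto simp: c_simps)
  have ad: "adj m n m n (unipotent m n (- U)) =
      unipotent n m (dag U)" if U: "U \<in> carrier_mat m n" for U
  proof -
    have "- U \<in> carrier_mat m n"
      using U by simp
    then show ?thesis
      by (simp add: adj_four_block[OF one_carrier_mat _ zero_carrier_mat one_carrier_mat] z dag_uminus)
  qed
  show ?thesis
    using X mc[of X] mc[of "- X"] mu ad[of X] ad[of "map_mat c X"]
    by (cases \<sigma>) (simp_all add: ang_def superscript_mat_eq del: superscript_mat.simps)
qed

end

lemma unipotent_mult:
  fixes X Y :: "'a::ring_1 mat"
  assumes "X \<in> carrier_mat m n" "Y \<in> carrier_mat m n"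
  shows "unipotent m n X * unipotent m n Y =
    unipotent m n (Y + X)"
  by (subst mult_four_block_mat[OF one_carrier_mat assms(1) zero_carrier_mat one_carrier_mat
        one_carrier_mat assms(2) zero_carrier_mat one_carrier_mat])
    (simp add: left_mult_one_mat[OF assms(2)] right_mult_one_mat[OF assms(1)] left_mult_zero_mat[OF assms(2)]
      right_mult_zero_mat[OF assms(1)])

lemma inverse_pair_unipotent:
  fixes X :: "'a::ring_1 mat"
  assumes X: "X \<in> carrier_mat m n"
  shows "inverse_pair (m + n) (unipotent m n X) (unipotent m n (- X))"
proof -
  have "- X + X = 0\<^sub>m m n" "X + - X = 0\<^sub>m m n"
    using X by (auto intro!: eq_matI)
  moreover have "- X \<in> carrier_mat m n"
    using X by simp
  ultimately show ?thesis
    using X by (simp add: inverse_pair_def unipotent_mult)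
qed

text \<open>The size of the inverse is not part of \<open>invertible_mat\<close>; it is recovered by
  comparing dimensions in the two products.\<close>

lemma inverse_pair_iff_invertible:
  "(A \<in> carrier_mat l l \<and> invertible_mat A) \<longleftrightarrow> (\<exists>B. inverse_pair l A B)"
proof
  assume A: "A \<in> carrier_mat l l \<and> invertible_mat A"
  then obtain B where "A * B = 1\<^sub>m (dim_row A)" and AB2: "B * A = 1\<^sub>m (dim_row B)"
    unfolding invertible_mat_def inverts_mat_def by blast
  then have AB: "A * B = 1\<^sub>m l" "B * A = 1\<^sub>m (dim_row B)"
    using A by auto
  have "dim_col B = l"
    using arg_cong[OF AB(1), of dim_col] by simp
  moreover have "dim_row B = l"
    using arg_cong[OF AB(2), of dim_col] carrier_matD(2)[of A l l] A by simp
  ultimately show "\<exists>B. inverse_pair l A B"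
    using A AB by (auto simp: inverse_pair_def intro!: exI[of _ B])
next
  assume "\<exists>B. inverse_pair l A B"
  then show "A \<in> carrier_mat l l \<and> invertible_mat A"
    unfolding inverse_pair_def invertible_mat_def inverts_mat_def by auto
qed

text \<open>The off-diagonal blocks \<open>U * M\<close> and \<open>N * V\<close> are chosen so that
  the second and third equalities hold for any \<open>U\<close> and \<open>V\<close>. The first one
  then differs only in its upper right block, where it reads
  \<open>A * (U * M) = C + N * V * B\<close>, the given equation.\<close>

lemma block_similar_unipotent:
  fixes A :: "'a::ring_1 mat"
  assumes sh: "shape k p q p' q' r A B C M N" and U: "U \<in> carrier_mat p q" and V: "V \<in> carrier_mat p' q'"
    and e: "eqn A B C M N U V"
  shows "block_similar p q' A B C M N
    (unipotent p q U) (unipotent p' q' V)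
    (unipotent p r (U * M)) (unipotent k q' (N * V))"
proof -
  note c = shapeD[OF sh]
  note UM = mult_carrier_mat[OF U c(4)] and NV = mult_carrier_mat[OF c(5) V]
  note ze = zero_carrier_mat and on = one_carrier_mat
  note d = carrier_matD[OF c(1)] carrier_matD[OF c(2)] carrier_matD[OF c(3)] carrier_matD[OF c(4)]
    carrier_matD[OF c(5)] carrier_matD[OF U] carrier_matD[OF V]
  have S: "A * (U * M) \<in> carrier_mat k r" "N * V * B \<in> carrier_mat k r"
    by (rule mult_carrier_mat[OF c(1) UM] mult_carrier_mat[OF NV c(2)])+
  have "S - T = C \<Longrightarrow> S = C + T" if "S \<in> carrier_mat k r" "T \<in> carrier_mat k r" for S T
    using that by (auto intro!: eq_matI)
  from this[OF S] have eq: "A * (U * M) = C + N * V * B"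
    using e assoc_mult_mat[OF c(1) U c(4)] unfolding eqn_def by simp
  have "four_block_mat A (0\<^sub>m k r) (0\<^sub>m q' p) B * unipotent p r (U * M) =
      four_block_mat A (A * (U * M)) (0\<^sub>m q' p) B"
    by (subst mult_four_block_mat[OF c(1) ze ze c(2) on UM ze on])
      (use c S in \<open>simp add: left_mult_zero_mat[OF UM] right_mult_zero_mat[OF c(2)]\<close>)
  moreover have "unipotent k q' (N * V) * four_block_mat A C (0\<^sub>m q' p) B =
      four_block_mat A (C + N * V * B) (0\<^sub>m q' p) B"
    by (subst mult_four_block_mat[OF on NV ze on c(1) c(3) ze c(2)])
      (use c S in \<open>simp add: right_mult_zero_mat[OF NV] left_mult_zero_mat[OF c(1)] left_mult_zero_mat[OF c(3)]\<close>)
  moreover have "four_block_mat (1\<^sub>m p) (0\<^sub>m p r) (0\<^sub>m q p) M * unipotent p r (U * M) =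
      four_block_mat (1\<^sub>m p) (U * M) (0\<^sub>m q p) M"
    by (subst mult_four_block_mat[OF on ze ze c(4) on UM ze on])
      (use c UM in \<open>simp add: left_mult_one_mat[OF UM] right_add_zero_mat[OF UM] left_mult_zero_mat[OF UM] right_mult_zero_mat[OF c(4)]\<close>)
  moreover have "unipotent p q U * four_block_mat (1\<^sub>m p) (0\<^sub>m p r) (0\<^sub>m q p) M =
      four_block_mat (1\<^sub>m p) (U * M) (0\<^sub>m q p) M"
    by (subst mult_four_block_mat[OF on U ze on on ze ze c(4)])
      (use c UM in \<open>simp add: right_mult_zero_mat[OF U]\<close>)
  moreover have "four_block_mat N (0\<^sub>m k q') (0\<^sub>m q' p') (1\<^sub>m q') * unipotent p' q' V =
      four_block_mat N (N * V) (0\<^sub>m q' p') (1\<^sub>m q')"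
    by (subst mult_four_block_mat[OF c(5) ze ze on on V ze on])
      (use c NV in \<open>simp add: left_mult_zero_mat[OF V]\<close>)
  moreover have "unipotent k q' (N * V) * four_block_mat N (0\<^sub>m k q') (0\<^sub>m q' p') (1\<^sub>m q') =
      four_block_mat N (N * V) (0\<^sub>m q' p') (1\<^sub>m q')"
    by (subst mult_four_block_mat[OF on NV ze on c(5) ze ze on])
      (use c NV in \<open>simp add: right_mult_one_mat[OF NV] right_mult_zero_mat[OF NV] left_mult_zero_mat[OF c(5)]\<close>)
  ultimately show ?thesis
    unfolding block_similar_def by (simp add: d eq)
qed

theorem theorem2:
  fixes c d :: "'a::division_ring \<Rightarrow> 'a"
    and s t :: nat
    and m n k r :: "nat \<Rightarrow> nat"
    and i1 i2 :: "nat \<Rightarrow> nat"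
    and \<epsilon> \<delta> :: "nat \<Rightarrow> superscript"
    and A B C M N :: "nat \<Rightarrow> 'a mat"
  defines "p \<equiv> \<lambda>i. superscript_rows (\<epsilon> i) (m (i1 i)) (n (i1 i))"
    and "q \<equiv> \<lambda>i. superscript_cols (\<epsilon> i) (m (i1 i)) (n (i1 i))"
    and "p' \<equiv> \<lambda>i. superscript_rows (\<delta> i) (m (i2 i)) (n (i2 i))"
    and "q' \<equiv> \<lambda>i. superscript_cols (\<delta> i) (m (i2 i)) (n (i2 i))"
  assumes "CHAR('a) \<noteq> 2"
    and "finite_dimensional_over_center TYPE('a)"
    and "involutory_automorphism c"
    and "involutory_anti_automorphism d"
    and "\<And>i. i \<in> {1..s} \<Longrightarrow> i1 i \<in> {1..t}"
    and "\<And>i. i \<in> {1..s} \<Longrightarrow> i2 i \<in> {1..t}"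
    and "\<And>i. i \<in> {1..s} \<Longrightarrow> A i \<in> carrier_mat (k i) (p i)"
    and "\<And>i. i \<in> {1..s} \<Longrightarrow> M i \<in> carrier_mat (q i) (r i)"
    and "\<And>i. i \<in> {1..s} \<Longrightarrow> N i \<in> carrier_mat (k i) (p' i)"
    and "\<And>i. i \<in> {1..s} \<Longrightarrow> B i \<in> carrier_mat (q' i) (r i)"
    and "\<And>i. i \<in> {1..s} \<Longrightarrow> C i \<in> carrier_mat (k i) (r i)"
  shows "(\<exists>X. (\<forall>j\<in>{1..t}. X j \<in> carrier_mat (m j) (n j)) \<and>
              (\<forall>i\<in>{1..s}. A i * superscript_mat c d (\<epsilon> i) (X (i1 i)) * M i
                        - N i * superscript_mat c d (\<delta> i) (X (i2 i)) * B i = C i))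
     \<longleftrightarrow>
         (\<exists>P Q R.
            (\<forall>j\<in>{1..t}. P j \<in> carrier_mat (m j + n j) (m j + n j) \<and> invertible_mat (P j)) \<and>
            (\<forall>i\<in>{1..s}. Q i \<in> carrier_mat (p i + r i) (p i + r i) \<and> invertible_mat (Q i)) \<and>
            (\<forall>i\<in>{1..s}. R i \<in> carrier_mat (k i + q' i) (k i + q' i) \<and> invertible_mat (R i)) \<and>
            (\<forall>i\<in>{1..s}.
               diag_block_mat2 (A i) (B i) * Q i
                 = R i * four_block_mat (A i) (C i) (0\<^sub>m (q' i) (p i)) (B i) \<and>
               diag_block_mat2 (1\<^sub>m (p i)) (M i) * Q i
                 = angle_mat c d (m (i1 i)) (n (i1 i)) (\<epsilon> i) (P (i1 i))
                   * diag_block_mat2 (1\<^sub>m (p i)) (M i) \<and>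
               diag_block_mat2 (N i) (1\<^sub>m (q' i))
                   * angle_mat c d (m (i2 i)) (n (i2 i)) (\<delta> i) (P (i2 i))
                 = R i * diag_block_mat2 (N i) (1\<^sub>m (q' i))))"
proof -
  have auto_c: "skew_field_auto c"
    using assms(7) unfolding involutory_automorphism_def skew_field_auto_def by blast
  interpret conjugations c d
  proof
    show "skew_field_auto c"
      by (rule auto_c)
    show "c (c a) = a" for a
      using assms(7) unfolding involutory_automorphism_def by blast
    show "skew_field_anti_auto d"
      using assms(8) unfolding involutory_anti_automorphism_def skew_field_anti_auto_def by blast
  qed
  have sh: "shape (k i) (p i) (q i) (p' i) (q' i) (r i) (A i) (B i) (C i) (M i) (N i)" if "i \<in> {1..s}" for i
    using assms(11-15)[OF that] by (simp add: shape_def)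
  show ?thesis (is "?L \<longleftrightarrow> ?R")
  proof
    assume ?L
    then obtain X where X: "\<And>j. j \<in> {1..t} \<Longrightarrow> X j \<in> carrier_mat (m j) (n j)"
      and eq: "\<And>i. i \<in> {1..s} \<Longrightarrow> eqn (A i) (B i) (C i) (M i) (N i)
        (superscript_mat c d (\<epsilon> i) (X (i1 i))) (superscript_mat c d (\<delta> i) (X (i2 i)))"
      unfolding eqn_def by blast
    define P where "P j = unipotent (m j) (n j) (X j)" for j
    define P' where "P' j = unipotent (m j) (n j) (- X j)" for j
    define Q where "Q i = unipotent (p i) (r i) (superscript_mat c d (\<epsilon> i) (X (i1 i)) * M i)" for i
    define R where "R i = unipotent (k i) (q' i) (N i * superscript_mat c d (\<delta> i) (X (i2 i)))" for i
    have P: "inverse_pair (m j + n j) (P j) (P' j)" if "j \<in> {1..t}" for j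
      unfolding P_def P'_def by (rule inverse_pair_unipotent[OF X[OF that]])
    have ang: "angle_mat c d (m j) (n j) \<sigma> (P j) = unipotent (srow (m j) (n j) \<sigma>) (scol (m j) (n j) \<sigma>) (superscript_mat c d \<sigma> (X j))" if j: "j \<in> {1..t}" for j \<sigma>
      unfolding angle_mat_eq_ang[OF inverse_pairD[OF P[OF j]]] unfolding P_def P'_def
      by (rule ang_unipotent[OF X[OF j]])
    have Xc: "superscript_mat c d (\<epsilon> i) (X (i1 i)) \<in> carrier_mat (p i) (q i)"
      "superscript_mat c d (\<delta> i) (X (i2 i)) \<in> carrier_mat (p' i) (q' i)" if i: "i \<in> {1..s}" for i
      unfolding p_def q_def p'_def q'_def
      by (rule superscript_carrier[OF X[OF assms(9)[OF i]]] superscript_carrier[OF X[OF assms(10)[OF i]]])+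
    have sim: "block_similar (p i) (q' i) (A i) (B i) (C i) (M i) (N i)
        (angle_mat c d (m (i1 i)) (n (i1 i)) (\<epsilon> i) (P (i1 i))) (angle_mat c d (m (i2 i)) (n (i2 i)) (\<delta> i) (P (i2 i)))
        (Q i) (R i)" if i: "i \<in> {1..s}" for i
      using block_similar_unipotent[OF sh[OF i] Xc[OF i] eq[OF i]]
      unfolding ang[OF assms(9)[OF i]] ang[OF assms(10)[OF i]] Q_def R_def p_def q_def p'_def q'_def .
    have "Q i \<in> carrier_mat (p i + r i) (p i + r i) \<and> invertible_mat (Q i)"
      "R i \<in> carrier_mat (k i + q' i) (k i + q' i) \<and> invertible_mat (R i)" if i: "i \<in> {1..s}" for i
      unfolding inverse_pair_iff_invertible Q_def R_def
      using inverse_pair_unipotent[OF mult_carrier_mat[OF Xc(1)[OF i] shapeD(4)[OF sh[OF i]]]]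
        inverse_pair_unipotent[OF mult_carrier_mat[OF shapeD(5)[OF sh[OF i]] Xc(2)[OF i]]] by blast+
    moreover have "P j \<in> carrier_mat (m j + n j) (m j + n j) \<and> invertible_mat (P j)" if "j \<in> {1..t}" for j
      unfolding inverse_pair_iff_invertible using P[OF that] by blast
    ultimately show ?R
      using sim unfolding block_similar_def by blast
  next
    assume ?R
    then obtain P Q R where P: "\<And>j. j \<in> {1..t} \<Longrightarrow> \<exists>P'. inverse_pair (m j + n j) (P j) P'"
      and Q: "\<And>i. i \<in> {1..s} \<Longrightarrow> \<exists>Q'. inverse_pair (p i + r i) (Q i) Q'"
      and R: "\<And>i. i \<in> {1..s} \<Longrightarrow> \<exists>R'. inverse_pair (k i + q' i) (R i) R'"
      and sim: "\<And>i. i \<in> {1..s} \<Longrightarrow> block_similar (p i) (q' i) (A i) (B i) (C i) (M i) (N i)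
        (angle_mat c d (m (i1 i)) (n (i1 i)) (\<epsilon> i) (P (i1 i))) (angle_mat c d (m (i2 i)) (n (i2 i)) (\<delta> i) (P (i2 i)))
        (Q i) (R i)"
      unfolding inverse_pair_iff_invertible block_similar_def by blast
    obtain P' where P': "\<And>j. j \<in> {1..t} \<Longrightarrow> inverse_pair (m j + n j) (P j) (P' j)"
      using P by metis
    obtain Q' where Q': "\<And>i. i \<in> {1..s} \<Longrightarrow> inverse_pair (p i + r i) (Q i) (Q' i)"
      using Q by metis
    obtain R' where R': "\<And>i. i \<in> {1..s} \<Longrightarrow> inverse_pair (k i + q' i) (R i) (R' i)"
      using R by metis
    have "block_similar (p i) (q' i) (A i) (B i) (C i) (M i) (N i)
        (ang (m (i1 i)) (n (i1 i)) (\<epsilon> i) (P (i1 i)) (P' (i1 i)))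
        (ang (m (i2 i)) (n (i2 i)) (\<delta> i) (P (i2 i)) (P' (i2 i))) (Q i) (R i)" if i: "i \<in> {1..s}" for i
      using sim[OF i] unfolding angle_mat_eq_ang[OF inverse_pairD[OF P'[OF assms(9)[OF i]]]]
        angle_mat_eq_ang[OF inverse_pairD[OF P'[OF assms(10)[OF i]]]] .
    note sim' = this
    show ?L
      by (rule similar_imp_solvable[where s = s and t = t and m = m and n = n and k = k and r = r and ?i1.0 = i1 and ?i2.0 = i2
            and \<epsilon> = \<epsilon> and \<delta> = \<delta> and A = A and B = B and C = C and M = M and N = N and P = P and P' = P'
            and Q = Q and Q' = Q' and R = R and R' = R',
            OF assms(5,6,9,10) sh[unfolded p_def q_def p'_def q'_def] P' Q'[unfolded p_def] R'[unfolded q'_def]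
              sim'[unfolded p_def q'_def]])
  qed
qed

end
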